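(* Let $R$ and $R'$ be commutative rings, let $A$ be an Azumaya algebra over $R$, let $A'$ be an Azumaya algebra over $R'$, and let $\phi: A \to A'$ be a ring homomorphism. Then $\phi$ is an isomorphism if and only if both of the following hold: (i) $\phi$ induces (by restriction to $R = Z(A)$) an isomorphism from $R$ onto $R' = Z(A')$; (ii) for every maximal ideal $\mathfrak{m}$ of $R$, $\mathrm{rk}_{R_{\mathfrak{m}}} A_{\mathfrak{m}} = \mathrm{rk}_{R'_{\phi(\mathfrak{m})}} A'_{\phi(\mathfrak{m})}$, where $\phi(\mathfrak{m})$ is the maximal ideal of $R'$ corresponding to $\mathfrak{m}$ under the isomorphism in (i).
   Context: Rings are associative with unit and ring homomorphisms preserve the unit; $\phi$ is not assumed to be linear over any base ring. An Azumaya algebra over a commutative ring $R$ is an $R$-algebra $A$ (not necessarily commutative) which is a finitely generated faithful $R$-module such that for each maximal ideal $\mathfrak{m}$ of $R$ the quotient $A/\mathfrak{m}A$ is a central simple $R/\mathfrak{m}$-algebra. It is a standard fact that then $A$ is a finitely generated projective $R$-module whose center $Z(A)$ is $R\cdot 1_A \cong R$; the ring $R$ is identified with its image $R \cdot 1_A$ in $A$. For a maximal ideal $\mathfrak{m}$ of $R$, $A_{\mathfrak{m}} = A \otimes_R R_{\mathfrak{m}}$ is a free $R_{\mathfrak{m}}$-module of finite rank, denoted $\mathrm{rk}_{R_{\mathfrak{m}}} A_{\mathfrak{m}}$. *)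

theory Defs
  imports "HOL-Algebra.Algebra"
begin

section \<open>Modules and algebras\<close>

text \<open>
  The library locale \<open>algebra\<close> makes the algebra itself commutative, so the
  not necessarily commutative notion is introduced here.
\<close>

locale assoc_algebra = module R A + ring A for R (structure) and A (structure) +
  assumes smult_mult_left:
      "\<lbrakk>r \<in> carrier R; a \<in> carrier A; b \<in> carrier A\<rbrakk>
        \<Longrightarrow> (r \<odot>\<^bsub>A\<^esub> a) \<otimes>\<^bsub>A\<^esub> b = r \<odot>\<^bsub>A\<^esub> (a \<otimes>\<^bsub>A\<^esub> b)"
    and smult_mult_right:
      "\<lbrakk>r \<in> carrier R; a \<in> carrier A; b \<in> carrier A\<rbrakk>
        \<Longrightarrow> a \<otimes>\<^bsub>A\<^esub> (r \<odot>\<^bsub>A\<^esub> b) = r \<odot>\<^bsub>A\<^esub> (a \<otimes>\<^bsub>A\<^esub> b)"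

definition fin_gen_module :: "('r, 'p) ring_scheme \<Rightarrow> ('r, 'a, 'q) module_scheme \<Rightarrow> bool" where
  "fin_gen_module R M \<longleftrightarrow>
     (\<exists>B. finite B \<and> B \<subseteq> carrier M \<and>
        (\<forall>x \<in> carrier M. \<exists>c \<in> B \<rightarrow> carrier R. x = (\<Oplus>\<^bsub>M\<^esub>b\<in>B. c b \<odot>\<^bsub>M\<^esub> b)))"

definition faithful_module :: "('r, 'p) ring_scheme \<Rightarrow> ('r, 'a, 'q) module_scheme \<Rightarrow> bool" where
  "faithful_module R M \<longleftrightarrow>
     (\<forall>r \<in> carrier R. (\<forall>x \<in> carrier M. r \<odot>\<^bsub>M\<^esub> x = \<zero>\<^bsub>M\<^esub>) \<longrightarrow> r = \<zero>\<^bsub>R\<^esub>)"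

definition finite_basis :: "('r, 'p) ring_scheme \<Rightarrow> ('r, 'a, 'q) module_scheme \<Rightarrow> 'a set \<Rightarrow> bool" where
  "finite_basis R M B \<longleftrightarrow>
     finite B \<and> B \<subseteq> carrier M \<and>
     (\<forall>x \<in> carrier M. \<exists>!c. c \<in> B \<rightarrow>\<^sub>E carrier R \<and> x = (\<Oplus>\<^bsub>M\<^esub>b\<in>B. c b \<odot>\<^bsub>M\<^esub> b))"

text \<open>
  The rank is only meaningful for a module that is free of finite rank over a nonzero
  commutative ring; otherwise the description below has no specified value.
\<close>

definition free_rank :: "('r, 'p) ring_scheme \<Rightarrow> ('r, 'a, 'q) module_scheme \<Rightarrow> nat" where
  "free_rank R M = (THE n. \<exists>B. finite_basis R M B \<and> card B = n)"


section \<open>Azumaya algebras\<close>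

definition center :: "('a, 'q) ring_scheme \<Rightarrow> 'a set" where
  "center A = {z \<in> carrier A. \<forall>a \<in> carrier A. z \<otimes>\<^bsub>A\<^esub> a = a \<otimes>\<^bsub>A\<^esub> z}"

definition center_ring :: "('a, 'q) ring_scheme \<Rightarrow> ('a, 'q) ring_scheme" where
  "center_ring A = A\<lparr>carrier := center A\<rparr>"

definition simple_ring :: "('a, 'q) ring_scheme \<Rightarrow> bool" where
  "simple_ring A \<longleftrightarrow> ring A \<and> carrier A \<noteq> {\<zero>\<^bsub>A\<^esub>} \<and>
     (\<forall>I. ideal I A \<longrightarrow> I = {\<zero>\<^bsub>A\<^esub>} \<or> I = carrier A)"

definition central_simple_algebra ::
    "('r, 'p) ring_scheme \<Rightarrow> ('r, 'a, 'q) module_scheme \<Rightarrow> bool" where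
  "central_simple_algebra K A \<longleftrightarrow>
     field K \<and> assoc_algebra K A \<and> fin_gen_module K A \<and> simple_ring A \<and>
     center A = {k \<odot>\<^bsub>A\<^esub> \<one>\<^bsub>A\<^esub> | k. k \<in> carrier K}"

text \<open>The submodule \<open>I A\<close>, the additive subgroup generated by the products \<open>r a\<close>.\<close>

definition ideal_smult :: "'r set \<Rightarrow> ('r, 'a, 'q) module_scheme \<Rightarrow> 'a set" where
  "ideal_smult I A = generate (add_monoid A) {r \<odot>\<^bsub>A\<^esub> a | r a. r \<in> I \<and> a \<in> carrier A}"

text \<open>
  The quotient \<open>A / I A\<close> as an algebra over \<open>R / I\<close>. Scalar multiplication is given on
  cosets as a union over representatives, in the style of \<^const>\<open>rcoset_mult\<close>.
\<close>

definition quot_algebra :: "'r set \<Rightarrow> ('r, 'a, 'q) module_scheme \<Rightarrow> ('r set, 'a set) module" where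
  "quot_algebra I A =
     \<lparr>carrier = carrier (A Quot ideal_smult I A),
      monoid.mult = monoid.mult (A Quot ideal_smult I A),
      one = monoid.one (A Quot ideal_smult I A),
      ring.zero = ring.zero (A Quot ideal_smult I A),
      add = ring.add (A Quot ideal_smult I A),
      smult = (\<lambda>U V. \<Union>r\<in>U. \<Union>a\<in>V. ideal_smult I A +>\<^bsub>A\<^esub> (r \<odot>\<^bsub>A\<^esub> a))\<rparr>"

locale azumaya_algebra = assoc_algebra R A for R (structure) and A (structure) +
  assumes fin_gen: "fin_gen_module R A"
    and faithful: "faithful_module R A"
    and central_simple_fibre:
      "maximalideal \<mm> R \<Longrightarrow> central_simple_algebra (R Quot \<mm>) (quot_algebra \<mm> A)"


section \<open>Localization and base change\<close>

definition frac_rel :: "('r, 'p) ring_scheme \<Rightarrow> 'r set \<Rightarrow> (('r \<times> 'r) \<times> ('r \<times> 'r)) set" where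
  "frac_rel R S = {((a, s), (b, t)).
     a \<in> carrier R \<and> b \<in> carrier R \<and> s \<in> S \<and> t \<in> S \<and>
     (\<exists>u \<in> S. u \<otimes>\<^bsub>R\<^esub> (t \<otimes>\<^bsub>R\<^esub> a \<ominus>\<^bsub>R\<^esub> s \<otimes>\<^bsub>R\<^esub> b) = \<zero>\<^bsub>R\<^esub>)}"

definition fraction :: "('r, 'p) ring_scheme \<Rightarrow> 'r set \<Rightarrow> 'r \<Rightarrow> 'r \<Rightarrow> ('r \<times> 'r) set" where
  "fraction R S a s = frac_rel R S `` {(a, s)}"

text \<open>
  The ring of fractions of \<open>R\<close> with denominators in \<open>S\<close>. The record also carries its
  structure of an \<open>R\<close>-module, so it serves both as a ring and as an \<open>R\<close>-algebra.
\<close>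

definition localization :: "('r, 'p) ring_scheme \<Rightarrow> 'r set \<Rightarrow> ('r, ('r \<times> 'r) set) module" where
  "localization R S =
     \<lparr>carrier = (carrier R \<times> S) // frac_rel R S,
      monoid.mult = (\<lambda>U V. \<Union>(a, s)\<in>U. \<Union>(b, t)\<in>V. fraction R S (a \<otimes>\<^bsub>R\<^esub> b) (s \<otimes>\<^bsub>R\<^esub> t)),
      one = fraction R S \<one>\<^bsub>R\<^esub> \<one>\<^bsub>R\<^esub>,
      ring.zero = fraction R S \<zero>\<^bsub>R\<^esub> \<one>\<^bsub>R\<^esub>,
      add = (\<lambda>U V. \<Union>(a, s)\<in>U. \<Union>(b, t)\<in>V.
               fraction R S (t \<otimes>\<^bsub>R\<^esub> a \<oplus>\<^bsub>R\<^esub> s \<otimes>\<^bsub>R\<^esub> b) (s \<otimes>\<^bsub>R\<^esub> t)),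
      smult = (\<lambda>r U. \<Union>(a, s)\<in>U. fraction R S (r \<otimes>\<^bsub>R\<^esub> a) s)\<rparr>"

definition local_ring_at :: "('r, 'p) ring_scheme \<Rightarrow> 'r set \<Rightarrow> ('r, ('r \<times> 'r) set) module" where
  "local_ring_at R \<pp> = localization R (carrier R - \<pp>)"

text \<open>
  \<open>M \<otimes>\<^sub>R N\<close> is the free abelian group on \<open>M \<times> N\<close> modulo the subgroup generated by the
  bilinearity and balancing relations.
\<close>

definition tensor_relators ::
    "('r, 'p) ring_scheme \<Rightarrow> ('r, 'a, 'q) module_scheme \<Rightarrow> ('r, 'b, 's) module_scheme
      \<Rightarrow> ('a \<times> 'b \<Rightarrow>\<^sub>0 int) set" where
  "tensor_relators R M N =
     {frag_of (x \<oplus>\<^bsub>M\<^esub> x', y) - frag_of (x, y) - frag_of (x', y) | x x' y.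
        x \<in> carrier M \<and> x' \<in> carrier M \<and> y \<in> carrier N} \<union>
     {frag_of (x, y \<oplus>\<^bsub>N\<^esub> y') - frag_of (x, y) - frag_of (x, y') | x y y'.
        x \<in> carrier M \<and> y \<in> carrier N \<and> y' \<in> carrier N} \<union>
     {frag_of (r \<odot>\<^bsub>M\<^esub> x, y) - frag_of (x, r \<odot>\<^bsub>N\<^esub> y) | r x y.
        r \<in> carrier R \<and> x \<in> carrier M \<and> y \<in> carrier N}"

definition tensor_kernel ::
    "('r, 'p) ring_scheme \<Rightarrow> ('r, 'a, 'q) module_scheme \<Rightarrow> ('r, 'b, 's) module_scheme
      \<Rightarrow> ('a \<times> 'b \<Rightarrow>\<^sub>0 int) set" where
  "tensor_kernel R M N =
     generate (free_Abelian_group (carrier M \<times> carrier N)) (tensor_relators R M N)"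

definition tensor_group ::
    "('r, 'p) ring_scheme \<Rightarrow> ('r, 'a, 'q) module_scheme \<Rightarrow> ('r, 'b, 's) module_scheme
      \<Rightarrow> ('a \<times> 'b \<Rightarrow>\<^sub>0 int) set monoid" where
  "tensor_group R M N =
     free_Abelian_group (carrier M \<times> carrier N) Mod tensor_kernel R M N"

text \<open>
  For an \<open>R\<close>-algebra \<open>B\<close>, the \<open>B\<close>-module \<open>M \<otimes>\<^sub>R B\<close> with \<open>s (x \<otimes> y) = x \<otimes> (s y)\<close>. Only the
  module structure is of interest; the multiplicative fields, which every module record
  has, are left unspecified.
\<close>

definition base_change ::
    "('r, 'p) ring_scheme \<Rightarrow> ('r, 'a, 'q) module_scheme \<Rightarrow> ('r, 'b, 's) module_scheme
      \<Rightarrow> ('b, ('a \<times> 'b \<Rightarrow>\<^sub>0 int) set) module" where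
  "base_change R M B =
     \<lparr>carrier = carrier (tensor_group R M B),
      monoid.mult = undefined,
      one = undefined,
      ring.zero = \<one>\<^bsub>tensor_group R M B\<^esub>,
      add = monoid.mult (tensor_group R M B),
      smult = (\<lambda>s U. \<Union>c\<in>U. tensor_kernel R M B
        #>\<^bsub>free_Abelian_group (carrier M \<times> carrier B)\<^esub>
          frag_extend (\<lambda>(x, y). frag_of (x, s \<otimes>\<^bsub>B\<^esub> y)) c)\<rparr>"

definition local_rank :: "('r, 'p) ring_scheme \<Rightarrow> 'r set \<Rightarrow> ('r, 'a, 'q) module_scheme \<Rightarrow> nat" where
  "local_rank R \<pp> M =
     free_rank (local_ring_at R \<pp>) (base_change R M (local_ring_at R \<pp>))"


section \<open>The ideal corresponding to an ideal of the base ring\<close>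

text \<open>
  \<open>\<phi>(\<mm>)\<close>, where \<open>R\<close> and \<open>R'\<close> are identified with their images
  \<open>R 1\<close> and \<open>R' 1\<close> in the algebras; intended for \<open>\<phi>\<close> mapping \<open>R 1\<close> onto \<open>R' 1\<close>.
\<close>

definition corresponding_ideal ::
    "('r, 'a, 'q) module_scheme \<Rightarrow> ('r2, 'p2) ring_scheme \<Rightarrow> ('r2, 'a2, 'q2) module_scheme
      \<Rightarrow> ('a \<Rightarrow> 'a2) \<Rightarrow> 'r set \<Rightarrow> 'r2 set" where
  "corresponding_ideal A R' A' \<phi> \<mm> =
     {r' \<in> carrier R'. \<exists>r \<in> \<mm>. \<phi> (r \<odot>\<^bsub>A\<^esub> \<one>\<^bsub>A\<^esub>) = r' \<odot>\<^bsub>A'\<^esub> \<one>\<^bsub>A'\<^esub>}"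

end

theory Submission
  imports Defs
begin

text \<open>
  All local information is read off from the multiplication maps, the sums of maps
  \<open>a \<mapsto> u a v\<close>. At a maximal ideal \<open>\<mm>\<close>, simplicity and centrality of the fibre give, by a density
  argument, dual systems: elements \<open>c\<close> of \<open>A\<close> with multiplication maps \<open>h c\<close> satisfying
  \<open>h c d \<equiv> \<delta>\<close> modulo \<open>\<mm> A\<close>. They show that a multiplication map with values in \<open>\<mm> A\<close> lies in \<open>\<mm>\<close>
  times the multiplication maps, and Nakayama's lemma then produces a multiplication map \<open>e\<close>
  with central values and \<open>e \<one> = t \<one>\<close>, \<open>t \<equiv> 1\<close> modulo \<open>\<mm>\<close>. Hence the center is \<open>R \<one>\<close>, the maps
  \<open>e \<circ> h c\<close> are linear forms, and a dual system that spans \<open>A\<close> modulo \<open>\<mm> A\<close> is a basis of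
  \<open>A\<close> at \<open>\<mm>\<close>; its cardinality is the local rank.

  A homomorphism \<open>\<phi>\<close> that is an isomorphism on centers maps dual systems to dual systems. So the
  image of a spanning dual system of \<open>A\<close> extends to a spanning one of \<open>A'\<close>; if the ranks agree it
  already is one, whence \<open>\<phi>\<close> is bijective locally, and therefore bijective.
\<close>

section \<open>Linear spans, Nakayama's lemma and maximal ideals\<close>

text \<open>The definition of an Azumaya algebra used here gives finite generation, faithfulness and
  central simple fibres only; the center and local freeness have to be derived. What the fibres say
  concerns maps modulo \<open>mA\<close>, and Nakayama's lemma must lift it. That lemma requires
  commutative scalars and finitely many generators, whereas multiplication maps form a
  noncommutative ring; hence the search for a commutative ring of maps around a single
  \<open>g\<close>. Multiplication maps stand in for linear forms until late because sums of
  \<open>u a v\<close> are carried along by any ring homomorphism, without linearity over a base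
  ring; linear forms are not. Localization is avoided as long as possible: a statement at
  \<open>\<mm>\<close> means one that holds after multiplication by some \<open>s\<close> outside
  \<open>\<mm>\<close>. Such \<open>s\<close> come from Nakayama's lemma as elements congruent to 1,
  finitely many of them are multiplied together, and ideals of denominators glue the results. Rings
  of fractions and tensor products appear only to identify the size of a spanning dual system with
  the rank in the theorem.\<close>

inductive_set lin_span ::
    "('r, 'a, 'q) module_scheme \<Rightarrow> 'r set \<Rightarrow> 'a set \<Rightarrow> 'a set \<Rightarrow> 'a set"
  for M (structure) and I U N where
  base: "n \<in> N \<Longrightarrow> n \<in> lin_span M I U N"
| step: "\<lbrakk>a \<in> I; u \<in> U; x \<in> lin_span M I U N\<rbrakk> \<Longrightarrow> a \<odot> u \<oplus> x \<in> lin_span M I U N"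

lemma lin_span_mono:
  assumes "I \<subseteq> I'" "U \<subseteq> U'" "N \<subseteq> N'"
  shows "lin_span M I U N \<subseteq> lin_span M I' U' N'"
proof
  fix x assume "x \<in> lin_span M I U N"
  then show "x \<in> lin_span M I' U' N'"
    by induction (use assms in \<open>auto intro: lin_span.intros\<close>)
qed

context module
begin

lemma submodule_facts:
  assumes "submodule N R M"
  shows "N \<subseteq> carrier M" "\<zero>\<^bsub>M\<^esub> \<in> N" "\<And>a b. \<lbrakk>a \<in> N; b \<in> N\<rbrakk> \<Longrightarrow> a \<oplus>\<^bsub>M\<^esub> b \<in> N"
    "\<And>r a. \<lbrakk>r \<in> carrier R; a \<in> N\<rbrakk> \<Longrightarrow> r \<odot>\<^bsub>M\<^esub> a \<in> N"
    "\<And>a. a \<in> N \<Longrightarrow> \<ominus>\<^bsub>M\<^esub> a \<in> N"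
proof -
  interpret N: submodule N R M by fact
  show "N \<subseteq> carrier M" using N.subset by simp
  show "\<zero>\<^bsub>M\<^esub> \<in> N" using N.one_closed by simp
  show "\<And>a b. \<lbrakk>a \<in> N; b \<in> N\<rbrakk> \<Longrightarrow> a \<oplus>\<^bsub>M\<^esub> b \<in> N" using N.m_closed by simp
  show "\<And>r a. \<lbrakk>r \<in> carrier R; a \<in> N\<rbrakk> \<Longrightarrow> r \<odot>\<^bsub>M\<^esub> a \<in> N" by simp
  show "\<And>a. a \<in> N \<Longrightarrow> \<ominus>\<^bsub>M\<^esub> a \<in> N" using submoduleE(3) assms by blast
qed

lemma submoduleI':
  assumes "H \<subseteq> carrier M" "\<zero>\<^bsub>M\<^esub> \<in> H"
    and "\<And>a b. \<lbrakk>a \<in> H; b \<in> H\<rbrakk> \<Longrightarrow> a \<oplus>\<^bsub>M\<^esub> b \<in> H"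
    and smult: "\<And>r a. \<lbrakk>r \<in> carrier R; a \<in> H\<rbrakk> \<Longrightarrow> r \<odot>\<^bsub>M\<^esub> a \<in> H"
  shows "submodule H R M"
proof (rule submoduleI)
  fix a assume a: "a \<in> H"
  have "(\<ominus> \<one>) \<odot>\<^bsub>M\<^esub> a = \<ominus>\<^bsub>M\<^esub> a" using a assms(1) by (subst smult_l_minus) auto
  then show "\<ominus>\<^bsub>M\<^esub> a \<in> H" using smult[OF _ a, of "\<ominus> \<one>"] by simp
qed (use assms in auto)

lemma zero_submodule: "submodule {\<zero>\<^bsub>M\<^esub>} R M"
  by (rule submoduleI') simp_all

lemma lin_span_closed:
  assumes "I \<subseteq> carrier R" "U \<subseteq> carrier M" "N \<subseteq> carrier M"
  shows "lin_span M I U N \<subseteq> carrier M"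
proof
  fix x assume "x \<in> lin_span M I U N"
  then show "x \<in> carrier M" by induction (use assms in auto)
qed

text \<open>The set is \<open>N + I U\<close>: a coefficient from the ideal \<open>I\<close> absorbs
  scalars. The base \<open>N\<close> makes one notion serve for plain spans
  (\<open>N = {\<zero>}\<close>), spans in a fibre (\<open>N = mA\<close>) and spans modulo the
  scalars.\<close>

lemma lin_span_submodule:
  assumes I: "ideal I R" and U: "U \<subseteq> carrier M" and N: "submodule N R M"
  shows "submodule (lin_span M I U N) R M"
proof -
  interpret I: ideal I R by fact
  note N' = submodule_facts[OF N]
  have IR: "I \<subseteq> carrier R" using I.a_subset .
  note cl = lin_span_closed[OF IR U N'(1)]
  have add: "x \<oplus>\<^bsub>M\<^esub> y \<in> lin_span M I U N"
    if x: "x \<in> lin_span M I U N" and y: "y \<in> lin_span M I U N" for x y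
    using x
  proof induction
    case (base n)
    from y show ?case
    proof induction
      case (base n')
      then show ?case using \<open>n \<in> N\<close> N'(3) by (auto intro: lin_span.base)
    next
      case (step a u z)
      have "n \<oplus>\<^bsub>M\<^esub> (a \<odot>\<^bsub>M\<^esub> u \<oplus>\<^bsub>M\<^esub> z) = a \<odot>\<^bsub>M\<^esub> u \<oplus>\<^bsub>M\<^esub> (n \<oplus>\<^bsub>M\<^esub> z)"
        using step \<open>n \<in> N\<close> N'(1) U IR cl by (intro M.a_lcomm) auto
      then show ?case using step by (auto intro: lin_span.step)
    qed
  next
    case (step a u z)
    have "a \<odot>\<^bsub>M\<^esub> u \<oplus>\<^bsub>M\<^esub> z \<oplus>\<^bsub>M\<^esub> y = a \<odot>\<^bsub>M\<^esub> u \<oplus>\<^bsub>M\<^esub> (z \<oplus>\<^bsub>M\<^esub> y)"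
      using step y U IR cl by (intro M.a_assoc) auto
    then show ?case using step by (auto intro: lin_span.step)
  qed
  have smult: "r \<odot>\<^bsub>M\<^esub> x \<in> lin_span M I U N"
    if r: "r \<in> carrier R" and x: "x \<in> lin_span M I U N" for r x
    using x
  proof induction
    case (base n)
    then show ?case using r N'(4) by (auto intro: lin_span.base)
  next
    case (step a u z)
    have "r \<odot>\<^bsub>M\<^esub> (a \<odot>\<^bsub>M\<^esub> u \<oplus>\<^bsub>M\<^esub> z) = (r \<otimes> a) \<odot>\<^bsub>M\<^esub> u \<oplus>\<^bsub>M\<^esub> r \<odot>\<^bsub>M\<^esub> z"
      using step r U IR cl by (simp add: smult_r_distr smult_assoc1 subset_iff)
    then show ?case using step r by (auto intro!: lin_span.step I.I_l_closed)
  qed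
  show ?thesis
    using cl lin_span.base[OF N'(2)] add smult by (rule submoduleI')
qed

lemma lin_span_superset:
  assumes "U \<subseteq> carrier M" "\<zero>\<^bsub>M\<^esub> \<in> N"
  shows "U \<subseteq> lin_span M (carrier R) U N"
proof
  fix u assume u: "u \<in> U"
  have "\<one> \<odot>\<^bsub>M\<^esub> u \<oplus>\<^bsub>M\<^esub> \<zero>\<^bsub>M\<^esub> \<in> lin_span M (carrier R) U N"
    by (intro lin_span.intros) (use assms u in auto)
  then show "u \<in> lin_span M (carrier R) U N" using u assms by (simp add: subset_iff)
qed

lemma lin_span_smult_mem:
  assumes "a \<in> I" "u \<in> U" "U \<subseteq> carrier M" "I \<subseteq> carrier R" "\<zero>\<^bsub>M\<^esub> \<in> N"
  shows "a \<odot>\<^bsub>M\<^esub> u \<in> lin_span M I U N"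
proof -
  have "a \<odot>\<^bsub>M\<^esub> u \<oplus>\<^bsub>M\<^esub> \<zero>\<^bsub>M\<^esub> \<in> lin_span M I U N"
    by (intro lin_span.intros) (use assms in auto)
  moreover have "a \<odot>\<^bsub>M\<^esub> u \<in> carrier M" using assms by auto
  ultimately show ?thesis by simp
qed

lemma lin_span_minimal:
  assumes "submodule K R M" "N \<subseteq> K" "\<And>a u. \<lbrakk>a \<in> I; u \<in> U\<rbrakk> \<Longrightarrow> a \<odot>\<^bsub>M\<^esub> u \<in> K"
  shows "lin_span M I U N \<subseteq> K"
proof
  fix x assume "x \<in> lin_span M I U N"
  then show "x \<in> K"
    by induction (use assms submodule_facts[OF assms(1)] in auto)
qed

text \<open>All multiples of \<open>q\<close> are collected into one, whose coefficient stays in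
  \<open>I\<close>; this is the elimination step of Nakayama's lemma.\<close>

lemma lin_span_insertE:
  assumes I: "ideal I R" and U: "U \<subseteq> carrier M" "q \<in> carrier M" and N: "submodule N R M"
    and x: "x \<in> lin_span M I (insert q U) N"
  obtains a y where "a \<in> I" "y \<in> lin_span M I U N" "x = a \<odot>\<^bsub>M\<^esub> q \<oplus>\<^bsub>M\<^esub> y"
proof -
  interpret I: ideal I R by fact
  note N' = submodule_facts[OF N]
  have IR: "I \<subseteq> carrier R" using I.a_subset .
  note cl = lin_span_closed[OF IR U(1) N'(1)]
  from x have "\<exists>a\<in>I. \<exists>y\<in>lin_span M I U N. x = a \<odot>\<^bsub>M\<^esub> q \<oplus>\<^bsub>M\<^esub> y"
  proof induction
    case (base n)
    then have "n = \<zero> \<odot>\<^bsub>M\<^esub> q \<oplus>\<^bsub>M\<^esub> n" using U N' by auto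
    then show ?case using base I.zero_closed by (blast intro: lin_span.base)
  next
    case (step b u z)
    then obtain a y where ay: "a \<in> I" "y \<in> lin_span M I U N" "z = a \<odot>\<^bsub>M\<^esub> q \<oplus>\<^bsub>M\<^esub> y" by blast
    have c: "a \<in> carrier R" "b \<in> carrier R" "y \<in> carrier M" "u \<in> carrier M"
      using ay step IR cl U by auto
    show ?case
    proof (cases "u = q")
      case True
      have "b \<odot>\<^bsub>M\<^esub> u \<oplus>\<^bsub>M\<^esub> z = (b \<oplus> a) \<odot>\<^bsub>M\<^esub> q \<oplus>\<^bsub>M\<^esub> y"
        using c U ay True by (simp add: smult_l_distr M.a_assoc)
      then show ?thesis using ay step I.a_closed by blast
    next
      case False
      have "b \<odot>\<^bsub>M\<^esub> u \<oplus>\<^bsub>M\<^esub> z = a \<odot>\<^bsub>M\<^esub> q \<oplus>\<^bsub>M\<^esub> (b \<odot>\<^bsub>M\<^esub> u \<oplus>\<^bsub>M\<^esub> y)"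
        using c U ay by (simp add: M.a_lcomm)
      moreover have "b \<odot>\<^bsub>M\<^esub> u \<oplus>\<^bsub>M\<^esub> y \<in> lin_span M I U N"
        using False step ay by (auto intro: lin_span.step)
      ultimately show ?thesis using ay by blast
    qed
  qed
  then show thesis using that by blast
qed

text \<open>Gaussian elimination: the generators are removed from the span one at a time.\<close>

lemma nakayama:
  assumes I: "ideal I R" and N: "submodule N R M" and fin: "finite U" and U: "U \<subseteq> carrier M"
    and span: "U \<subseteq> lin_span M I U N"
  obtains s where "s \<in> carrier R" "s \<ominus> \<one> \<in> I" "\<And>u. u \<in> U \<Longrightarrow> s \<odot>\<^bsub>M\<^esub> u \<in> N"
proof -
  interpret I: ideal I R by fact
  have IR: "I \<subseteq> carrier R" using I.a_subset .
  have "\<exists>s\<in>carrier R. s \<ominus> \<one> \<in> I \<and> (\<forall>u\<in>U. s \<odot>\<^bsub>M\<^esub> u \<in> lin_span M I (U - V) N)"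
    if "finite V" "V \<subseteq> U" for V
    using that
  proof (induction V)
    case empty
    have "\<one> \<ominus> \<one> \<in> I" using I.zero_closed by (simp add: R.minus_eq R.r_neg)
    then show ?case using U span by (intro bexI[of _ \<one>]) (auto simp: subset_iff)
  next
    case (insert q V)
    then obtain s where s: "s \<in> carrier R" "s \<ominus> \<one> \<in> I"
      "\<And>u. u \<in> U \<Longrightarrow> s \<odot>\<^bsub>M\<^esub> u \<in> lin_span M I (U - V) N" by auto
    define W where "W = U - insert q V"
    have UV: "U - V = insert q W" using insert by (auto simp: W_def)
    have W: "W \<subseteq> carrier M" "q \<in> carrier M" using U insert by (auto simp: W_def)
    note sub = submodule_facts[OF lin_span_submodule[OF I W(1) N]]
    have "s \<odot>\<^bsub>M\<^esub> q \<in> lin_span M I (insert q W) N" using s(3)[of q] insert UV by simp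
    then obtain a y where ay: "a \<in> I" "y \<in> lin_span M I W N" "s \<odot>\<^bsub>M\<^esub> q = a \<odot>\<^bsub>M\<^esub> q \<oplus>\<^bsub>M\<^esub> y"
      using lin_span_insertE[OF I W N] by blast
    have c: "a \<in> carrier R" "y \<in> carrier M" using ay IR sub(1) by auto
    have saq: "(s \<ominus> a) \<odot>\<^bsub>M\<^esub> q = y"
    proof -
      have "(s \<ominus> a) \<odot>\<^bsub>M\<^esub> q = s \<odot>\<^bsub>M\<^esub> q \<oplus>\<^bsub>M\<^esub> \<ominus>\<^bsub>M\<^esub> (a \<odot>\<^bsub>M\<^esub> q)"
        using c s W by (simp add: R.minus_eq smult_l_distr smult_l_minus)
      also have "\<dots> = y" using c W unfolding ay(3)
        by (simp add: M.a_comm[of "a \<odot>\<^bsub>M\<^esub> q"] M.a_assoc M.r_neg)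
      finally show ?thesis .
    qed
    \<comment> \<open>Since \<open>(s \<ominus> a) q = y\<close> no longer involves
      \<open>q\<close>, the factor \<open>s \<ominus> a\<close> removes \<open>q\<close> from the
      relation that \<open>s\<close> provides for any generator. As \<open>a\<close> lies in
      \<open>I\<close>, the product is still congruent to \<open>\<one>\<close>.\<close>
    define s' where "s' = (s \<ominus> a) \<otimes> s"
    have s': "s' \<in> carrier R" using s c by (simp add: s'_def)
    have "s' \<ominus> \<one> = (s \<ominus> a) \<otimes> (s \<ominus> \<one>) \<oplus> (s \<ominus> \<one>) \<oplus> \<ominus> a"
      using s c unfolding s'_def by algebra
    moreover have "\<dots> \<in> I" using s ay c
      by (intro I.a_closed I.I_l_closed I.a_inv_closed) auto
    ultimately have s'I: "s' \<ominus> \<one> \<in> I" by simp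
    have "s' \<odot>\<^bsub>M\<^esub> u \<in> lin_span M I W N" if u: "u \<in> U" for u
    proof -
      have "s \<odot>\<^bsub>M\<^esub> u \<in> lin_span M I (insert q W) N" using s(3)[of u] u UV by simp
      then obtain b z where bz: "b \<in> I" "z \<in> lin_span M I W N" "s \<odot>\<^bsub>M\<^esub> u = b \<odot>\<^bsub>M\<^esub> q \<oplus>\<^bsub>M\<^esub> z"
        using lin_span_insertE[OF I W N] by blast
      have c': "b \<in> carrier R" "z \<in> carrier M" "u \<in> carrier M" using bz IR sub(1) u U by auto
      have "s' \<odot>\<^bsub>M\<^esub> u = (s \<ominus> a) \<odot>\<^bsub>M\<^esub> (b \<odot>\<^bsub>M\<^esub> q \<oplus>\<^bsub>M\<^esub> z)"
        using s c c' by (simp add: s'_def smult_assoc1 bz(3))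
      also have "\<dots> = (b \<otimes> (s \<ominus> a)) \<odot>\<^bsub>M\<^esub> q \<oplus>\<^bsub>M\<^esub> (s \<ominus> a) \<odot>\<^bsub>M\<^esub> z"
        using s c c' W by (simp add: smult_r_distr R.m_comm flip: smult_assoc1)
      also have "\<dots> = b \<odot>\<^bsub>M\<^esub> y \<oplus>\<^bsub>M\<^esub> (s \<ominus> a) \<odot>\<^bsub>M\<^esub> z"
        using s c c' W saq by (simp add: smult_assoc1)
      also have "\<dots> \<in> lin_span M I W N"
        using s c c' ay bz by (intro sub(3,4)) auto
      finally show ?thesis .
    qed
    then show ?case using s' s'I unfolding W_def by blast
  qed
  from this[OF fin order_refl] obtain s where s: "s \<in> carrier R" "s \<ominus> \<one> \<in> I"
      "\<And>u. u \<in> U \<Longrightarrow> s \<odot>\<^bsub>M\<^esub> u \<in> lin_span M I {} N" by auto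
  have "lin_span M I {} N \<subseteq> N" by (rule lin_span_minimal[OF N]) auto
  then show thesis using s that by blast
qed

end

section \<open>Maximal ideals and arithmetic in the residue field\<close>

context cring
begin

lemma exists_maximalideal:
  assumes "ideal I R" "I \<noteq> carrier R"
  obtains J where "maximalideal J R" "I \<subseteq> J"
proof -
  \<comment> \<open>Properness is phrased as \<open>\<one> \<notin> J\<close> so that it survives
    unions of chains.\<close>
  define \<A> where "\<A> = {J. ideal J R \<and> I \<subseteq> J \<and> \<one> \<notin> J}"
  have one: "\<one> \<notin> I" using assms ideal.one_imp_carrier by blast
  have "\<exists>J\<in>\<A>. \<forall>K\<in>\<A>. J \<subseteq> K \<longrightarrow> K = J"
  proof (rule subset_Zorn)
    fix C assume C: "subset.chain \<A> C"
    show "\<exists>B\<in>\<A>. \<forall>D\<in>C. D \<subseteq> B"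
    proof (cases "C = {}")
      case True
      then show ?thesis using assms one by (auto simp: \<A>_def)
    next
      case False
      have CA: "C \<subseteq> \<A>" and ch: "\<And>D E. \<lbrakk>D \<in> C; E \<in> C\<rbrakk> \<Longrightarrow> D \<subseteq> E \<or> E \<subseteq> D"
        using C by (auto simp: subset_chain_def)
      have id: "D \<in> C \<Longrightarrow> ideal D R" for D using CA by (auto simp: \<A>_def)
      have "ideal (\<Union>C) R"
      proof (rule idealI)
        show "ring R" by (rule ring_axioms)
        show "subgroup (\<Union>C) (add_monoid R)"
        proof (rule group.subgroupI)
          show "group (add_monoid R)" by (rule add.group_axioms)
          show "\<Union>C \<subseteq> carrier (add_monoid R)" using id ideal.Icarr by fastforce
          show "\<Union>C \<noteq> {}" using False id additive_subgroup.zero_closed ideal.axioms(1) by blast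
          fix a assume "a \<in> \<Union>C"
          then obtain D where D: "D \<in> C" "a \<in> D" by blast
          then show "inv\<^bsub>add_monoid R\<^esub> a \<in> \<Union>C"
            using additive_subgroup.a_inv_closed[OF ideal.axioms(1)[OF id]] by (auto simp: a_inv_def)
          fix b assume "b \<in> \<Union>C"
          then obtain E where E: "E \<in> C" "b \<in> E" by blast
          obtain Z where "Z \<in> C" "a \<in> Z" "b \<in> Z" using ch[OF D(1) E(1)] D E by blast
          then show "a \<otimes>\<^bsub>add_monoid R\<^esub> b \<in> \<Union>C"
            using additive_subgroup.a_closed[OF ideal.axioms(1)[OF id]] by auto
        qed
      next
        fix a x assume "a \<in> \<Union>C" and x: "x \<in> carrier R"
        then obtain D where D: "D \<in> C" "a \<in> D" by blast
        show "x \<otimes> a \<in> \<Union>C" using ideal.I_l_closed[OF id[OF D(1)] D(2) x] D by blast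
        show "a \<otimes> x \<in> \<Union>C" using ideal.I_r_closed[OF id[OF D(1)] D(2) x] D by blast
      qed
      then have "\<Union>C \<in> \<A>" using CA False by (fastforce simp: \<A>_def)
      then show ?thesis by blast
    qed
  qed
  then obtain J where J: "J \<in> \<A>" "\<And>K. \<lbrakk>K \<in> \<A>; J \<subseteq> K\<rbrakk> \<Longrightarrow> K = J" by blast
  have "maximalideal J R"
  proof (rule maximalidealI)
    show "ideal J R" using J by (simp add: \<A>_def)
    show "carrier R \<noteq> J" using J by (auto simp: \<A>_def)
    fix K assume K: "ideal K R" "J \<subseteq> K" "K \<subseteq> carrier R"
    show "K = J \<or> K = carrier R"
    proof (cases "\<one> \<in> K")
      case True
      then show ?thesis using K ideal.one_imp_carrier by blast
    next
      case False
      then show ?thesis using J K by (auto simp: \<A>_def)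
    qed
  qed
  then show thesis using that J by (auto simp: \<A>_def)
qed

lemma ideal_finsum_closed:
  assumes J: "ideal J R" and "finite D" "\<And>d. d \<in> D \<Longrightarrow> f d \<in> J"
  shows "(\<Oplus>d\<in>D. f d) \<in> J"
  using assms(2,3)
proof (induction D)
  case empty
  then show ?case using additive_subgroup.zero_closed[OF ideal.axioms(1)[OF J]] by simp
next
  case (insert d D)
  have "f \<in> D \<rightarrow> carrier R" "f d \<in> carrier R" using insert.prems ideal.Icarr[OF J] by auto
  then show ?case using insert additive_subgroup.a_closed[OF ideal.axioms(1)[OF J]] by simp
qed

text \<open>Inversion in the field \<open>R / J\<close>, stated by a congruence: \<open>J\<close>
  together with the ideal of \<open>r\<close> generates everything, and a decomposition of
  \<open>\<one>\<close> shows \<open>s\<close>.\<close>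

lemma maximalideal_inverse:
  assumes "maximalideal J R" "r \<in> carrier R" "r \<notin> J"
  obtains s where "s \<in> carrier R" "s \<otimes> r \<ominus> \<one> \<in> J"
proof -
  interpret J: maximalideal J R by fact
  have K: "ideal (J <+>\<^bsub>R\<^esub> PIdl r) R"
    using add_ideals[OF J.is_ideal cgenideal_ideal] assms by simp
  have "\<zero> \<otimes> r \<in> PIdl r" unfolding cgenideal_def by blast
  then have "\<zero> \<in> PIdl r" "r \<in> PIdl r" using assms cgenideal_self by auto
  have "J \<subseteq> J <+>\<^bsub>R\<^esub> PIdl r"
  proof
    fix j assume j: "j \<in> J"
    then have "j = j \<oplus> \<zero>" using J.Icarr by simp
    then show "j \<in> J <+>\<^bsub>R\<^esub> PIdl r" using j \<open>\<zero> \<in> PIdl r\<close> unfolding set_add_def' by blast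
  qed
  moreover have "r \<in> J <+>\<^bsub>R\<^esub> PIdl r"
  proof -
    have "r = \<zero> \<oplus> r" using assms by simp
    then show ?thesis using \<open>r \<in> PIdl r\<close> J.zero_closed unfolding set_add_def' by blast
  qed
  ultimately have "J <+>\<^bsub>R\<^esub> PIdl r = carrier R"
    using J.I_maximal[OF K] assms ideal.Icarr[OF K] by blast
  then have "\<one> \<in> J <+>\<^bsub>R\<^esub> PIdl r" by simp
  then obtain j s where js: "j \<in> J" "s \<in> carrier R" "\<one> = j \<oplus> s \<otimes> r"
    unfolding set_add_def' cgenideal_def by auto
  have j: "j \<in> carrier R" using J.Icarr js(1) .
  have "s \<otimes> r \<ominus> (j \<oplus> s \<otimes> r) = \<ominus> j" using j js(2) assms(2) by algebra
  then have "s \<otimes> r \<ominus> \<one> = \<ominus> j" using js(3) by simp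
  then show thesis using that js by simp
qed

lemma maximalideal_one_notin:
  assumes "maximalideal J R" shows "\<one> \<notin> J"
  using assms ideal.one_imp_carrier[of J R] maximalideal.I_notcarr[of J R] maximalideal.axioms(1)[of J R]
  by blast

text \<open>Turns the scalars produced by Nakayama's lemma into admissible denominators at
  \<open>J\<close>.\<close>

lemma maximalideal_one_plus:
  assumes "maximalideal J R" "s \<in> carrier R" "s \<ominus> \<one> \<in> J" shows "s \<notin> J"
proof
  interpret J: maximalideal J R by fact
  assume "s \<in> J"
  then have "s \<ominus> (s \<ominus> \<one>) \<in> J" using assms by (simp add: minus_eq)
  moreover have "s \<ominus> (s \<ominus> \<one>) = \<one>" using assms(2) by algebra
  ultimately show False using maximalideal_one_notin assms by simp
qed

lemma maximalideal_mult_notin: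
  assumes "maximalideal J R" "s \<in> carrier R" "t \<in> carrier R" "s \<notin> J" "t \<notin> J"
  shows "s \<otimes> t \<notin> J"
  using primeideal.I_prime[OF maximalideal_prime[OF assms(1)] assms(2,3)] assms(4,5) by blast

end

section \<open>Multiplication maps and the fibres of an Azumaya algebra\<close>

text \<open>The image of the enveloping algebra, \<open>A\<close> tensor its opposite, in the
  endomorphisms of \<open>A\<close>. Restriction to the carrier makes the maps extensional, so that
  pointwise equality is equality and they can form a ring.\<close>

inductive_set mult_maps :: "('a, 'q) ring_scheme \<Rightarrow> ('a \<Rightarrow> 'a) set"
  for A (structure) where
  single: "\<lbrakk>u \<in> carrier A; v \<in> carrier A\<rbrakk> \<Longrightarrow> (\<lambda>a\<in>carrier A. u \<otimes> a \<otimes> v) \<in> mult_maps A"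
| sum: "\<lbrakk>f \<in> mult_maps A; g \<in> mult_maps A\<rbrakk> \<Longrightarrow> (\<lambda>a\<in>carrier A. f a \<oplus> g a) \<in> mult_maps A"

context ring
begin

lemma mult_maps_closed [simp]: "\<lbrakk>f \<in> mult_maps R; a \<in> carrier R\<rbrakk> \<Longrightarrow> f a \<in> carrier R"
  by (induction f arbitrary: a rule: mult_maps.induct) auto

lemma mult_maps_extensional: "f \<in> mult_maps R \<Longrightarrow> f \<in> extensional (carrier R)"
  by (induction f rule: mult_maps.induct) (simp_all only: restrict_extensional)

lemma mult_maps_eqI:
  assumes "f \<in> mult_maps R" "g \<in> extensional (carrier R)" "\<And>a. a \<in> carrier R \<Longrightarrow> f a = g a"
  shows "f = g"
  using mult_maps_extensional[OF assms(1)] assms(2,3) by (rule extensionalityI)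

lemma mult_maps_add:
  "\<lbrakk>f \<in> mult_maps R; a \<in> carrier R; b \<in> carrier R\<rbrakk> \<Longrightarrow> f (a \<oplus> b) = f a \<oplus> f b"
proof (induction f arbitrary: a b rule: mult_maps.induct)
  case (single u v)
  then show ?case by (simp add: r_distr l_distr)
next
  case (sum f g)
  then show ?case by (simp add: a_ac)
qed

text \<open>Applied to \<open>mA\<close> this lets multiplication maps act on the fibre.\<close>

lemma mult_maps_ideal:
  assumes "ideal J R" "f \<in> mult_maps R" "a \<in> J"
  shows "f a \<in> J"
proof -
  interpret J: ideal J R by fact
  show ?thesis using assms(2,3)
  proof (induction f arbitrary: a rule: mult_maps.induct)
    case (single u v)
    then show ?case using J.I_l_closed J.I_r_closed by simp
  qed simp
qed

lemma mult_maps_zero: "f \<in> mult_maps R \<Longrightarrow> f \<zero> = \<zero>"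
  using mult_maps_ideal[OF zeroideal] by blast

lemma mult_maps_minus:
  assumes "f \<in> mult_maps R" "a \<in> carrier R" "b \<in> carrier R"
  shows "f (a \<ominus> b) = f a \<ominus> f b"
proof -
  have "f (a \<ominus> b) \<oplus> f b = f (a \<ominus> b \<oplus> b)" using assms by (simp add: mult_maps_add)
  also have "a \<ominus> b \<oplus> b = a" using assms(2,3) by algebra
  finally have e: "f (a \<ominus> b) \<oplus> f b = f a" .
  have "f (a \<ominus> b) = f (a \<ominus> b) \<oplus> f b \<ominus> f b"
    using mult_maps_closed[OF assms(1,3)] mult_maps_closed[OF assms(1), of "a \<ominus> b"] assms(2,3)
    by (simp add: minus_eq a_assoc r_neg)
  then show ?thesis by (simp add: e)
qed

lemma mult_maps_lmult:
  "\<lbrakk>f \<in> mult_maps R; u \<in> carrier R\<rbrakk> \<Longrightarrow> (\<lambda>a\<in>carrier R. u \<otimes> f a) \<in> mult_maps R"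
proof (induction f rule: mult_maps.induct)
  case (single w v)
  have "(\<lambda>a\<in>carrier R. u \<otimes> (\<lambda>a\<in>carrier R. w \<otimes> a \<otimes> v) a) = (\<lambda>a\<in>carrier R. (u \<otimes> w) \<otimes> a \<otimes> v)"
    using single by (intro restrict_ext) (simp add: m_assoc)
  then show ?case using single by (simp only: mult_maps.single m_closed)
next
  case (sum f g)
  have "(\<lambda>a\<in>carrier R. u \<otimes> (\<lambda>a\<in>carrier R. f a \<oplus> g a) a)
    = (\<lambda>a\<in>carrier R. (\<lambda>a\<in>carrier R. u \<otimes> f a) a \<oplus> (\<lambda>a\<in>carrier R. u \<otimes> g a) a)"
    using sum by (intro restrict_ext) (simp add: r_distr)
  then show ?case using sum by (simp only: mult_maps.sum)
qed

lemma mult_maps_rmult: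
  "\<lbrakk>f \<in> mult_maps R; u \<in> carrier R\<rbrakk> \<Longrightarrow> (\<lambda>a\<in>carrier R. f a \<otimes> u) \<in> mult_maps R"
proof (induction f rule: mult_maps.induct)
  case (single w v)
  have "(\<lambda>a\<in>carrier R. (\<lambda>a\<in>carrier R. w \<otimes> a \<otimes> v) a \<otimes> u) = (\<lambda>a\<in>carrier R. w \<otimes> a \<otimes> (v \<otimes> u))"
    using single by (intro restrict_ext) (simp add: m_assoc)
  then show ?case using single by (simp only: mult_maps.single m_closed)
next
  case (sum f g)
  have "(\<lambda>a\<in>carrier R. (\<lambda>a\<in>carrier R. f a \<oplus> g a) a \<otimes> u)
    = (\<lambda>a\<in>carrier R. (\<lambda>a\<in>carrier R. f a \<otimes> u) a \<oplus> (\<lambda>a\<in>carrier R. g a \<otimes> u) a)"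
    using sum by (intro restrict_ext) (simp add: l_distr)
  then show ?case using sum by (simp only: mult_maps.sum)
qed

lemma mult_maps_comp:
  "\<lbrakk>f \<in> mult_maps R; g \<in> mult_maps R\<rbrakk> \<Longrightarrow> (\<lambda>a\<in>carrier R. f (g a)) \<in> mult_maps R"
proof (induction f rule: mult_maps.induct)
  case (single u v)
  have "(\<lambda>a\<in>carrier R. (\<lambda>a\<in>carrier R. u \<otimes> a \<otimes> v) (g a))
     = (\<lambda>a\<in>carrier R. (\<lambda>a\<in>carrier R. u \<otimes> g a) a \<otimes> v)"
    using single by (intro restrict_ext) simp
  then show ?case using single by (simp only: mult_maps_lmult mult_maps_rmult)
next
  case (sum f h)
  have "(\<lambda>a\<in>carrier R. (\<lambda>a\<in>carrier R. f a \<oplus> h a) (g a))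
    = (\<lambda>a\<in>carrier R. (\<lambda>a\<in>carrier R. f (g a)) a \<oplus> (\<lambda>a\<in>carrier R. h (g a)) a)"
    using sum by (intro restrict_ext) simp
  then show ?case using sum by (simp only: mult_maps.sum)
qed

lemma mult_maps_id: "(\<lambda>a\<in>carrier R. a) \<in> mult_maps R"
proof -
  have "(\<lambda>a\<in>carrier R. a) = (\<lambda>a\<in>carrier R. \<one> \<otimes> a \<otimes> \<one>)" by (intro restrict_ext) simp
  then show ?thesis by (simp only: mult_maps.single one_closed)
qed

lemma mult_maps_diff:
  assumes "f \<in> mult_maps R" "g \<in> mult_maps R"
  shows "(\<lambda>a\<in>carrier R. f a \<ominus> g a) \<in> mult_maps R"
proof -
  have "(\<lambda>a\<in>carrier R. f a \<ominus> g a) = (\<lambda>a\<in>carrier R. f a \<oplus> (\<lambda>a\<in>carrier R. \<ominus> \<one> \<otimes> g a) a)"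
    using assms by (intro restrict_ext) (simp add: minus_eq l_minus)
  then show ?thesis using assms by (simp only: mult_maps.sum mult_maps_lmult a_inv_closed one_closed)
qed

lemma mult_maps_zero_map: "(\<lambda>a\<in>carrier R. \<zero>) \<in> mult_maps R"
proof -
  have "(\<lambda>a\<in>carrier R. \<zero>) = (\<lambda>a\<in>carrier R. \<zero> \<otimes> a \<otimes> \<zero>)" by (intro restrict_ext) simp
  then show ?thesis by (simp only: mult_maps.single zero_closed)
qed

lemma mult_maps_lmultiplication: "u \<in> carrier R \<Longrightarrow> (\<lambda>a\<in>carrier R. u \<otimes> a) \<in> mult_maps R"
  using mult_maps_lmult[OF mult_maps_id, of u] by (simp cong: restrict_cong)

lemma mult_maps_rmultiplication: "u \<in> carrier R \<Longrightarrow> (\<lambda>a\<in>carrier R. a \<otimes> u) \<in> mult_maps R"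
  using mult_maps_rmult[OF mult_maps_id, of u] by (simp cong: restrict_cong)

lemma mult_maps_commutator:
  "u \<in> carrier R \<Longrightarrow> (\<lambda>a\<in>carrier R. u \<otimes> a \<ominus> a \<otimes> u) \<in> mult_maps R"
  using mult_maps_diff[OF mult_maps_lmultiplication mult_maps_rmultiplication, of u u]
  by (simp cong: restrict_cong)

text \<open>The source of linearity over the base ring, whose scalars act as multiplications by
  central elements.\<close>

lemma mult_maps_center:
  assumes "f \<in> mult_maps R" "z \<in> center R" "a \<in> carrier R"
  shows "f (z \<otimes> a) = z \<otimes> f a"
  using assms(1,3)
proof (induction f arbitrary: a rule: mult_maps.induct)
  case (single u v)
  have z: "z \<in> carrier R" "z \<otimes> u = u \<otimes> z" using assms(2) single by (auto simp: center_def)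
  have "u \<otimes> (z \<otimes> a) \<otimes> v = (u \<otimes> z) \<otimes> a \<otimes> v" using z single by (simp add: m_assoc)
  also have "\<dots> = z \<otimes> (u \<otimes> a \<otimes> v)" using z single by (simp add: m_assoc flip: z(2))
  finally show ?case using z single by simp
next
  case (sum f g)
  then show ?case using assms(2) by (simp add: center_def r_distr)
qed

end

section \<open>Fibres of an Azumaya algebra at a maximal ideal\<close>

locale azumaya = R: cring R + A: ring A + azumaya_algebra R A
  for A :: "('r, 'a, 'q) module_scheme" (structure) and R :: "('r, 'p) ring_scheme" (structure)
begin

lemma smult_mult_one: "\<lbrakk>r \<in> carrier R; a \<in> carrier A\<rbrakk> \<Longrightarrow> (r \<odot> \<one>) \<otimes> a = r \<odot> a"
  by (simp add: smult_mult_left)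

lemma smult_one_center: "r \<in> carrier R \<Longrightarrow> r \<odot> \<one> \<in> center A"
  by (simp add: center_def smult_mult_left smult_mult_right)

lemma mult_maps_smult:
  assumes "f \<in> mult_maps A" "r \<in> carrier R" "a \<in> carrier A"
  shows "f (r \<odot> a) = r \<odot> f a"
  using A.mult_maps_center[OF assms(1) smult_one_center[OF assms(2)] assms(3)] assms
  by (simp add: smult_mult_left)

lemma mult_maps_scalar: "r \<in> carrier R \<Longrightarrow> (\<lambda>a\<in>carrier A. r \<odot> a) \<in> mult_maps A"
  using A.mult_maps_lmultiplication[of "r \<odot> \<one>"] by (simp add: smult_mult_one cong: restrict_cong)

lemma smult_one_inj:
  assumes "r \<in> carrier R" "s \<in> carrier R" "r \<odot> \<one> = s \<odot> \<one>"
  shows "r = s"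
proof -
  have "(r \<ominus>\<^bsub>R\<^esub> s) \<odot> a = \<zero>" if a: "a \<in> carrier A" for a
  proof -
    have "r \<odot> a = s \<odot> a" using assms smult_mult_one a by metis
    then show ?thesis using assms a
      by (simp add: R.minus_eq smult_l_distr smult_l_minus A.r_neg)
  qed
  then have "r \<ominus>\<^bsub>R\<^esub> s = \<zero>\<^bsub>R\<^esub>" using faithful assms by (simp add: faithful_module_def)
  then show ?thesis using assms by simp
qed

lemma generators:
  obtains B where "finite B" "B \<subseteq> carrier A" "\<one> \<in> B" "lin_span A (carrier R) B {\<zero>} = carrier A"
proof -
  obtain B where B: "finite B" "B \<subseteq> carrier A"
    "\<And>x. x \<in> carrier A \<Longrightarrow> \<exists>c \<in> B \<rightarrow> carrier R. x = (\<Oplus>b\<in>B. c b \<odot> b)"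
    using fin_gen unfolding fin_gen_module_def by blast
  \<comment> \<open>The unit is kept among the generators so that plain commutators
    \<open>[b, -]\<close> occur later among the maps indexed by pairs of generators.\<close>
  let ?B = "insert \<one> B"
  have B': "?B \<subseteq> carrier A" using B by simp
  note sub = submodule_facts[OF lin_span_submodule[OF R.oneideal B' zero_submodule]]
  have "x \<in> lin_span A (carrier R) ?B {\<zero>}" if x: "x \<in> carrier A" for x
  proof -
    obtain c where c: "c \<in> B \<rightarrow> carrier R" "x = (\<Oplus>b\<in>B. c b \<odot> b)" using B x by blast
    have "(\<Oplus>b\<in>D. c b \<odot> b) \<in> lin_span A (carrier R) ?B {\<zero>}" if "D \<subseteq> B" for D
      using finite_subset[OF that B(1)] that
    proof (induction D)
      case empty
      then show ?case using sub(2) by simp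
    next
      case (insert d D)
      have m: "(\<lambda>b. c b \<odot> b) \<in> D \<rightarrow> carrier A" "c d \<in> carrier R" "d \<in> carrier A"
        using c(1) B(2) insert.prems by blast+
      then show ?case using insert by (auto intro: lin_span.step)
    qed
    then show ?thesis using c by blast
  qed
  then show thesis using that[of ?B] B B' sub(1) by blast
qed

end

locale azumaya_at = azumaya A R
  for A :: "('r, 'a, 'q) module_scheme" (structure) and R :: "('r, 'p) ring_scheme" (structure) +
  fixes \<mm>
  assumes maximal: "maximalideal \<mm> R"
begin

sublocale \<mm>: maximalideal \<mm> R by (rule maximal)

abbreviation mA where "mA \<equiv> ideal_smult \<mm> A"

lemma mm_carrier [simp]: "\<mu> \<in> \<mm> \<Longrightarrow> \<mu> \<in> carrier R" by (rule \<mm>.Icarr)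

lemma smult_in_mA [simp]: "\<lbrakk>\<mu> \<in> \<mm>; a \<in> carrier A\<rbrakk> \<Longrightarrow> \<mu> \<odot> a \<in> mA"
  unfolding ideal_smult_def by (rule generate.incl) blast

text \<open>\<open>mA\<close> is generated as an additive group only; this reduces facts about it to
  a check on the products \<open>\<mu> \<odot> a\<close>.\<close>

lemma mA_minimal:
  assumes "submodule K R A" "\<And>\<mu> a. \<lbrakk>\<mu> \<in> \<mm>; a \<in> carrier A\<rbrakk> \<Longrightarrow> \<mu> \<odot> a \<in> K"
  shows "mA \<subseteq> K"
proof
  note K = submodule_facts[OF assms(1)]
  fix x assume "x \<in> mA"
  then show "x \<in> K" unfolding ideal_smult_def
  proof induction
    case (inv h)
    then have "h \<in> K" using assms(2) by blast
    then show ?case using K(5) by (simp add: a_inv_def)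
  qed (use K assms(2) in auto)
qed

lemma mA_subgroup: "subgroup mA (add_monoid A)"
  unfolding ideal_smult_def
  by (rule group.generate_is_subgroup[OF A.add.group_axioms]) auto

lemma mA_submodule: "submodule mA R A"
proof -
  have "r \<odot> x \<in> mA" if r: "r \<in> carrier R" and x: "x \<in> mA" for r x
    using x unfolding ideal_smult_def
  proof induction
    case one
    then show ?case using r generate.one[of "add_monoid A"] by simp
  next
    case (incl h)
    then obtain \<mu> a where h: "h = \<mu> \<odot> a" "\<mu> \<in> \<mm>" "a \<in> carrier A" by blast
    then have "r \<odot> h = (r \<otimes>\<^bsub>R\<^esub> \<mu>) \<odot> a" using r by (simp add: smult_assoc1)
    then show ?case using h r \<mm>.I_l_closed by (intro generate.incl) blast
  next
    case (inv h)
    then obtain \<mu> a where h: "h = \<mu> \<odot> a" "\<mu> \<in> \<mm>" "a \<in> carrier A" by blast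
    have "r \<odot> (inv\<^bsub>add_monoid A\<^esub> h) = \<ominus> (r \<odot> h)"
      using h r smult_r_minus[of r h] by (simp add: a_inv_def)
    also have "\<dots> = inv\<^bsub>add_monoid A\<^esub> ((r \<otimes>\<^bsub>R\<^esub> \<mu>) \<odot> a)"
      using h r by (simp add: smult_assoc1 a_inv_def)
    finally show ?case using h r \<mm>.I_l_closed by (auto intro!: generate.inv)
  next
    case (eng h1 h2)
    have "\<And>h. h \<in> generate (add_monoid A) {r \<odot> a |r a. r \<in> \<mm> \<and> a \<in> carrier A} \<Longrightarrow> h \<in> carrier A"
      using subgroup.mem_carrier[OF mA_subgroup] by (simp add: ideal_smult_def)
    then show ?case using eng r generate.eng[OF eng.IH] by (simp add: smult_r_distr)
  qed
  then show ?thesis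
    by (intro submodule.intro submodule_axioms.intro mA_subgroup)
qed

lemmas mA_facts = submodule_facts[OF mA_submodule]

lemma mA_ideal: "ideal mA A"
proof (rule idealI[OF A.ring_axioms mA_subgroup])
  fix a x assume a: "a \<in> mA" and x: "x \<in> carrier A"
  have "submodule {a \<in> carrier A. x \<otimes> a \<in> mA} R A"
    using x mA_facts
    by (intro submoduleI) (auto simp: A.r_distr smult_mult_right A.r_minus)
  then have "mA \<subseteq> {a \<in> carrier A. x \<otimes> a \<in> mA}"
    by (rule mA_minimal) (use x in \<open>auto simp: smult_mult_right\<close>)
  then show "x \<otimes> a \<in> mA" using a by blast
  have "submodule {a \<in> carrier A. a \<otimes> x \<in> mA} R A"
    using x mA_facts
    by (intro submoduleI) (auto simp: A.l_distr smult_mult_left A.l_minus)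
  then have "mA \<subseteq> {a \<in> carrier A. a \<otimes> x \<in> mA}"
    by (rule mA_minimal) (use x in \<open>auto simp: smult_mult_left\<close>)
  then show "a \<otimes> x \<in> mA" using a by blast
qed

sublocale mA: ideal mA A by (rule mA_ideal)

lemma fibre: "central_simple_algebra (R Quot \<mm>) (quot_algebra \<mm> A)"
  by (rule central_simple_fibre) (rule maximal)

lemma one_notin_mA: "\<one> \<notin> mA"
proof
  assume "\<one> \<in> mA"
  then have "mA = carrier A" by (rule mA.one_imp_carrier)
  then have "carrier (A Quot mA) = {mA}"
    using mA.a_rcos_const[of] by (auto simp: FactRing_simps)
  then show False using fibre
    by (simp add: central_simple_algebra_def simple_ring_def quot_algebra_def FactRing_def)
qed

lemma coset_eq_iff:
  "\<lbrakk>a \<in> carrier A; b \<in> carrier A\<rbrakk> \<Longrightarrow> mA +> a = mA +> b \<longleftrightarrow> a \<ominus> b \<in> mA"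
  using A.quotient_eq_iff_same_a_r_cos[OF mA_ideal] by blast

text \<open>The values at \<open>a\<close> of all multiplication maps, taken together with
  \<open>mA\<close>, form the two-sided ideal \<open>A a A + mA\<close>. Its image in the fibre is
  not zero, so by simplicity it contains the unit.\<close>

lemma fibre_simple:
  assumes a: "a \<in> carrier A" "a \<notin> mA"
  obtains f where "f \<in> mult_maps A" "f a \<ominus> \<one> \<in> mA"
proof -
  let ?Q = "quot_algebra \<mm> A"
  define K where "K = {x \<in> carrier A. \<exists>f\<in>mult_maps A. x \<ominus> f a \<in> mA}"
  have "ideal K A"
  proof (rule idealI[OF A.ring_axioms A.add.subgroupI])
    have "(\<lambda>a\<in>carrier A. a) \<in> mult_maps A" "\<zero> \<ominus> \<zero> \<in> mA"
      using A.mult_maps_id mA_facts(2) by (auto simp: A.minus_eq A.r_neg)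
    have "a \<in> K" unfolding K_def using a mA_facts(2) A.mult_maps_id
      by (auto simp: A.minus_eq A.r_neg intro!: bexI[of _ "\<lambda>a\<in>carrier A. a"])
    then show "K \<noteq> {}" by blast
    show "K \<subseteq> carrier A" by (auto simp: K_def)
    fix x assume "x \<in> K"
    then obtain f where f: "x \<in> carrier A" "f \<in> mult_maps A" "x \<ominus> f a \<in> mA" by (auto simp: K_def)
    have fa: "f a \<in> carrier A" using f a by simp
    have "\<ominus> x \<ominus> (\<zero> \<ominus> f a) = \<ominus> (x \<ominus> f a)" using f(1) fa by algebra
    then have "\<ominus> x \<ominus> (\<lambda>b\<in>carrier A. (\<lambda>b\<in>carrier A. \<zero>) b \<ominus> f b) a \<in> mA"
      using f a mA_facts(5) by simp
    then show "\<ominus> x \<in> K" unfolding K_def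
      using f A.mult_maps_diff[OF A.mult_maps_zero_map f(2)] by blast
    { fix y assume "y \<in> K"
      then obtain g where g: "y \<in> carrier A" "g \<in> mult_maps A" "y \<ominus> g a \<in> mA" by (auto simp: K_def)
      have ga: "g a \<in> carrier A" using g a by simp
      have "(x \<oplus> y) \<ominus> (f a \<oplus> g a) = (x \<ominus> f a) \<oplus> (y \<ominus> g a)" using f(1) g(1) fa ga by algebra
      then have "(x \<oplus> y) \<ominus> (\<lambda>b\<in>carrier A. f b \<oplus> g b) a \<in> mA"
        using f g a mA_facts(3) by simp
      then show "x \<oplus> y \<in> K" unfolding K_def
        using f g mult_maps.sum[OF f(2) g(2)] by blast }
    fix y assume y: "y \<in> carrier A"
    have "y \<otimes> x \<ominus> y \<otimes> f a = y \<otimes> (x \<ominus> f a)" using f(1) fa y by algebra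
    then have "y \<otimes> x \<ominus> (\<lambda>b\<in>carrier A. y \<otimes> f b) a \<in> mA"
      using f a y mA.I_l_closed by simp
    then show "y \<otimes> x \<in> K" unfolding K_def
      using f y A.mult_maps_lmult[OF f(2) y] by blast
    have "x \<otimes> y \<ominus> f a \<otimes> y = (x \<ominus> f a) \<otimes> y" using f(1) fa y by algebra
    then have "x \<otimes> y \<ominus> (\<lambda>b\<in>carrier A. f b \<otimes> y) a \<in> mA"
      using f a y mA.I_r_closed by simp
    then show "x \<otimes> y \<in> K" unfolding K_def
      using f y A.mult_maps_rmult[OF f(2) y] by blast
  qed
  have aK: "a \<in> K" unfolding K_def using a mA_facts(2) A.mult_maps_id
    by (auto simp: A.minus_eq A.r_neg intro!: bexI[of _ "\<lambda>a\<in>carrier A. a"])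
  have simp: "simple_ring ?Q" using fibre by (simp add: central_simple_algebra_def)
  let ?K = "(+>) mA ` K"
  have K: "ideal ?K (A Quot mA)"
    by (rule A.ring_ideal_imp_quot_ideal[OF mA_ideal \<open>ideal K A\<close>])
  have "ideal ?K ?Q"
  proof (rule idealI)
    show "ring ?Q" using simp by (simp add: simple_ring_def)
    show "subgroup ?K (add_monoid ?Q)"
      using additive_subgroup.a_subgroup[OF ideal.axioms(1)[OF K]]
      unfolding subgroup_def m_inv_def quot_algebra_def by simp
  next
    fix a x assume "a \<in> ?K" "x \<in> carrier ?Q"
    then show "x \<otimes>\<^bsub>?Q\<^esub> a \<in> ?K" "a \<otimes>\<^bsub>?Q\<^esub> x \<in> ?K"
      using ideal.I_l_closed[OF K] ideal.I_r_closed[OF K] by (auto simp: quot_algebra_def)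
  qed
  then have "?K = {\<zero>\<^bsub>?Q\<^esub>} \<or> ?K = carrier ?Q" using simp by (simp add: simple_ring_def)
  moreover have "?K \<noteq> {\<zero>\<^bsub>?Q\<^esub>}"
  proof
    assume "?K = {\<zero>\<^bsub>?Q\<^esub>}"
    then have "mA +> a = mA" using aK by (auto simp: quot_algebra_def FactRing_def)
    then show False using a mA.rcos_const_imp_mem by blast
  qed
  ultimately have "?K = carrier (A Quot mA)" by (simp add: quot_algebra_def)
  moreover have "mA +> \<one> \<in> carrier (A Quot mA)" by (auto simp: FactRing_simps)
  ultimately obtain x where x: "x \<in> K" "mA +> \<one> = mA +> x" by blast
  then obtain f where f: "x \<in> carrier A" "f \<in> mult_maps A" "x \<ominus> f a \<in> mA" by (auto simp: K_def)
  have fa: "f a \<in> carrier A" using f a by simp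
  have "\<one> \<ominus> x \<in> mA" using x f coset_eq_iff by simp
  moreover have "f a \<ominus> \<one> = \<ominus> ((\<one> \<ominus> x) \<oplus> (x \<ominus> f a))"
    using f(1) fa by algebra
  ultimately have "f a \<ominus> \<one> \<in> mA" using f mA_facts by simp
  then show thesis using that f by blast
qed

text \<open>The class of \<open>z\<close> is central in the fibre, and the center of the fibre
  consists of the classes of scalars.\<close>

lemma fibre_central:
  assumes z: "z \<in> carrier A" and comm: "\<And>a. a \<in> carrier A \<Longrightarrow> z \<otimes> a \<ominus> a \<otimes> z \<in> mA"
  obtains r where "r \<in> carrier R" "z \<ominus> r \<odot> \<one> \<in> mA"
proof -
  let ?Q = "quot_algebra \<mm> A"
  have "mA +> z \<in> center ?Q" unfolding center_def
  proof (intro CollectI conjI ballI)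
    show "mA +> z \<in> carrier ?Q" using z by (auto simp: quot_algebra_def FactRing_simps)
    fix w assume "w \<in> carrier ?Q"
    then obtain a where a: "a \<in> carrier A" "w = mA +> a"
      by (auto simp: quot_algebra_def FactRing_simps)
    then show "(mA +> z) \<otimes>\<^bsub>?Q\<^esub> w = w \<otimes>\<^bsub>?Q\<^esub> (mA +> z)"
      using z comm[OF a(1)] coset_eq_iff[of "z \<otimes> a" "a \<otimes> z"]
      by (simp add: quot_algebra_def FactRing_def mA.rcoset_mult_add)
  qed
  then obtain k where k: "k \<in> carrier (R Quot \<mm>)" "mA +> z = k \<odot>\<^bsub>?Q\<^esub> \<one>\<^bsub>?Q\<^esub>"
    using fibre by (auto simp: central_simple_algebra_def)
  obtain r where r: "r \<in> carrier R" "k = \<mm> +>\<^bsub>R\<^esub> r" using k by (auto simp: FactRing_simps)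
  \<comment> \<open>Scalar multiplication of cosets is a union over representatives, so a single
    pair of representatives already places \<open>r \<odot> \<one>\<close> in the coset of
    \<open>z\<close>; a coset is determined by any of its elements.\<close>
  have "r \<in> k" using r \<mm>.a_rcos_self by simp
  moreover have "\<one> \<in> mA +> \<one>" using mA.a_rcos_self by simp
  moreover have "r \<odot> \<one> \<in> mA +> (r \<odot> \<one>)" using mA.a_rcos_self r by simp
  ultimately have "r \<odot> \<one> \<in> k \<odot>\<^bsub>?Q\<^esub> \<one>\<^bsub>?Q\<^esub>"
    by (auto simp: quot_algebra_def FactRing_def)
  then have "r \<odot> \<one> \<in> mA +> z" using k by simp
  then have "mA +> z = mA +> (r \<odot> \<one>)"
    using z by (metis A.a_repr_independence mA_subgroup)
  then show thesis using that r z coset_eq_iff by simp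
qed

end

section \<open>Dual systems modulo a maximal ideal\<close>

context azumaya_at
begin

text \<open>Equality in the fibre. Membership in the carrier is included so that chains of
  congruences need no side conditions.\<close>

definition eqm :: "'a \<Rightarrow> 'a \<Rightarrow> bool" (infix "\<doteq>" 50) where
  "a \<doteq> b \<longleftrightarrow> a \<in> carrier A \<and> b \<in> carrier A \<and> a \<ominus> b \<in> mA"

lemma eqm_carrier: "a \<doteq> b \<Longrightarrow> a \<in> carrier A" "a \<doteq> b \<Longrightarrow> b \<in> carrier A"
  by (auto simp: eqm_def)

lemma eqm_refl [simp]: "a \<in> carrier A \<Longrightarrow> a \<doteq> a"
  using mA_facts(2) by (simp add: eqm_def A.minus_eq A.r_neg)

lemma eqm_zero_iff: "a \<in> carrier A \<Longrightarrow> a \<doteq> \<zero> \<longleftrightarrow> a \<in> mA"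
  by (simp add: eqm_def A.minus_eq)

lemma eqm_sym: "a \<doteq> b \<Longrightarrow> b \<doteq> a"
proof -
  assume ab: "a \<doteq> b"
  then have "b \<ominus> a = \<ominus> (a \<ominus> b)" using eqm_carrier[OF ab] by algebra
  then show ?thesis using ab mA_facts(5) by (simp add: eqm_def)
qed

lemma eqm_add: "\<lbrakk>a \<doteq> b; c \<doteq> d\<rbrakk> \<Longrightarrow> a \<oplus> c \<doteq> b \<oplus> d"
proof -
  assume e: "a \<doteq> b" "c \<doteq> d"
  have "(a \<oplus> c) \<ominus> (b \<oplus> d) = (a \<ominus> b) \<oplus> (c \<ominus> d)"
    using eqm_carrier[OF e(1)] eqm_carrier[OF e(2)] by algebra
  then show ?thesis using e mA_facts(3) by (simp add: eqm_def)
qed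

lemma eqm_trans [trans]: "\<lbrakk>a \<doteq> b; b \<doteq> c\<rbrakk> \<Longrightarrow> a \<doteq> c"
proof -
  assume e: "a \<doteq> b" "b \<doteq> c"
  have "a \<ominus> c = (a \<ominus> b) \<oplus> (b \<ominus> c)"
    using eqm_carrier[OF e(1)] eqm_carrier[OF e(2)] by algebra
  then show ?thesis using e mA_facts(3) by (simp add: eqm_def)
qed

lemma eqm_mult: "\<lbrakk>a \<doteq> b; c \<doteq> d\<rbrakk> \<Longrightarrow> a \<otimes> c \<doteq> b \<otimes> d"
proof -
  assume e: "a \<doteq> b" "c \<doteq> d"
  have "(a \<otimes> c) \<ominus> (b \<otimes> d) = (a \<ominus> b) \<otimes> c \<oplus> b \<otimes> (c \<ominus> d)"
    using eqm_carrier[OF e(1)] eqm_carrier[OF e(2)] by algebra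
  then show ?thesis using e mA_facts(3) mA.I_l_closed mA.I_r_closed by (simp add: eqm_def)
qed

lemma eqm_smult: "\<lbrakk>r \<in> carrier R; a \<doteq> b\<rbrakk> \<Longrightarrow> r \<odot> a \<doteq> r \<odot> b"
  using eqm_mult[of "r \<odot> \<one>" "r \<odot> \<one>" a b] eqm_carrier[of a b] by (simp add: smult_mult_one)

lemma eqm_diff: "\<lbrakk>a \<doteq> b; c \<doteq> d\<rbrakk> \<Longrightarrow> a \<ominus> c \<doteq> b \<ominus> d"
  using eqm_add[of a b "\<ominus> \<one> \<otimes> c" "\<ominus> \<one> \<otimes> d"] eqm_mult[of "\<ominus> \<one>" "\<ominus> \<one>" c d]
    eqm_carrier[of c d]
  by (simp add: A.minus_eq A.l_minus)

lemma eqm_mult_map: "\<lbrakk>f \<in> mult_maps A; a \<doteq> b\<rbrakk> \<Longrightarrow> f a \<doteq> f b"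
  unfolding eqm_def
  using A.mult_maps_ideal[OF mA_ideal, of f "a \<ominus> b"] by (simp add: A.mult_maps_minus)

lemma eqm_mA: "a \<doteq> b \<Longrightarrow> a \<in> mA \<longleftrightarrow> b \<in> mA"
  by (metis eqm_carrier eqm_sym eqm_trans eqm_zero_iff)

lemma eqm_finsum:
  assumes "finite C" "\<And>c. c \<in> C \<Longrightarrow> F c \<doteq> G c"
  shows "(\<Oplus>c\<in>C. F c) \<doteq> (\<Oplus>c\<in>C. G c)"
  using assms
proof (induction C)
  case (insert c C)
  have "F \<in> insert c C \<rightarrow> carrier A" "G \<in> insert c C \<rightarrow> carrier A"
    using insert.prems eqm_carrier by blast+
  then show ?case using insert eqm_add by simp
qed simp

text \<open>The preimage in \<open>A\<close> of the span of \<open>C\<close> in the fibre.\<close>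

definition mspan :: "'a set \<Rightarrow> 'a set" where "mspan C = lin_span A (carrier R) C mA"

lemma mspan_submodule: "C \<subseteq> carrier A \<Longrightarrow> submodule (mspan C) R A"
  unfolding mspan_def by (rule lin_span_submodule[OF R.oneideal _ mA_submodule])

lemma mA_subset_mspan: "mA \<subseteq> mspan C"
  unfolding mspan_def by (auto intro: lin_span.base)

lemma mspan_superset: "C \<subseteq> carrier A \<Longrightarrow> C \<subseteq> mspan C"
  unfolding mspan_def by (rule lin_span_superset[OF _ mA_facts(2)])

lemma mspan_mono: "C \<subseteq> D \<Longrightarrow> mspan C \<subseteq> mspan D"
  unfolding mspan_def by (rule lin_span_mono) auto

lemma eqm_mspan: 
  assumes "C \<subseteq> carrier A" "a \<doteq> b" "b \<in> mspan C"
  shows "a \<in> mspan C"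
proof -
  have "a = (a \<ominus> b) \<oplus> b" using eqm_carrier[OF assms(2)] by algebra
  moreover have "a \<ominus> b \<in> mspan C" using assms(2) mA_subset_mspan by (auto simp: eqm_def)
  ultimately show ?thesis using submodule_facts(3)[OF mspan_submodule[OF assms(1)]] assms(3)
    by metis
qed

text \<open>Linear independence in the fibre, certified by multiplication maps. The
  \<open>h c\<close> take values in \<open>A\<close> and not in \<open>R\<close>; this is what
  allows a ring homomorphism to transport them, and scalar-valued forms are extracted from them only
  later.\<close>

definition dual_system :: "'a set \<Rightarrow> ('a \<Rightarrow> 'a \<Rightarrow> 'a) \<Rightarrow> bool" where
  "dual_system C h \<longleftrightarrow> finite C \<and> C \<subseteq> carrier A \<and> (\<forall>c\<in>C. h c \<in> mult_maps A) \<and>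
     (\<forall>c\<in>C. \<forall>d\<in>C. h c d \<doteq> (if c = d then \<one> else \<zero>))"

lemma dual_systemD:
  assumes "dual_system C h"
  shows "finite C" "C \<subseteq> carrier A" "\<And>c. c \<in> C \<Longrightarrow> h c \<in> mult_maps A"
    "\<And>c. c \<in> C \<Longrightarrow> h c c \<doteq> \<one>" "\<And>c d. \<lbrakk>c \<in> C; d \<in> C; c \<noteq> d\<rbrakk> \<Longrightarrow> h c d \<in> mA"
proof -
  show "finite C" "C \<subseteq> carrier A" "\<And>c. c \<in> C \<Longrightarrow> h c \<in> mult_maps A"
    using assms by (auto simp: dual_system_def)
  show "h c c \<doteq> \<one>" if "c \<in> C" for c
  proof -
    have "h c c \<doteq> (if c = c then \<one> else \<zero>)" using assms that unfolding dual_system_def by blast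
    then show ?thesis by simp
  qed
  show "h c d \<in> mA" if "c \<in> C" "d \<in> C" "c \<noteq> d" for c d
  proof -
    have "h c d \<doteq> (if c = d then \<one> else \<zero>)" using assms that unfolding dual_system_def by blast
    then show ?thesis using that eqm_zero_iff eqm_carrier by auto
  qed
qed

lemma dual_systemI:
  assumes "finite C" "C \<subseteq> carrier A" "\<And>c. c \<in> C \<Longrightarrow> h c \<in> mult_maps A"
    "\<And>c. c \<in> C \<Longrightarrow> h c c \<doteq> \<one>" "\<And>c d. \<lbrakk>c \<in> C; d \<in> C; c \<noteq> d\<rbrakk> \<Longrightarrow> h c d \<in> mA"
  shows "dual_system C h"
proof -
  have "h c d \<doteq> \<zero>" if "c \<in> C" "d \<in> C" "c \<noteq> d" for c d
    using assms(5)[OF that] mA_facts(1) eqm_zero_iff by blast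
  then show ?thesis using assms unfolding dual_system_def by simp
qed

text \<open>If some \<open>h c x\<close> is not central in the fibre, a commutator separates
  \<open>x\<close> from \<open>C\<close>. Otherwise every \<open>h c x\<close> is a scalar there,
  and \<open>a\<close> minus the sum of the \<open>c (h c a)\<close> is a map that kills
  \<open>C\<close> and changes \<open>x\<close> only by an element of the span of \<open>C\<close>,
  so that \<open>x\<close> does not go to zero.\<close>

lemma separating_map:
  assumes C: "dual_system C h" and x: "x \<in> carrier A" "x \<notin> mspan C"
  obtains k where "k \<in> mult_maps A" "\<And>c. c \<in> C \<Longrightarrow> k c \<in> mA" "k x \<notin> mA"
proof (cases "\<exists>c\<in>C. \<exists>d\<in>carrier A. d \<otimes> h c x \<ominus> h c x \<otimes> d \<notin> mA")
  case True
  note C = dual_systemD[OF C]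
  from True obtain c d where cd: "c \<in> C" "d \<in> carrier A" "d \<otimes> h c x \<ominus> h c x \<otimes> d \<notin> mA"
    by blast
  \<comment> \<open>On \<open>C\<close> the values of \<open>h c\<close> are congruent to
    \<open>\<one>\<close> or \<open>\<zero>\<close>, and the commutator with \<open>d\<close> kills
    both.\<close>
  let ?k = "\<lambda>a\<in>carrier A. (\<lambda>a\<in>carrier A. d \<otimes> a \<ominus> a \<otimes> d) (h c a)"
  have "?k \<in> mult_maps A"
    by (rule A.mult_maps_comp[OF A.mult_maps_commutator]) (use cd C in auto)
  moreover have "?k c' \<in> mA" if c': "c' \<in> C" for c'
  proof -
    have hc: "h c c' \<in> carrier A" using C cd c' by auto
    have "d \<otimes> h c c' \<ominus> h c c' \<otimes> d \<in> mA"
    proof (cases "c = c'")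
      case True
      have "d \<otimes> h c c' \<ominus> h c c' \<otimes> d \<doteq> d \<otimes> \<one> \<ominus> \<one> \<otimes> d"
        using C(4)[OF c'] True cd(2) by (intro eqm_diff eqm_mult) auto
      then show ?thesis using cd(2) mA_facts(2) eqm_mA by (auto simp: A.minus_eq A.r_neg)
    next
      case False
      have "h c c' \<in> mA" using False C(5) cd c' by blast
      then show ?thesis using cd(2) mA.I_l_closed mA.I_r_closed mA_facts by (simp add: A.minus_eq)
    qed
    then show ?thesis using c' hc C by auto
  qed
  moreover have "?k x \<notin> mA" using cd x C by simp
  ultimately show thesis by (rule that)
next
  case False
  note C' = dual_systemD[OF C]
  note S = submodule_facts[OF mspan_submodule[OF C'(2)]]
  have kappa: "\<exists>\<kappa>\<in>carrier R. h c x \<doteq> \<kappa> \<odot> \<one>" if c: "c \<in> C" for c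
  proof -
    have hx: "h c x \<in> carrier A" using C' c x by simp
    have "h c x \<otimes> a \<ominus> a \<otimes> h c x \<in> mA" if a: "a \<in> carrier A" for a
    proof -
      have "a \<otimes> h c x \<ominus> h c x \<otimes> a \<in> mA" using False c a by blast
      moreover have "h c x \<otimes> a \<ominus> a \<otimes> h c x = \<ominus> (a \<otimes> h c x \<ominus> h c x \<otimes> a)"
        using hx a by algebra
      ultimately show ?thesis using mA_facts(5) by simp
    qed
    then obtain r where "r \<in> carrier R" "h c x \<ominus> r \<odot> \<one> \<in> mA"
      using fibre_central[OF hx] by blast
    then show ?thesis using hx by (auto simp: eqm_def)
  qed
  \<comment> \<open>Starting from the identity, the terms \<open>c (h c a)\<close> are subtracted
    for one \<open>c\<close> at a time. Keeping \<open>k x \<ominus> x\<close> in the span of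
    \<open>C\<close> is what finally prevents \<open>k x\<close> from vanishing in the
    fibre.\<close>
  have "\<exists>k\<in>mult_maps A. k x \<ominus> x \<in> mspan C \<and> (\<forall>c\<in>D. k c \<in> mA) \<and> (\<forall>c\<in>C - D. k c \<doteq> c)"
    if "finite D" "D \<subseteq> C" for D
    using that
  proof (induction D)
    case empty
    have "x \<ominus> x \<in> mspan C" using x S(2) by (simp add: A.minus_eq A.r_neg)
    moreover have "c \<doteq> c" if "c \<in> C" for c using C'(2) that by (auto intro: eqm_refl)
    ultimately show ?case using x C'(2) S(2)
      by (intro bexI[OF _ A.mult_maps_id]) (auto simp: subset_iff)
  next
    case (insert c D)
    then obtain k where k: "k \<in> mult_maps A" "k x \<ominus> x \<in> mspan C"
      "\<And>c. c \<in> D \<Longrightarrow> k c \<in> mA" "\<And>c. c \<in> C - D \<Longrightarrow> k c \<doteq> c" by auto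
    have c: "c \<in> C" "c \<in> carrier A" "c \<notin> D" "h c \<in> mult_maps A" using insert C' by auto
    let ?k = "\<lambda>a\<in>carrier A. k a \<ominus> (\<lambda>a\<in>carrier A. c \<otimes> h c a) a"
    have kM: "?k \<in> mult_maps A"
      by (intro A.mult_maps_diff A.mult_maps_lmult k c)
    have kx: "?k x \<ominus> x \<in> mspan C"
    proof -
      \<comment> \<open>Scalarity of \<open>h c x\<close> enters here: the term subtracted at
        \<open>x\<close> is congruent to a multiple of \<open>c\<close> by a scalar, not merely to
        an element of \<open>c A\<close>.\<close>
      obtain \<kappa> where \<kappa>: "\<kappa> \<in> carrier R" "h c x \<doteq> \<kappa> \<odot> \<one>" using kappa c by blast
      have "c \<otimes> h c x \<doteq> c \<otimes> (\<kappa> \<odot> \<one>)" using \<kappa> c by (intro eqm_mult) auto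
      also have "c \<otimes> (\<kappa> \<odot> \<one>) = \<kappa> \<odot> c" using \<kappa> c by (simp add: smult_mult_right)
      finally have "c \<otimes> h c x \<in> mspan C"
        using S(4)[OF \<kappa>(1)] mspan_superset[OF C'(2)] c eqm_mspan[OF C'(2)] by blast
      then have "(k x \<ominus> x) \<oplus> \<ominus> (c \<otimes> h c x) \<in> mspan C" using k S by blast
      moreover have "k x \<in> carrier A" "h c x \<in> carrier A" using k c x by auto
      then have "k x \<ominus> c \<otimes> h c x \<ominus> x = (k x \<ominus> x) \<oplus> \<ominus> (c \<otimes> h c x)"
        using x c(2) by algebra
      ultimately show ?thesis using x by simp
    qed
    have kd: "?k d \<doteq> (if d \<in> insert c D then \<zero> else d)" if d: "d \<in> C" for d
    proof -
      have dA: "d \<in> carrier A" using d C' by auto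
      show ?thesis
      proof (cases "d = c")
        case True
        have "k d \<ominus> c \<otimes> h c d \<doteq> c \<ominus> c \<otimes> \<one>"
          using C'(4)[OF d] k(4)[of d] c True d by (intro eqm_diff eqm_mult) auto
        then show ?thesis using True c by (simp add: A.minus_eq A.r_neg)
      next
        case False
        have hd: "h c d \<doteq> \<zero>" using C'(5)[of c d] c d False eqm_zero_iff mA_facts by auto
        have kd: "k d \<doteq> (if d \<in> D then \<zero> else d)"
          using k(3)[of d] k(4)[of d] d eqm_zero_iff mA_facts by auto
        have "k d \<ominus> c \<otimes> h c d \<doteq> (if d \<in> D then \<zero> else d) \<ominus> c \<otimes> \<zero>"
          using kd hd c by (intro eqm_diff eqm_mult) auto
        then show ?thesis using False c dA by (simp add: A.minus_eq)
      qed
    qed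
    have "?k d \<in> mA" if "d \<in> insert c D" for d
    proof -
      have d: "d \<in> C" "?k d \<doteq> \<zero>" using kd[of d] that insert.prems by auto
      then show ?thesis using eqm_zero_iff eqm_carrier by blast
    qed
    moreover have "?k d \<doteq> d" if "d \<in> C - insert c D" for d
      using kd[of d] that by auto
    ultimately show ?case using kM kx by blast
  qed
  from this[OF C'(1) order_refl] obtain k where k: "k \<in> mult_maps A" "k x \<ominus> x \<in> mspan C"
    "\<And>c. c \<in> C \<Longrightarrow> k c \<in> mA" by auto
  have "k x \<notin> mA"
  proof
    assume "k x \<in> mA"
    then have "k x \<oplus> \<ominus> (k x \<ominus> x) \<in> mspan C"
      by (intro S(3) S(5) k(2) subsetD[OF mA_subset_mspan])
    moreover have "k x \<in> carrier A" using k x by simp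
    then have "k x \<oplus> \<ominus> (k x \<ominus> x) = x" using x(1) by algebra
    ultimately show False using x by simp
  qed
  then show thesis using that k by blast
qed

text \<open>As in Gram-Schmidt: a separating map, normalized at \<open>x\<close> by simplicity of
  the fibre, is dual to \<open>x\<close>, and each older map is corrected by a left multiple of it
  so as to vanish at \<open>x\<close>.\<close>

lemma dual_system_insert:
  assumes C: "dual_system C h" and x: "x \<in> carrier A" "x \<notin> mspan C"
  obtains h' where "dual_system (insert x C) h'"
proof -
  note C' = dual_systemD[OF C]
  obtain k where k: "k \<in> mult_maps A" "\<And>c. c \<in> C \<Longrightarrow> k c \<in> mA" "k x \<notin> mA"
    using separating_map[OF C x] by blast
  obtain l where l: "l \<in> mult_maps A" "l (k x) \<ominus> \<one> \<in> mA"
    using fibre_simple[OF A.mult_maps_closed[OF k(1) x(1)] k(3)] by blast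
  define g where "g = (\<lambda>a\<in>carrier A. l (k a))"
  have gM: "g \<in> mult_maps A" unfolding g_def by (rule A.mult_maps_comp[OF l(1) k(1)])
  have gx: "g x \<doteq> \<one>" using l k x by (simp add: g_def eqm_def)
  have gc: "g c \<in> mA" if "c \<in> C" for c
    using A.mult_maps_ideal[OF mA_ideal l(1) k(2)[OF that]] C'(2) that by (auto simp: g_def)
  have xC: "x \<notin> C" using x mspan_superset[OF C'(2)] by blast
  define h' where "h' c = (if c = x then g
    else (\<lambda>a\<in>carrier A. h c a \<ominus> (\<lambda>a\<in>carrier A. h c x \<otimes> g a) a))" for c
  have "dual_system (insert x C) h'"
  proof (rule dual_systemI)
    show "finite (insert x C)" "insert x C \<subseteq> carrier A" using C' x by auto
    show "h' c \<in> mult_maps A" if "c \<in> insert x C" for c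
      unfolding h'_def using that C'(3) gM x
      by (auto simp del: restrict_apply intro!: A.mult_maps_diff A.mult_maps_lmult)
    have eq: "h' c a = h c a \<ominus> h c x \<otimes> g a" if "c \<in> C" "a \<in> carrier A" for c a
      using that xC by (auto simp: h'_def)
    show "h' c c \<doteq> \<one>" if "c \<in> insert x C" for c
    proof (cases "c = x")
      case True
      then show ?thesis using gx by (simp add: h'_def)
    next
      case False
      then have c: "c \<in> C" "c \<in> carrier A" using that C' by auto
      have "h c c \<ominus> h c x \<otimes> g c \<doteq> \<one> \<ominus> h c x \<otimes> \<zero>"
        using C'(3,4)[OF c(1)] gc[OF c(1)] x eqm_zero_iff mA_facts(1)
        by (intro eqm_diff eqm_mult) auto
      then show ?thesis using c eq C' x by (simp add: A.minus_eq)
    qed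
    show "h' c d \<in> mA" if "c \<in> insert x C" "d \<in> insert x C" "c \<noteq> d" for c d
    proof (cases "c = x")
      case True
      then show ?thesis using that gc by (simp add: h'_def)
    next
      case False
      then have c: "c \<in> C" "c \<in> carrier A" using that C' by auto
      have hx: "h c x \<in> carrier A" using C' c x by simp
      show ?thesis
      proof (cases "d = x")
        case True
        have "h c x \<ominus> h c x \<otimes> g x \<doteq> h c x \<ominus> h c x \<otimes> \<one>"
          using gx hx by (intro eqm_diff eqm_mult) auto
        then have "h c x \<ominus> h c x \<otimes> g x \<doteq> \<zero>" using hx by (simp add: A.minus_eq A.r_neg)
        then show ?thesis using True eq[OF c(1) x(1)] eqm_zero_iff eqm_carrier by metis
      next
        case False
        then have d: "d \<in> C" "d \<in> carrier A" using that C' by auto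
        have "h c d \<in> mA" using C'(5) c d that by blast
        then show ?thesis using eq[OF c(1) d(2)] gc[OF d(1)] hx mA.I_l_closed mA_facts
          by (simp add: A.minus_eq)
      qed
    qed
  qed
  then show thesis by (rule that)
qed

text \<open>The finitely many generators of \<open>A\<close> are treated in turn; each one is
  already in the span or can be adjoined by \<open>dual_system_insert\<close>.\<close>

lemma dual_system_extend:
  assumes C: "dual_system C h"
  obtains C' h' where "C \<subseteq> C'" "dual_system C' h'" "mspan C' = carrier A"
proof -
  obtain B where B: "finite B" "B \<subseteq> carrier A" "\<one> \<in> B" "lin_span A (carrier R) B {\<zero>} = carrier A"
    by (rule generators)
  have "\<exists>C' h'. C \<subseteq> C' \<and> dual_system C' h' \<and> B \<subseteq> mspan C'"
    using B(1,2)
  proof (induction B)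
    case empty
    then show ?case using C by blast
  next
    case (insert b B)
    then obtain C' h' where C': "C \<subseteq> C'" "dual_system C' h'" "B \<subseteq> mspan C'" by auto
    show ?case
    proof (cases "b \<in> mspan C'")
      case True
      then show ?thesis using C' by blast
    next
      case False
      then obtain h'' where h'': "dual_system (insert b C') h''"
        using dual_system_insert[OF C'(2)] insert by blast
      have "mspan C' \<subseteq> mspan (insert b C')" by (rule mspan_mono) blast
      moreover have "b \<in> mspan (insert b C')"
        using mspan_superset[OF dual_systemD(2)[OF h'']] by blast
      ultimately show ?thesis using C' h'' by blast
    qed
  qed
  then obtain C' h' where C': "C \<subseteq> C'" "dual_system C' h'" "B \<subseteq> mspan C'" by blast
  note S = mspan_submodule[OF dual_systemD(2)[OF C'(2)]]
  have "lin_span A (carrier R) B {\<zero>} \<subseteq> mspan C'"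
    by (rule lin_span_minimal[OF S]) (use submodule_facts[OF S] C'(3) in auto)
  then have "mspan C' = carrier A" using B(4) submodule_facts(1)[OF S] by blast
  then show thesis using that C' by blast
qed

text \<open>This is injectivity of the enveloping algebra of the fibre into its endomorphisms.
  Because \<open>(u c v) a y = u (c (v a) y)\<close>, the hypothesis persists when each
  \<open>c\<close> is replaced by \<open>f c\<close> for a multiplication map \<open>f\<close>; with
  \<open>h d\<close> for \<open>f\<close> and \<open>\<one>\<close> for \<open>a\<close> only
  \<open>y d\<close> is left modulo \<open>mA\<close>.\<close>

lemma dual_coefficients:
  assumes C: "dual_system C h" and y: "y \<in> C \<rightarrow> carrier A"
    and small: "\<And>a. a \<in> carrier A \<Longrightarrow> (\<Oplus>c\<in>C. c \<otimes> a \<otimes> y c) \<in> mA"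
    and d: "d \<in> C"
  shows "y d \<in> mA"
proof -
  note C' = dual_systemD[OF C]
  have yc [simp]: "y c \<in> carrier A" "c \<in> carrier A" if "c \<in> C" for c using y that C' by auto
  have "(\<Oplus>c\<in>C. f c \<otimes> a \<otimes> y c) \<in> mA" if "f \<in> mult_maps A" "a \<in> carrier A" for f a
    using that
  proof (induction f arbitrary: a rule: mult_maps.induct)
    case (single u v)
    have "(\<Oplus>c\<in>C. (\<lambda>a\<in>carrier A. u \<otimes> a \<otimes> v) c \<otimes> a \<otimes> y c) = (\<Oplus>c\<in>C. u \<otimes> (c \<otimes> (v \<otimes> a) \<otimes> y c))"
      using single by (intro A.finsum_cong') (auto simp: A.m_assoc)
    also have "\<dots> = u \<otimes> (\<Oplus>c\<in>C. c \<otimes> (v \<otimes> a) \<otimes> y c)"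
      using single C' by (intro A.finsum_rdistr[symmetric]) auto
    finally show ?case using small[of "v \<otimes> a"] single mA.I_l_closed by simp
  next
    case (sum f g)
    have "(\<Oplus>c\<in>C. (\<lambda>a\<in>carrier A. f a \<oplus> g a) c \<otimes> a \<otimes> y c)
       = (\<Oplus>c\<in>C. f c \<otimes> a \<otimes> y c \<oplus> g c \<otimes> a \<otimes> y c)"
      using sum by (intro A.finsum_cong') (auto simp: A.l_distr)
    also have "\<dots> = (\<Oplus>c\<in>C. f c \<otimes> a \<otimes> y c) \<oplus> (\<Oplus>c\<in>C. g c \<otimes> a \<otimes> y c)"
      using sum by (intro A.finsum_addf) auto
    finally show ?case using sum mA_facts(3) by simp
  qed
  from this[OF C'(3)[OF d], of \<one>] have "(\<Oplus>c\<in>C. h d c \<otimes> \<one> \<otimes> y c) \<in> mA" by simp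
  moreover have "(\<Oplus>c\<in>C. h d c \<otimes> \<one> \<otimes> y c) \<doteq> (\<Oplus>c\<in>C. if d = c then y c else \<zero>)"
  proof (rule eqm_finsum[OF C'(1)])
    fix c assume c: "c \<in> C"
    have "h d c \<doteq> (if d = c then \<one> else \<zero>)" using C c d unfolding dual_system_def by blast
    then have "h d c \<otimes> \<one> \<otimes> y c \<doteq> (if d = c then \<one> else \<zero>) \<otimes> \<one> \<otimes> y c"
      using c by (intro eqm_mult) auto
    then show "h d c \<otimes> \<one> \<otimes> y c \<doteq> (if d = c then y c else \<zero>)" using c by (simp split: if_splits)
  qed
  moreover have "(\<Oplus>c\<in>C. if d = c then y c else \<zero>) = y d"
    using A.finsum_singleton[OF d C'(1), of y] by auto
  ultimately show ?thesis using eqm_mA by simp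
qed

text \<open>This is \<open>\<mm>\<close> times the multiplication maps; \<open>small_mapsI\<close>
  shows that it contains every multiplication map with values in \<open>mA\<close>.\<close>

inductive_set small_maps :: "('a \<Rightarrow> 'a) set" where
  small_single: "\<lbrakk>\<mu> \<in> \<mm>; u \<in> carrier A; v \<in> carrier A\<rbrakk>
     \<Longrightarrow> (\<lambda>a\<in>carrier A. \<mu> \<odot> (u \<otimes> a \<otimes> v)) \<in> small_maps"
| small_sum: "\<lbrakk>f \<in> small_maps; g \<in> small_maps\<rbrakk> \<Longrightarrow> (\<lambda>a\<in>carrier A. f a \<oplus> g a) \<in> small_maps"

lemma small_maps_closed [simp]: "\<lbrakk>f \<in> small_maps; a \<in> carrier A\<rbrakk> \<Longrightarrow> f a \<in> carrier A"
  by (induction f arbitrary: a rule: small_maps.induct) auto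

lemma small_maps_mA: "\<lbrakk>f \<in> small_maps; a \<in> carrier A\<rbrakk> \<Longrightarrow> f a \<in> mA"
  by (induction f arbitrary: a rule: small_maps.induct) (auto intro: mA_facts(3))

lemma small_maps_zero: "(\<lambda>a\<in>carrier A. \<zero>) \<in> small_maps"
proof -
  have "(\<lambda>a\<in>carrier A. \<zero>) = (\<lambda>a\<in>carrier A. \<zero>\<^bsub>R\<^esub> \<odot> (\<zero> \<otimes> a \<otimes> \<zero>))"
    by (intro restrict_ext) simp
  then show ?thesis using small_single[OF \<mm>.zero_closed, of \<zero> \<zero>] by simp
qed

lemma small_maps_smult:
  "\<lbrakk>f \<in> small_maps; r \<in> carrier R\<rbrakk> \<Longrightarrow> (\<lambda>a\<in>carrier A. r \<odot> f a) \<in> small_maps"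
proof (induction f rule: small_maps.induct)
  case (small_single \<mu> u v)
  have "(\<lambda>a\<in>carrier A. r \<odot> (\<lambda>a\<in>carrier A. \<mu> \<odot> (u \<otimes> a \<otimes> v)) a)
    = (\<lambda>a\<in>carrier A. (r \<otimes>\<^bsub>R\<^esub> \<mu>) \<odot> (u \<otimes> a \<otimes> v))"
    using small_single by (intro restrict_ext) (simp add: smult_assoc1)
  then show ?case using small_single \<mm>.I_l_closed by (simp only: small_maps.small_single)
next
  case (small_sum f g)
  have "(\<lambda>a\<in>carrier A. r \<odot> (\<lambda>a\<in>carrier A. f a \<oplus> g a) a)
    = (\<lambda>a\<in>carrier A. (\<lambda>a\<in>carrier A. r \<odot> f a) a \<oplus> (\<lambda>a\<in>carrier A. r \<odot> g a) a)"
    using small_sum by (intro restrict_ext) (simp add: smult_r_distr)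
  then show ?case using small_sum by (simp only: small_maps.small_sum)
qed

lemma small_maps_mA_left:
  assumes "u \<in> mA" "v \<in> carrier A"
  shows "(\<lambda>a\<in>carrier A. u \<otimes> a \<otimes> v) \<in> small_maps"
proof -
  let ?K = "{u \<in> carrier A. (\<lambda>a\<in>carrier A. u \<otimes> a \<otimes> v) \<in> small_maps}"
  have smult: "r \<odot> w \<in> ?K" if "r \<in> carrier R" "w \<in> ?K" for r w
  proof -
    have "(\<lambda>a\<in>carrier A. (r \<odot> w) \<otimes> a \<otimes> v) = (\<lambda>a\<in>carrier A. r \<odot> (\<lambda>a\<in>carrier A. w \<otimes> a \<otimes> v) a)"
      using that assms by (intro restrict_ext) (simp add: smult_mult_left)
    moreover have "r \<odot> w \<in> carrier A" using that by simp
    ultimately show ?thesis using small_maps_smult that by (simp del: restrict_apply)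
  qed
  have "submodule ?K R A"
  proof (rule submoduleI')
    show "\<zero> \<in> ?K" using small_maps_zero assms by (simp cong: restrict_cong)
    fix w w' assume w: "w \<in> ?K" and w': "w' \<in> ?K"
    have "(\<lambda>a\<in>carrier A. (w \<oplus> w') \<otimes> a \<otimes> v)
      = (\<lambda>a\<in>carrier A. (\<lambda>a\<in>carrier A. w \<otimes> a \<otimes> v) a \<oplus> (\<lambda>a\<in>carrier A. w' \<otimes> a \<otimes> v) a)"
      using w w' assms by (intro restrict_ext) (simp add: A.l_distr)
    then show "w \<oplus> w' \<in> ?K" using small_sum w w' by (simp del: restrict_apply)
  qed (use smult in auto)
  moreover have "\<mu> \<odot> a \<in> ?K" if "\<mu> \<in> \<mm>" "a \<in> carrier A" for \<mu> a
    using that assms small_single[of \<mu> a v] by (simp add: smult_mult_left cong: restrict_cong)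
  ultimately show ?thesis using mA_minimal[of ?K] assms by blast
qed

lemma small_maps_mA_right:
  assumes "u \<in> carrier A" "v \<in> mA"
  shows "(\<lambda>a\<in>carrier A. u \<otimes> a \<otimes> v) \<in> small_maps"
proof -
  let ?K = "{v \<in> carrier A. (\<lambda>a\<in>carrier A. u \<otimes> a \<otimes> v) \<in> small_maps}"
  have smult: "r \<odot> w \<in> ?K" if "r \<in> carrier R" "w \<in> ?K" for r w
  proof -
    have "(\<lambda>a\<in>carrier A. u \<otimes> a \<otimes> (r \<odot> w)) = (\<lambda>a\<in>carrier A. r \<odot> (\<lambda>a\<in>carrier A. u \<otimes> a \<otimes> w) a)"
      using that assms by (intro restrict_ext) (simp add: smult_mult_right)
    moreover have "r \<odot> w \<in> carrier A" using that by simp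
    ultimately show ?thesis using small_maps_smult that by (simp del: restrict_apply)
  qed
  have "submodule ?K R A"
  proof (rule submoduleI')
    show "\<zero> \<in> ?K" using small_maps_zero assms by (simp cong: restrict_cong)
    fix w w' assume w: "w \<in> ?K" and w': "w' \<in> ?K"
    have "(\<lambda>a\<in>carrier A. u \<otimes> a \<otimes> (w \<oplus> w'))
      = (\<lambda>a\<in>carrier A. (\<lambda>a\<in>carrier A. u \<otimes> a \<otimes> w) a \<oplus> (\<lambda>a\<in>carrier A. u \<otimes> a \<otimes> w') a)"
      using w w' assms by (intro restrict_ext) (simp add: A.r_distr)
    then show "w \<oplus> w' \<in> ?K" using small_sum w w' by (simp del: restrict_apply)
  qed (use smult in auto)
  moreover have "\<mu> \<odot> a \<in> ?K" if "\<mu> \<in> \<mm>" "a \<in> carrier A" for \<mu> a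
    using that assms small_single[of \<mu> u a] by (simp add: smult_mult_right cong: restrict_cong)
  ultimately show ?thesis using mA_minimal[of ?K] assms by blast
qed

text \<open>The left factor of each summand \<open>u a v\<close> is expanded in \<open>C\<close>
  modulo \<open>mA\<close>; its scalar coefficients move over to the right factor, and the part in
  \<open>mA\<close> yields a small map.\<close>

lemma mult_map_decomposition:
  assumes C: "dual_system C h" "mspan C = carrier A" and f: "f \<in> mult_maps A"
  shows "\<exists>y\<in>C \<rightarrow> carrier A. \<exists>n\<in>small_maps. \<forall>a\<in>carrier A. f a = (\<Oplus>c\<in>C. c \<otimes> a \<otimes> y c) \<oplus> n a"
  using f
proof induction
  case (single u v)
  note C' = dual_systemD[OF C(1)]
  have "u \<in> lin_span A (carrier R) C mA" using single C(2) by (simp add: mspan_def)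
  then show ?case
  proof induction
    case (base u)
    have 1: "(\<lambda>a\<in>carrier A. u \<otimes> a \<otimes> v) \<in> small_maps" using small_maps_mA_left base single by blast
    have 2: "(\<Oplus>c\<in>C. c \<otimes> a \<otimes> \<zero>) = \<zero>" if "a \<in> carrier A" for a
      using that C'(2) by (intro A.add.finprod_one_eqI) (auto simp: subset_iff)
    show ?case
      by (rule bexI[of _ "\<lambda>_. \<zero>"], rule bexI[OF _ 1]) (use 2 base mA_facts(1) single in auto)
  next
    case (step r c x)
    then obtain y n where yn: "y \<in> C \<rightarrow> carrier A" "n \<in> small_maps"
      "\<And>a. a \<in> carrier A \<Longrightarrow> x \<otimes> a \<otimes> v = (\<Oplus>c\<in>C. c \<otimes> a \<otimes> y c) \<oplus> n a" by auto
    have c: "c \<in> carrier A" using step C' by auto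
    have yc [simp]: "y d \<in> carrier A" "d \<in> carrier A" if "d \<in> C" for d using yn that C' by auto
    have x: "x \<in> carrier A"
      using step lin_span_closed[OF order_refl C'(2) mA_facts(1)] by blast
    \<comment> \<open>The new summand \<open>(r \<odot> c) a v\<close> equals
      \<open>c a (r \<odot> v)\<close> and is absorbed into the right factor at
      \<open>c\<close>.\<close>
    define y' where "y' d = y d \<oplus> (if c = d then r \<odot> v else \<zero>)" for d
    have y': "y' \<in> C \<rightarrow> carrier A" using step single by (auto simp: y'_def)
    have "(r \<odot> c \<oplus> x) \<otimes> a \<otimes> v = (\<Oplus>d\<in>C. d \<otimes> a \<otimes> y' d) \<oplus> n a" if a: "a \<in> carrier A" for a
    proof -
      have "(\<Oplus>d\<in>C. d \<otimes> a \<otimes> y' d) = (\<Oplus>d\<in>C. d \<otimes> a \<otimes> y d \<oplus> (if c = d then d \<otimes> a \<otimes> (r \<odot> v) else \<zero>))"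
        using a step single by (intro A.finsum_cong') (auto simp: y'_def A.r_distr)
      also have "\<dots> = (\<Oplus>d\<in>C. d \<otimes> a \<otimes> y d) \<oplus> (\<Oplus>d\<in>C. if c = d then d \<otimes> a \<otimes> (r \<odot> v) else \<zero>)"
        using a step single by (intro A.finsum_addf) auto
      also have "(\<Oplus>d\<in>C. if c = d then d \<otimes> a \<otimes> (r \<odot> v) else \<zero>) = c \<otimes> a \<otimes> (r \<odot> v)"
        using a step single by (intro A.finsum_singleton C') auto
      finally have e: "(\<Oplus>d\<in>C. d \<otimes> a \<otimes> y' d) = (\<Oplus>d\<in>C. d \<otimes> a \<otimes> y d) \<oplus> c \<otimes> a \<otimes> (r \<odot> v)" .
      have S: "(\<Oplus>d\<in>C. d \<otimes> a \<otimes> y d) \<in> carrier A" using a by (intro A.finsum_closed) auto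
      have "(r \<odot> c \<oplus> x) \<otimes> a \<otimes> v = c \<otimes> a \<otimes> (r \<odot> v) \<oplus> x \<otimes> a \<otimes> v"
        using a c x step single by (simp add: A.l_distr smult_mult_left smult_mult_right)
      also have "\<dots> = (\<Oplus>d\<in>C. d \<otimes> a \<otimes> y' d) \<oplus> n a"
        unfolding yn(3)[OF a] e using S a c step single yn(2) by (simp add: A.a_ac)
      finally show ?thesis .
    qed
    then show ?case using y' yn(2)
      by (intro bexI[of _ y'] bexI[of _ n]) (auto simp: step)
  qed
next
  case (sum f g)
  note C' = dual_systemD[OF C(1)]
  from sum obtain y n where yn: "y \<in> C \<rightarrow> carrier A" "n \<in> small_maps"
    "\<And>a. a \<in> carrier A \<Longrightarrow> f a = (\<Oplus>c\<in>C. c \<otimes> a \<otimes> y c) \<oplus> n a" by blast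
  from sum obtain z k where zk: "z \<in> C \<rightarrow> carrier A" "k \<in> small_maps"
    "\<And>a. a \<in> carrier A \<Longrightarrow> g a = (\<Oplus>c\<in>C. c \<otimes> a \<otimes> z c) \<oplus> k a" by blast
  have c [simp]: "y d \<in> carrier A" "z d \<in> carrier A" "d \<in> carrier A" if "d \<in> C" for d
    using yn zk that C' by auto
  have "f a \<oplus> g a = (\<Oplus>c\<in>C. c \<otimes> a \<otimes> (y c \<oplus> z c)) \<oplus> (\<lambda>a\<in>carrier A. n a \<oplus> k a) a"
    if a: "a \<in> carrier A" for a
  proof -
    have "(\<Oplus>c\<in>C. c \<otimes> a \<otimes> (y c \<oplus> z c)) = (\<Oplus>c\<in>C. c \<otimes> a \<otimes> y c \<oplus> c \<otimes> a \<otimes> z c)"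
      using a by (intro A.finsum_cong') (auto simp: A.r_distr)
    also have "\<dots> = (\<Oplus>c\<in>C. c \<otimes> a \<otimes> y c) \<oplus> (\<Oplus>c\<in>C. c \<otimes> a \<otimes> z c)"
      using a by (intro A.finsum_addf) auto
    finally have e: "(\<Oplus>c\<in>C. c \<otimes> a \<otimes> (y c \<oplus> z c))
       = (\<Oplus>c\<in>C. c \<otimes> a \<otimes> y c) \<oplus> (\<Oplus>c\<in>C. c \<otimes> a \<otimes> z c)" .
    have S: "(\<Oplus>c\<in>C. c \<otimes> a \<otimes> y c) \<in> carrier A" "(\<Oplus>c\<in>C. c \<otimes> a \<otimes> z c) \<in> carrier A"
      using a by (auto intro!: A.finsum_closed)
    show ?thesis unfolding yn(3)[OF a] zk(3)[OF a] e using S a yn(2) zk(2) by (simp add: A.a_ac)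
  qed
  then show ?case using yn(1) zk(1) small_sum[OF yn(2) zk(2)]
    by (intro bexI[of _ "\<lambda>c. y c \<oplus> z c"] bexI[of _ "\<lambda>a\<in>carrier A. n a \<oplus> k a"]) auto
qed

lemma small_maps_finsum:
  assumes "finite C" "\<And>c. c \<in> C \<Longrightarrow> (\<lambda>a\<in>carrier A. F c a) \<in> small_maps"
  shows "(\<lambda>a\<in>carrier A. \<Oplus>c\<in>C. F c a) \<in> small_maps"
  using assms
proof (induction C)
  case empty
  then show ?case using small_maps_zero by (simp only: A.finsum_empty)
next
  case (insert c C)
  have cl: "F d a \<in> carrier A" if "d \<in> insert c C" "a \<in> carrier A" for d a
    using small_maps_closed[OF insert.prems(1)[OF that(1)] that(2)] that(2) by simp
  have "(\<lambda>a\<in>carrier A. \<Oplus>c\<in>insert c C. F c a)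
    = (\<lambda>a\<in>carrier A. (\<lambda>a\<in>carrier A. F c a) a \<oplus> (\<lambda>a\<in>carrier A. \<Oplus>c\<in>C. F c a) a)"
    using cl insert.hyps by (intro restrict_ext) (auto intro!: A.finsum_insert)
  then show ?case using small_sum[OF insert.prems(1) insert.IH] insert.prems
    by (simp del: restrict_apply)
qed

text \<open>In the decomposition over a spanning dual system the sum has values in \<open>mA\<close>
  as well, so by \<open>dual_coefficients\<close> its right factors lie in \<open>mA\<close> and
  each summand is small. A pointwise condition thus becomes membership in \<open>\<mm>\<close> times
  the maps, the form in which Nakayama's lemma can use it.\<close>

lemma small_mapsI:
  assumes f: "f \<in> mult_maps A" and small: "\<And>a. a \<in> carrier A \<Longrightarrow> f a \<in> mA"
  shows "f \<in> small_maps"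
proof -
  have "dual_system {} undefined" by (rule dual_systemI) auto
  then obtain C h where "{} \<subseteq> C" and C: "dual_system C h" "mspan C = carrier A"
    by (rule dual_system_extend)
  note C' = dual_systemD[OF C(1)]
  obtain y n where yn: "y \<in> C \<rightarrow> carrier A" "n \<in> small_maps"
    "\<And>a. a \<in> carrier A \<Longrightarrow> f a = (\<Oplus>c\<in>C. c \<otimes> a \<otimes> y c) \<oplus> n a"
    using mult_map_decomposition[OF C f] by blast
  have [simp]: "y d \<in> carrier A" "d \<in> carrier A" if "d \<in> C" for d using yn that C' by auto
  have "(\<Oplus>c\<in>C. c \<otimes> a \<otimes> y c) \<in> mA" if a: "a \<in> carrier A" for a
  proof -
    have S: "(\<Oplus>c\<in>C. c \<otimes> a \<otimes> y c) \<in> carrier A" "n a \<in> carrier A"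
      using a yn(2) by (auto intro!: A.finsum_closed)
    have "(\<Oplus>c\<in>C. c \<otimes> a \<otimes> y c) = f a \<ominus> n a"
      unfolding yn(3)[OF a] using S by (simp add: A.minus_eq A.a_assoc A.r_neg)
    then show ?thesis using small[OF a] small_maps_mA[OF yn(2) a] mA_facts by (simp add: A.minus_eq)
  qed
  then have y: "y c \<in> mA" if "c \<in> C" for c using dual_coefficients[OF C(1) yn(1)] that by blast
  have "(\<lambda>a\<in>carrier A. \<Oplus>c\<in>C. c \<otimes> a \<otimes> y c) \<in> small_maps"
    using C'(1) by (rule small_maps_finsum) (simp add: small_maps_mA_right y)
  from small_sum[OF this yn(2)] have g: "(\<lambda>a\<in>carrier A. f a) \<in> small_maps"
    by (simp add: yn(3) cong: restrict_cong)
  have "(\<lambda>a\<in>carrier A. f a) = f"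
    using A.mult_maps_extensional[OF f] by (simp add: extensional_restrict)
  then show ?thesis using g by simp
qed

text \<open>The system \<open>{\<one>}\<close> is dual to the identity. In a spanning extension the
  map attached to \<open>\<one>\<close> reads off the coefficient of \<open>\<one>\<close> modulo
  \<open>mA\<close>, which is a scalar.\<close>

lemma scalar_projection:
  obtains g where "g \<in> mult_maps A" "g \<one> = \<one>"
    "\<And>a. a \<in> carrier A \<Longrightarrow> \<exists>r\<in>carrier R. g a \<doteq> r \<odot> \<one>"
proof -
  have "dual_system {\<one>} (\<lambda>_. \<lambda>a\<in>carrier A. a)"
    using A.mult_maps_id by (intro dual_systemI) auto
  then obtain C h where C: "{\<one>} \<subseteq> C" "dual_system C h" "mspan C = carrier A"
    by (rule dual_system_extend)
  note C' = dual_systemD[OF C(2)]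
  have one: "\<one> \<in> C" using C by simp
  let ?u = "h \<one> \<one> \<ominus> \<one>"
  have h1: "h \<one> \<in> mult_maps A" and u: "?u \<in> mA" using C'(3,4)[OF one] by (auto simp: eqm_def)
  then have uA: "?u \<in> carrier A" "h \<one> \<one> \<in> carrier A" using mA_facts by auto
  have g0: "\<exists>r\<in>carrier R. h \<one> a \<doteq> r \<odot> \<one>" if "a \<in> carrier A" for a
  proof -
    have "a \<in> lin_span A (carrier R) C mA" using that C(3) by (simp add: mspan_def)
    then show ?thesis
    proof induction
      case (base n)
      then have "h \<one> n \<in> mA" "n \<in> carrier A" using A.mult_maps_ideal[OF mA_ideal h1] mA_facts by auto
      then have "h \<one> n \<doteq> \<zero>\<^bsub>R\<^esub> \<odot> \<one>" using h1 eqm_zero_iff by simp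
      then show ?case by blast
    next
      case (step r c x)
      then obtain s where s: "s \<in> carrier R" "h \<one> x \<doteq> s \<odot> \<one>" by blast
      have c: "c \<in> carrier A" using step C' by auto
      have x: "x \<in> carrier A"
        using step lin_span_closed[OF order_refl C'(2) mA_facts(1)] by blast
      obtain t where t: "t \<in> carrier R" "h \<one> c \<doteq> t \<odot> \<one>"
      proof (cases "\<one> = c")
        case True
        then have "h \<one> c \<doteq> \<one>\<^bsub>R\<^esub> \<odot> \<one>" using C'(4)[OF one] by (metis A.one_closed smult_one)
        then show ?thesis using that by blast
      next
        case False
        then have "h \<one> c \<doteq> \<zero>\<^bsub>R\<^esub> \<odot> \<one>" using C'(5)[OF one _ False] step eqm_zero_iff h1 c by simp
        then show ?thesis using that by blast
      qed
      have "h \<one> (r \<odot> c \<oplus> x) = r \<odot> h \<one> c \<oplus> h \<one> x"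
        using step c x h1 by (simp add: A.mult_maps_add mult_maps_smult)
      also have "\<dots> \<doteq> r \<odot> (t \<odot> \<one>) \<oplus> s \<odot> \<one>"
        using s t step by (intro eqm_add eqm_smult)
      also have "\<dots> = (r \<otimes>\<^bsub>R\<^esub> t \<oplus>\<^bsub>R\<^esub> s) \<odot> \<one>" using s t step by (simp add: smult_l_distr smult_assoc1)
      finally show ?case using s t step by blast
    qed
  qed
  \<comment> \<open>\<open>h \<one> \<one>\<close> equals \<open>\<one>\<close> only modulo
    \<open>mA\<close>. Subtracting the left multiplication by the error makes the value at
    \<open>\<one>\<close> exact and changes nothing in the fibre.\<close>
  let ?g = "\<lambda>a\<in>carrier A. h \<one> a \<ominus> (\<lambda>a\<in>carrier A. ?u \<otimes> a) a"
  have "?g \<in> mult_maps A" by (intro A.mult_maps_diff h1 A.mult_maps_lmultiplication uA)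
  moreover have "?g \<one> = \<one>"
  proof -
    have "h \<one> \<one> \<ominus> (h \<one> \<one> \<ominus> \<one>) = \<one>" using uA(2) by algebra
    then show ?thesis using uA by simp
  qed
  moreover have "\<exists>r\<in>carrier R. ?g a \<doteq> r \<odot> \<one>" if a: "a \<in> carrier A" for a
  proof -
    obtain r where r: "r \<in> carrier R" "h \<one> a \<doteq> r \<odot> \<one>" using g0 a by blast
    have "?u \<otimes> a \<in> mA" using u a mA.I_r_closed by blast
    then have "?u \<otimes> a \<doteq> \<zero>" using eqm_zero_iff uA a by simp
    then have "h \<one> a \<ominus> ?u \<otimes> a \<doteq> r \<odot> \<one> \<ominus> \<zero>" using r by (intro eqm_diff)
    then show ?thesis using r a by (auto simp: A.minus_eq)
  qed
  ultimately show thesis by (rule that)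
qed

end

section \<open>The ring of multiplication maps and linear forms\<close>

definition mult_ring :: "('a, 'q) ring_scheme \<Rightarrow> ('a \<Rightarrow> 'a) ring" where
  "mult_ring A = \<lparr>carrier = mult_maps A,
     monoid.mult = (\<lambda>f g. \<lambda>a\<in>carrier A. f (g a)), one = (\<lambda>a\<in>carrier A. a),
     ring.zero = (\<lambda>a\<in>carrier A. \<zero>\<^bsub>A\<^esub>), add = (\<lambda>f g. \<lambda>a\<in>carrier A. f a \<oplus>\<^bsub>A\<^esub> g a)\<rparr>"

context ring
begin

lemma mult_ring_ring: "ring (mult_ring R)"
proof (rule ringI)
  note ext = mult_maps_eqI
  show "abelian_group (mult_ring R)"
  proof (rule abelian_groupI)
    fix f assume f: "f \<in> carrier (mult_ring R)"
    show "\<exists>g\<in>carrier (mult_ring R). g \<oplus>\<^bsub>mult_ring R\<^esub> f = \<zero>\<^bsub>mult_ring R\<^esub>"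
      using f mult_maps_diff[OF mult_maps_zero_map, of f]
      by (intro bexI[of _ "\<lambda>a\<in>carrier R. (\<lambda>a\<in>carrier R. \<zero>) a \<ominus> f a"])
        (auto simp: mult_ring_def minus_eq l_neg intro!: restrict_ext)
    show "\<zero>\<^bsub>mult_ring R\<^esub> \<oplus>\<^bsub>mult_ring R\<^esub> f = f"
      using f by (intro ext[symmetric]) (auto simp: mult_ring_def)
  qed (auto simp: mult_ring_def mult_maps.sum mult_maps_zero_map a_ac simp del: restrict_apply
      intro!: restrict_ext, auto simp: a_ac)
  show "Group.monoid (mult_ring R)"
  proof (rule monoidI)
    fix f assume f: "f \<in> carrier (mult_ring R)"
    show "\<one>\<^bsub>mult_ring R\<^esub> \<otimes>\<^bsub>mult_ring R\<^esub> f = f" "f \<otimes>\<^bsub>mult_ring R\<^esub> \<one>\<^bsub>mult_ring R\<^esub> = f"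
      using f by (intro ext[symmetric], auto simp: mult_ring_def)+
  qed (auto simp: mult_ring_def mult_maps_comp mult_maps_id simp del: restrict_apply
      intro!: restrict_ext, auto)
qed (auto simp: mult_ring_def mult_maps_add simp del: restrict_apply intro!: restrict_ext,
    auto simp: mult_maps_add)

text \<open>In the ring of multiplication maps, right multiplication is precomposition. Letting a
  commutative subring act in this way brings \<open>f \<mapsto> f \<circ> g\<close> within the reach
  of Nakayama's lemma.\<close>

definition right_module :: "('a, 'a) module" where
  "right_module = \<lparr>carrier = carrier R, monoid.mult = (\<otimes>), one = \<one>, ring.zero = \<zero>,
     add = (\<oplus>), smult = (\<lambda>s u. u \<otimes> s)\<rparr>"

lemma right_module:
  assumes "subcring S R"
  shows "module (R\<lparr>carrier := S\<rparr>) right_module"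
proof (rule moduleI)
  have S: "S \<subseteq> carrier R" using assms subcringE(1) by blast
  show "cring (R\<lparr>carrier := S\<rparr>)" using assms subcring_iff[OF S] by blast
  have com: "s \<otimes> t = t \<otimes> s" if "s \<in> S" "t \<in> S" for s t
    using subcringE(8)[OF assms] that .
  show "abelian_group right_module"
  proof (rule abelian_groupI)
    fix x assume "x \<in> carrier right_module"
    then have x: "x \<in> carrier R" by (simp add: right_module_def)
    then have "\<ominus> x \<oplus> x = \<zero>" "\<ominus> x \<in> carrier R" by (simp_all add: l_neg)
    then show "\<exists>y\<in>carrier right_module. y \<oplus>\<^bsub>right_module\<^esub> x = \<zero>\<^bsub>right_module\<^esub>"
      by (auto simp: right_module_def)
  qed (auto simp: right_module_def a_assoc intro: a_comm)
  fix a b x assume "a \<in> carrier (R\<lparr>carrier := S\<rparr>)" "b \<in> carrier (R\<lparr>carrier := S\<rparr>)"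
    "x \<in> carrier right_module"
  then show "(a \<otimes>\<^bsub>R\<lparr>carrier := S\<rparr>\<^esub> b) \<odot>\<^bsub>right_module\<^esub> x
    = a \<odot>\<^bsub>right_module\<^esub> (b \<odot>\<^bsub>right_module\<^esub> x)"
    using S com[of a b] by (simp add: right_module_def m_assoc subset_iff)
qed (use subcringE(1)[OF assms] in \<open>auto simp: right_module_def l_distr r_distr subset_iff\<close>)

end

section \<open>Linear forms, and dual bases up to a denominator\<close>

context module
begin

definition linear_form :: "('c \<Rightarrow> 'a) \<Rightarrow> bool" where
  "linear_form \<epsilon> \<longleftrightarrow> \<epsilon> \<in> carrier M \<rightarrow> carrier R \<and>
     (\<forall>a\<in>carrier M. \<forall>b\<in>carrier M. \<epsilon> (a \<oplus>\<^bsub>M\<^esub> b) = \<epsilon> a \<oplus> \<epsilon> b) \<and>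
     (\<forall>r\<in>carrier R. \<forall>a\<in>carrier M. \<epsilon> (r \<odot>\<^bsub>M\<^esub> a) = r \<otimes> \<epsilon> a)"

lemma linear_formI:
  assumes "\<And>a. a \<in> carrier M \<Longrightarrow> \<epsilon> a \<in> carrier R"
    "\<And>a b. \<lbrakk>a \<in> carrier M; b \<in> carrier M\<rbrakk> \<Longrightarrow> \<epsilon> (a \<oplus>\<^bsub>M\<^esub> b) = \<epsilon> a \<oplus> \<epsilon> b"
    "\<And>r a. \<lbrakk>r \<in> carrier R; a \<in> carrier M\<rbrakk> \<Longrightarrow> \<epsilon> (r \<odot>\<^bsub>M\<^esub> a) = r \<otimes> \<epsilon> a"
  shows "linear_form \<epsilon>"
  using assms by (auto simp: linear_form_def)

lemma linear_formD:
  assumes "linear_form \<epsilon>"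
  shows "\<And>a. a \<in> carrier M \<Longrightarrow> \<epsilon> a \<in> carrier R"
    "\<And>a b. \<lbrakk>a \<in> carrier M; b \<in> carrier M\<rbrakk> \<Longrightarrow> \<epsilon> (a \<oplus>\<^bsub>M\<^esub> b) = \<epsilon> a \<oplus> \<epsilon> b"
    "\<And>r a. \<lbrakk>r \<in> carrier R; a \<in> carrier M\<rbrakk> \<Longrightarrow> \<epsilon> (r \<odot>\<^bsub>M\<^esub> a) = r \<otimes> \<epsilon> a"
  using assms by (auto simp: linear_form_def)

text \<open>Wherever \<open>T\<close> is invertible, dividing the forms by \<open>T\<close> gives a
  genuine dual basis. Local freeness can thus be expressed over \<open>R\<close> itself.\<close>

definition scaled_dual_basis :: "'a \<Rightarrow> 'c set \<Rightarrow> ('c \<Rightarrow> 'c \<Rightarrow> 'a) \<Rightarrow> bool" where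
  "scaled_dual_basis T C \<epsilon> \<longleftrightarrow> (\<forall>c\<in>C. linear_form (\<epsilon> c)) \<and>
     (\<forall>c\<in>C. \<forall>d\<in>C. \<epsilon> c d = (if c = d then T else \<zero>)) \<and>
     (\<forall>a\<in>carrier M. T \<odot>\<^bsub>M\<^esub> a = (\<Oplus>\<^bsub>M\<^esub>c\<in>C. \<epsilon> c a \<odot>\<^bsub>M\<^esub> c))"

lemma scaled_dual_basisD:
  assumes "scaled_dual_basis T C \<epsilon>"
  shows "\<And>c. c \<in> C \<Longrightarrow> linear_form (\<epsilon> c)"
    "\<And>c d. \<lbrakk>c \<in> C; d \<in> C\<rbrakk> \<Longrightarrow> \<epsilon> c d = (if c = d then T else \<zero>)"
    "\<And>a. a \<in> carrier M \<Longrightarrow> T \<odot>\<^bsub>M\<^esub> a = (\<Oplus>\<^bsub>M\<^esub>c\<in>C. \<epsilon> c a \<odot>\<^bsub>M\<^esub> c)"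
  using assms unfolding scaled_dual_basis_def by blast+

lemma linear_form_zero:
  assumes "linear_form \<epsilon>" shows "\<epsilon> \<zero>\<^bsub>M\<^esub> = \<zero>"
  using linear_formD(3)[OF assms, of \<zero> "\<zero>\<^bsub>M\<^esub>"] linear_formD(1)[OF assms] by simp

lemma linear_form_lincomb:
  assumes \<epsilon>: "linear_form \<epsilon>" and D: "finite D" "D \<subseteq> carrier M" "x \<in> D \<rightarrow> carrier R"
  shows "\<epsilon> (\<Oplus>\<^bsub>M\<^esub>d\<in>D. x d \<odot>\<^bsub>M\<^esub> d) = (\<Oplus>d\<in>D. x d \<otimes> \<epsilon> d)"
  using D
proof (induction D)
  case empty
  then show ?case using linear_form_zero[OF \<epsilon>] by simp
next
  case (insert d D)
  have c: "d \<in> carrier M" "x d \<in> carrier R" "\<And>e. e \<in> D \<Longrightarrow> e \<in> carrier M" "\<And>e. e \<in> D \<Longrightarrow> x e \<in> carrier R"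
    using insert.prems by auto
  have s: "(\<Oplus>\<^bsub>M\<^esub>d\<in>D. x d \<odot>\<^bsub>M\<^esub> d) \<in> carrier M" using c by (intro M.finsum_closed) auto
  have "(\<Oplus>\<^bsub>M\<^esub>d\<in>insert d D. x d \<odot>\<^bsub>M\<^esub> d) = x d \<odot>\<^bsub>M\<^esub> d \<oplus>\<^bsub>M\<^esub> (\<Oplus>\<^bsub>M\<^esub>d\<in>D. x d \<odot>\<^bsub>M\<^esub> d)"
    using insert.hyps c by (intro M.finsum_insert) auto
  moreover have "(\<Oplus>d\<in>insert d D. x d \<otimes> \<epsilon> d) = x d \<otimes> \<epsilon> d \<oplus> (\<Oplus>d\<in>D. x d \<otimes> \<epsilon> d)"
    using insert.hyps c linear_formD(1)[OF \<epsilon>] by (intro R.finsum_insert) auto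
  ultimately show ?case using insert s c linear_formD[OF \<epsilon>] by auto
qed

end

context azumaya
begin

lemma linear_form_scale:
  assumes "linear_form \<epsilon>" "s \<in> carrier R" shows "linear_form (\<lambda>a. s \<otimes>\<^bsub>R\<^esub> \<epsilon> a)"
  by (rule linear_formI)
    (use assms linear_formD[OF assms(1)] in \<open>auto simp: R.r_distr R.m_lcomm\<close>)

lemma linear_form_diff:
  assumes "linear_form \<epsilon>" "linear_form \<eta>" shows "linear_form (\<lambda>a. \<epsilon> a \<ominus>\<^bsub>R\<^esub> \<eta> a)"
proof (rule linear_formI)
  note e = linear_formD[OF assms(1)] and h = linear_formD[OF assms(2)]
  fix a assume a: "a \<in> carrier A"
  then have c: "\<epsilon> a \<in> carrier R" "\<eta> a \<in> carrier R" using e h by auto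
  then show "\<epsilon> a \<ominus>\<^bsub>R\<^esub> \<eta> a \<in> carrier R" by simp
  fix b assume b: "b \<in> carrier A"
  then have d: "\<epsilon> b \<in> carrier R" "\<eta> b \<in> carrier R" using e h by auto
  have "(\<epsilon> a \<oplus>\<^bsub>R\<^esub> \<epsilon> b) \<ominus>\<^bsub>R\<^esub> (\<eta> a \<oplus>\<^bsub>R\<^esub> \<eta> b)
     = (\<epsilon> a \<ominus>\<^bsub>R\<^esub> \<eta> a) \<oplus>\<^bsub>R\<^esub> (\<epsilon> b \<ominus>\<^bsub>R\<^esub> \<eta> b)"
    using c d by algebra
  then show "\<epsilon> (a \<oplus> b) \<ominus>\<^bsub>R\<^esub> \<eta> (a \<oplus> b)
     = (\<epsilon> a \<ominus>\<^bsub>R\<^esub> \<eta> a) \<oplus>\<^bsub>R\<^esub> (\<epsilon> b \<ominus>\<^bsub>R\<^esub> \<eta> b)"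
    using e(2) h(2) a b by simp
next
  note e = linear_formD[OF assms(1)] and h = linear_formD[OF assms(2)]
  fix a r assume a: "a \<in> carrier A" and r: "r \<in> carrier R"
  then have c: "\<epsilon> a \<in> carrier R" "\<eta> a \<in> carrier R" using e h by auto
  have "r \<otimes>\<^bsub>R\<^esub> \<epsilon> a \<ominus>\<^bsub>R\<^esub> r \<otimes>\<^bsub>R\<^esub> \<eta> a = r \<otimes>\<^bsub>R\<^esub> (\<epsilon> a \<ominus>\<^bsub>R\<^esub> \<eta> a)"
    using c r by algebra
  then show "\<epsilon> (r \<odot> a) \<ominus>\<^bsub>R\<^esub> \<eta> (r \<odot> a) = r \<otimes>\<^bsub>R\<^esub> (\<epsilon> a \<ominus>\<^bsub>R\<^esub> \<eta> a)"
    using e(3) h(3) a r by simp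
qed

lemma linear_form_sum:
  assumes "finite D" "\<And>d. d \<in> D \<Longrightarrow> linear_form (\<epsilon> d)" "\<And>d. d \<in> D \<Longrightarrow> s d \<in> carrier R"
  shows "linear_form (\<lambda>a. \<Oplus>\<^bsub>R\<^esub>d\<in>D. s d \<otimes>\<^bsub>R\<^esub> \<epsilon> d a)"
proof (rule linear_formI)
  note e = linear_formD[OF assms(2)]
  show "(\<Oplus>\<^bsub>R\<^esub>d\<in>D. s d \<otimes>\<^bsub>R\<^esub> \<epsilon> d a) \<in> carrier R" if "a \<in> carrier A" for a
    using that e(1) assms by (auto intro!: R.finsum_closed)
  show "(\<Oplus>\<^bsub>R\<^esub>d\<in>D. s d \<otimes>\<^bsub>R\<^esub> \<epsilon> d (a \<oplus> b))
    = (\<Oplus>\<^bsub>R\<^esub>d\<in>D. s d \<otimes>\<^bsub>R\<^esub> \<epsilon> d a) \<oplus>\<^bsub>R\<^esub> (\<Oplus>\<^bsub>R\<^esub>d\<in>D. s d \<otimes>\<^bsub>R\<^esub> \<epsilon> d b)"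
    if "a \<in> carrier A" "b \<in> carrier A" for a b
  proof -
    have "(\<Oplus>\<^bsub>R\<^esub>d\<in>D. s d \<otimes>\<^bsub>R\<^esub> \<epsilon> d (a \<oplus> b))
      = (\<Oplus>\<^bsub>R\<^esub>d\<in>D. s d \<otimes>\<^bsub>R\<^esub> \<epsilon> d a \<oplus>\<^bsub>R\<^esub> s d \<otimes>\<^bsub>R\<^esub> \<epsilon> d b)"
      using that e assms(3) by (intro R.finsum_cong') (auto simp: R.r_distr)
    also have "\<dots> = (\<Oplus>\<^bsub>R\<^esub>d\<in>D. s d \<otimes>\<^bsub>R\<^esub> \<epsilon> d a) \<oplus>\<^bsub>R\<^esub> (\<Oplus>\<^bsub>R\<^esub>d\<in>D. s d \<otimes>\<^bsub>R\<^esub> \<epsilon> d b)"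
      using that e assms(3) by (intro R.finsum_addf) auto
    finally show ?thesis .
  qed
  show "(\<Oplus>\<^bsub>R\<^esub>d\<in>D. s d \<otimes>\<^bsub>R\<^esub> \<epsilon> d (r \<odot> a)) = r \<otimes>\<^bsub>R\<^esub> (\<Oplus>\<^bsub>R\<^esub>d\<in>D. s d \<otimes>\<^bsub>R\<^esub> \<epsilon> d a)"
    if "a \<in> carrier A" "r \<in> carrier R" for a r
  proof -
    have "(\<Oplus>\<^bsub>R\<^esub>d\<in>D. s d \<otimes>\<^bsub>R\<^esub> \<epsilon> d (r \<odot> a)) = (\<Oplus>\<^bsub>R\<^esub>d\<in>D. r \<otimes>\<^bsub>R\<^esub> (s d \<otimes>\<^bsub>R\<^esub> \<epsilon> d a))"
      using that e assms(3) by (intro R.finsum_cong') (auto simp: R.m_lcomm)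
    also have "\<dots> = r \<otimes>\<^bsub>R\<^esub> (\<Oplus>\<^bsub>R\<^esub>d\<in>D. s d \<otimes>\<^bsub>R\<^esub> \<epsilon> d a)"
      using that e assms(1,3) by (intro R.finsum_rdistr[symmetric]) auto
    finally show ?thesis .
  qed
qed

definition scalars :: "'a set" where "scalars = {r \<odot> \<one> | r. r \<in> carrier R}"

lemma scalarsI [intro]: "r \<in> carrier R \<Longrightarrow> r \<odot> \<one> \<in> scalars"
  by (auto simp: scalars_def)

lemma scalars_submodule: "submodule scalars R A"
proof (rule submoduleI')
  show "\<zero> \<in> scalars" using scalarsI[of "\<zero>\<^bsub>R\<^esub>"] by simp
  fix a b assume "a \<in> scalars" "b \<in> scalars"
  then obtain r s where "r \<in> carrier R" "s \<in> carrier R" "a = r \<odot> \<one>" "b = s \<odot> \<one>"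
    by (auto simp: scalars_def)
  then show "a \<oplus> b \<in> scalars" using scalarsI[of "r \<oplus>\<^bsub>R\<^esub> s"] by (simp add: smult_l_distr)
next
  fix r a assume r: "r \<in> carrier R" and "a \<in> scalars"
  then obtain s where "s \<in> carrier R" "a = s \<odot> \<one>" by (auto simp: scalars_def)
  then show "r \<odot> a \<in> scalars" using r scalarsI[of "r \<otimes>\<^bsub>R\<^esub> s"] by (simp add: smult_assoc1)
qed (auto simp: scalars_def)

lemma mult_map_scalars:
  assumes "f \<in> mult_maps A" "r \<in> carrier R"
  shows "f (r \<odot> \<one>) = r \<odot> f \<one>"
  using mult_maps_smult assms by simp

end

section \<open>A local separability element\<close>

lemma (in ring) diff_add: "\<lbrakk>x \<in> carrier R; y \<in> carrier R\<rbrakk> \<Longrightarrow> (x \<ominus> y) \<oplus> y = x"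
  by algebra

context azumaya_at
begin

text \<open>If \<open>r\<close> were outside \<open>\<mm>\<close>, an inverse modulo
  \<open>\<mm>\<close> would put \<open>\<one>\<close> into \<open>mA\<close>, but the fibre is not
  zero.\<close>

lemma smult_one_mA:
  assumes r: "r \<in> carrier R" shows "r \<odot> \<one> \<in> mA \<longleftrightarrow> r \<in> \<mm>"
proof
  assume rA: "r \<odot> \<one> \<in> mA"
  show "r \<in> \<mm>"
  proof (rule ccontr)
    assume "r \<notin> \<mm>"
    then obtain s where s: "s \<in> carrier R" "s \<otimes>\<^bsub>R\<^esub> r \<ominus>\<^bsub>R\<^esub> \<one>\<^bsub>R\<^esub> \<in> \<mm>"
      using R.maximalideal_inverse[OF maximal r] by blast
    let ?\<mu> = "s \<otimes>\<^bsub>R\<^esub> r \<ominus>\<^bsub>R\<^esub> \<one>\<^bsub>R\<^esub>"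
    have "s \<odot> (r \<odot> \<one>) = (s \<otimes>\<^bsub>R\<^esub> r) \<odot> \<one>" using s r by (simp add: smult_assoc1)
    moreover have "s \<otimes>\<^bsub>R\<^esub> r = ?\<mu> \<oplus>\<^bsub>R\<^esub> \<one>\<^bsub>R\<^esub>" using s(1) r by algebra
    ultimately have e: "s \<odot> (r \<odot> \<one>) = ?\<mu> \<odot> \<one> \<oplus> \<one>"
      using s r by (metis A.one_closed R.minus_closed R.m_closed R.one_closed smult_l_distr smult_one)
    have c: "?\<mu> \<odot> \<one> \<in> carrier A" using s by auto
    have "\<one> = s \<odot> (r \<odot> \<one>) \<ominus> ?\<mu> \<odot> \<one>" unfolding e using c by algebra
    moreover have "s \<odot> (r \<odot> \<one>) \<ominus> ?\<mu> \<odot> \<one> \<in> mA"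
      using mA_facts(3,4,5) rA s smult_in_mA[OF s(2) A.one_closed] by (simp add: A.minus_eq)
    ultimately show False using one_notin_mA by simp
  qed
qed simp

text \<open>
  \<open>e\<close> plays the role of the separability idempotent. The maps \<open>w b c = b [c, -]\<close> generate
  the left ideal of the multiplication maps vanishing at \<open>\<one>\<close>. If \<open>g\<close> is a scalar projection
  modulo \<open>\<mm>\<close>, then \<open>f \<mapsto> f \<circ> g\<close> sends this left ideal into \<open>\<mm>\<close> times itself, so Nakayama's
  lemma over a commutative ring \<open>S\<close> of maps containing \<open>g\<close> yields \<open>e\<close> with \<open>w b c \<circ> e = 0\<close>.
  For \<open>S\<close> we take the bicommutant of \<open>g\<close> in the ring of multiplication maps that preserve \<open>R \<one>\<close>.
\<close>

lemma separability_map: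
  obtains e t where "e \<in> mult_maps A" "t \<in> carrier R" "t \<ominus>\<^bsub>R\<^esub> \<one>\<^bsub>R\<^esub> \<in> \<mm>" "e \<one> = t \<odot> \<one>"
    "\<And>a. a \<in> carrier A \<Longrightarrow> e a \<in> center A"
proof -
  obtain B where B: "finite B" "B \<subseteq> carrier A" "\<one> \<in> B" "lin_span A (carrier R) B {\<zero>} = carrier A"
    by (rule generators)
  obtain g where g: "g \<in> mult_maps A" "g \<one> = \<one>"
    "\<And>a. a \<in> carrier A \<Longrightarrow> \<exists>r\<in>carrier R. g a \<doteq> r \<odot> \<one>"
    using scalar_projection by blast
  define E where "E = mult_ring A"
  interpret E: ring E unfolding E_def by (rule A.mult_ring_ring)
  have Ec: "carrier E = mult_maps A" by (simp add: E_def mult_ring_def)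
  have Em: "f \<otimes>\<^bsub>E\<^esub> k = (\<lambda>a\<in>carrier A. f (k a))" for f k by (simp add: E_def mult_ring_def)
  have Ea: "f \<oplus>\<^bsub>E\<^esub> k = (\<lambda>a\<in>carrier A. f a \<oplus> k a)" for f k by (simp add: E_def mult_ring_def)
  have E1: "\<one>\<^bsub>E\<^esub> = (\<lambda>a\<in>carrier A. a)" and E0: "\<zero>\<^bsub>E\<^esub> = (\<lambda>a\<in>carrier A. \<zero>)"
    by (simp_all add: E_def mult_ring_def)
  have minus: "\<ominus>\<^bsub>E\<^esub> f = (\<lambda>a\<in>carrier A. \<ominus> f a)" if f: "f \<in> mult_maps A" for f
  proof -
    have m: "(\<lambda>a\<in>carrier A. \<ominus> f a) \<in> carrier E"
      using A.mult_maps_diff[OF A.mult_maps_zero_map f] f unfolding Ec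
      by (simp add: A.minus_eq cong: restrict_cong)
    have "(\<lambda>a\<in>carrier A. \<ominus> f a) \<oplus>\<^bsub>E\<^esub> f = \<zero>\<^bsub>E\<^esub>"
      using f by (auto simp: Ea E0 A.l_neg intro!: restrict_ext)
    then show ?thesis using E.minus_equality[OF _ _ m, of f] f Ec by simp
  qed
  \<comment> \<open>By linearity, preservation of \<open>R \<one>\<close> need only be tested at
    \<open>\<one>\<close>. On such maps evaluation at \<open>\<one>\<close> is multiplicative, which
    is what makes \<open>\<aa>\<close> below an ideal.\<close>
  define M1 where "M1 = {p \<in> mult_maps A. p \<one> \<in> scalars}"
  define S where "S = {p \<in> M1. \<forall>q\<in>M1. q \<otimes>\<^bsub>E\<^esub> g = g \<otimes>\<^bsub>E\<^esub> q \<longrightarrow> p \<otimes>\<^bsub>E\<^esub> q = q \<otimes>\<^bsub>E\<^esub> p}"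
  have sc: "scalars \<subseteq> carrier A" "\<And>a b. \<lbrakk>a \<in> scalars; b \<in> scalars\<rbrakk> \<Longrightarrow> a \<oplus> b \<in> scalars"
    "\<And>a. a \<in> scalars \<Longrightarrow> \<ominus> a \<in> scalars" "\<And>r a. \<lbrakk>r \<in> carrier R; a \<in> scalars\<rbrakk> \<Longrightarrow> r \<odot> a \<in> scalars"
    using submodule_facts[OF scalars_submodule] by auto
  have SM: "S \<subseteq> carrier E" by (auto simp: S_def M1_def Ec)
  have one_scalar: "\<one> \<in> scalars" using scalarsI[of "\<one>\<^bsub>R\<^esub>"] by simp
  have M1_mult: "p \<otimes>\<^bsub>E\<^esub> q \<in> M1" if p: "p \<in> M1" and q: "q \<in> M1" for p q
  proof -
    obtain r where r: "r \<in> carrier R" "q \<one> = r \<odot> \<one>" using q by (auto simp: M1_def scalars_def)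
    have "p (q \<one>) = r \<odot> p \<one>" using p r mult_map_scalars by (simp add: M1_def)
    then have "p (q \<one>) \<in> scalars" using p r sc(4) by (simp add: M1_def)
    then show ?thesis using p q A.mult_maps_comp by (simp add: M1_def Em)
  qed
  have "subcring S E"
  proof (rule E.subcringI[OF E.subringI])
    show "S \<subseteq> carrier E" by (fact SM)
    show "\<one>\<^bsub>E\<^esub> \<in> S" unfolding S_def
      using one_scalar A.mult_maps_id E.l_one E.r_one Ec by (auto simp: M1_def E1)
    fix p assume p: "p \<in> S"
    then have pE: "p \<in> carrier E" using SM by blast
    have pM: "p \<in> M1" "\<And>q. \<lbrakk>q \<in> M1; q \<otimes>\<^bsub>E\<^esub> g = g \<otimes>\<^bsub>E\<^esub> q\<rbrakk> \<Longrightarrow> p \<otimes>\<^bsub>E\<^esub> q = q \<otimes>\<^bsub>E\<^esub> p"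
      using p by (auto simp: S_def)
    have "\<ominus>\<^bsub>E\<^esub> p \<in> M1" using pM(1) minus[of p] E.a_inv_closed[OF pE] sc(3) Ec by (simp add: M1_def)
    then show "\<ominus>\<^bsub>E\<^esub> p \<in> S" using pM(2) pE Ec
      by (auto simp: S_def M1_def E.l_minus E.r_minus)
    fix q assume q: "q \<in> S"
    then have qE: "q \<in> carrier E" using SM by blast
    have qM: "q \<in> M1" "\<And>p. \<lbrakk>p \<in> M1; p \<otimes>\<^bsub>E\<^esub> g = g \<otimes>\<^bsub>E\<^esub> p\<rbrakk> \<Longrightarrow> q \<otimes>\<^bsub>E\<^esub> p = p \<otimes>\<^bsub>E\<^esub> q"
      using q by (auto simp: S_def)
    have "(p \<otimes>\<^bsub>E\<^esub> q) \<otimes>\<^bsub>E\<^esub> k = k \<otimes>\<^bsub>E\<^esub> (p \<otimes>\<^bsub>E\<^esub> q)"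
      if k: "k \<in> M1" "k \<otimes>\<^bsub>E\<^esub> g = g \<otimes>\<^bsub>E\<^esub> k" for k
    proof -
      have kE: "k \<in> carrier E" using k by (simp add: M1_def Ec)
      have "(p \<otimes>\<^bsub>E\<^esub> q) \<otimes>\<^bsub>E\<^esub> k = p \<otimes>\<^bsub>E\<^esub> (k \<otimes>\<^bsub>E\<^esub> q)"
        using pE qE kE qM(2)[OF k] by (simp add: E.m_assoc)
      also have "\<dots> = (k \<otimes>\<^bsub>E\<^esub> p) \<otimes>\<^bsub>E\<^esub> q"
        using pE qE kE by (simp flip: pM(2)[OF k] add: E.m_assoc)
      finally show ?thesis using pE qE kE by (simp add: E.m_assoc)
    qed
    then show "p \<otimes>\<^bsub>E\<^esub> q \<in> S" using M1_mult[OF pM(1) qM(1)] by (simp add: S_def)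
    have "p \<oplus>\<^bsub>E\<^esub> q \<in> M1" using pM(1) qM(1) mult_maps.sum[of p A q] sc(2) by (simp add: M1_def Ea)
    moreover have "(p \<oplus>\<^bsub>E\<^esub> q) \<otimes>\<^bsub>E\<^esub> k = k \<otimes>\<^bsub>E\<^esub> (p \<oplus>\<^bsub>E\<^esub> q)"
      if k: "k \<in> M1" "k \<otimes>\<^bsub>E\<^esub> g = g \<otimes>\<^bsub>E\<^esub> k" for k
    proof -
      have kE: "k \<in> carrier E" using k by (simp add: M1_def Ec)
      show ?thesis using pE qE kE pM(2)[OF k] qM(2)[OF k] by (simp add: E.l_distr E.r_distr)
    qed
    ultimately show "p \<oplus>\<^bsub>E\<^esub> q \<in> S" by (simp add: S_def)
    \<comment> \<open>\<open>g\<close> commutes with itself, so the elements of \<open>S\<close>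
      commute with \<open>g\<close>; hence they are among the maps against which elements of
      \<open>S\<close> are tested, and \<open>S\<close> is commutative.\<close>
    have "g \<in> M1" using g one_scalar by (simp add: M1_def)
    then have "q \<otimes>\<^bsub>E\<^esub> g = g \<otimes>\<^bsub>E\<^esub> q" using qM(2) by blast
    then show "p \<otimes>\<^bsub>E\<^esub> q = q \<otimes>\<^bsub>E\<^esub> p" using pM(2) qM(1) by blast
  qed
  note S = subcringE[OF this]
  let ?S = "E\<lparr>carrier := S\<rparr>"
  interpret V: module ?S E.right_module by (rule E.right_module[OF \<open>subcring S E\<close>])
  have Vc: "carrier E.right_module = mult_maps A" by (simp add: E.right_module_def Ec)
  have Vs: "p \<odot>\<^bsub>E.right_module\<^esub> u = (\<lambda>a\<in>carrier A. u (p a))" for p u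
    by (simp add: E.right_module_def Em)
  have Va: "u \<oplus>\<^bsub>E.right_module\<^esub> v = (\<lambda>a\<in>carrier A. u a \<oplus> v a)" for u v
    by (simp add: E.right_module_def Ea)
  have V0: "\<zero>\<^bsub>E.right_module\<^esub> = (\<lambda>a\<in>carrier A. \<zero>)" by (simp add: E.right_module_def E0)
  have gS: "g \<in> S" using g one_scalar by (auto simp: S_def M1_def)
  have scalS: "(\<lambda>a\<in>carrier A. r \<odot> a) \<in> S" if r: "r \<in> carrier R" for r
    using r mult_maps_scalar[OF r] scalarsI[OF r] mult_maps_smult
    by (auto simp: S_def M1_def Em intro!: restrict_ext)
  \<comment> \<open>The kernel of evaluation at \<open>\<one>\<close> followed by reduction modulo
    \<open>\<mm>\<close>. Besides the multiplications by elements of \<open>\<mm>\<close> it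
    contains the identity minus \<open>g\<close>; and a map congruent to the identity modulo
    \<open>\<aa>\<close> sends \<open>\<one>\<close> to \<open>t \<odot> \<one>\<close> with
    \<open>t\<close> congruent to 1 modulo \<open>\<mm>\<close>.\<close>
  define \<aa> where "\<aa> = {p \<in> S. \<exists>\<rho>\<in>\<mm>. p \<one> = \<rho> \<odot> \<one>}"
  have \<aa>_mult: "p \<otimes>\<^bsub>E\<^esub> q \<in> \<aa>" if p: "p \<in> S" and q: "q \<in> \<aa>" for p q
  proof -
    obtain \<rho> \<sigma> where \<rho>: "\<rho> \<in> \<mm>" "q \<one> = \<rho> \<odot> \<one>" "\<sigma> \<in> carrier R" "p \<one> = \<sigma> \<odot> \<one>"
      using p q by (auto simp: \<aa>_def S_def M1_def scalars_def)
    have "p (q \<one>) = (\<rho> \<otimes>\<^bsub>R\<^esub> \<sigma>) \<odot> \<one>"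
      using \<rho> p SM mult_map_scalars[of p \<rho>] by (auto simp: smult_assoc1 Ec)
    moreover have "\<rho> \<otimes>\<^bsub>R\<^esub> \<sigma> \<in> \<mm>" using \<rho> \<mm>.I_r_closed by blast
    ultimately show ?thesis using p q S(6) by (auto simp: \<aa>_def Em)
  qed
  have \<aa>: "ideal \<aa> ?S"
  proof (rule idealI[OF V.R.ring_axioms V.R.add.subgroupI])
    show "\<aa> \<subseteq> carrier ?S" by (auto simp: \<aa>_def)
    have "\<zero>\<^bsub>E\<^esub> \<one> = \<zero>\<^bsub>R\<^esub> \<odot> \<one>" by (simp add: E0)
    then have "\<zero>\<^bsub>E\<^esub> \<in> \<aa>" using S(2) \<mm>.zero_closed unfolding \<aa>_def by blast
    then show "\<aa> \<noteq> {}" by blast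
    fix p assume p: "p \<in> \<aa>"
    have pS: "p \<in> carrier ?S" using p by (simp add: \<aa>_def)
    have "(\<ominus>\<^bsub>?S\<^esub> \<one>\<^bsub>?S\<^esub>) \<otimes>\<^bsub>?S\<^esub> p = \<ominus>\<^bsub>?S\<^esub> p"
      using V.R.l_minus[OF V.R.one_closed pS] V.R.l_one[OF pS] by metis
    then have e: "\<ominus>\<^bsub>?S\<^esub> p = (\<ominus>\<^bsub>?S\<^esub> \<one>\<^bsub>?S\<^esub>) \<otimes>\<^bsub>E\<^esub> p" by simp
    have "\<ominus>\<^bsub>?S\<^esub> \<one>\<^bsub>?S\<^esub> \<in> carrier ?S" by blast
    then show "\<ominus>\<^bsub>?S\<^esub> p \<in> \<aa>" unfolding e using \<aa>_mult p by simp
    fix q assume q: "q \<in> \<aa>"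
    obtain \<rho> \<sigma> where \<rho>: "\<rho> \<in> \<mm>" "p \<one> = \<rho> \<odot> \<one>" "\<sigma> \<in> \<mm>" "q \<one> = \<sigma> \<odot> \<one>"
      using p q by (auto simp: \<aa>_def)
    have "(p \<oplus>\<^bsub>E\<^esub> q) \<one> = (\<rho> \<oplus>\<^bsub>R\<^esub> \<sigma>) \<odot> \<one>" using \<rho> by (simp add: Ea smult_l_distr)
    moreover have "\<rho> \<oplus>\<^bsub>R\<^esub> \<sigma> \<in> \<mm>" using \<rho> by simp
    ultimately show "p \<oplus>\<^bsub>?S\<^esub> q \<in> \<aa>" using p q S(7) by (auto simp: \<aa>_def)
  next
    fix p q assume pq: "p \<in> \<aa>" "q \<in> carrier ?S"
    then show "q \<otimes>\<^bsub>?S\<^esub> p \<in> \<aa>" using \<aa>_mult by simp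
    have "p \<otimes>\<^bsub>E\<^esub> q = q \<otimes>\<^bsub>E\<^esub> p" using pq S(8) by (auto simp: \<aa>_def)
    then show "p \<otimes>\<^bsub>?S\<^esub> q \<in> \<aa>" using \<aa>_mult pq by simp
  qed
  define w where "w b c = (\<lambda>a\<in>carrier A. b \<otimes> (\<lambda>a\<in>carrier A. c \<otimes> a \<ominus> a \<otimes> c) a)" for b c
  have w_mult: "w b c \<in> mult_maps A" if "b \<in> carrier A" "c \<in> carrier A" for b c
    unfolding w_def using that by (intro A.mult_maps_lmult A.mult_maps_commutator)
  have w_eq: "w b c a = b \<otimes> (c \<otimes> a \<ominus> a \<otimes> c)" if "a \<in> carrier A" for a b c
    using that by (simp add: w_def)
  define U where "U = (\<lambda>(b, c). w b c) ` (B \<times> B)"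
  have U: "finite U" "U \<subseteq> carrier E.right_module"
    using B(1,2) w_mult by (auto simp: U_def Vc subset_iff)
  define L where "L = lin_span E.right_module \<aa> U {\<zero>\<^bsub>E.right_module\<^esub>}"
  have "submodule L ?S E.right_module"
    unfolding L_def by (rule V.lin_span_submodule[OF \<aa> U(2) V.zero_submodule])
  note L = V.submodule_facts[OF this]
  have L_add: "(\<lambda>a\<in>carrier A. f a \<oplus> k a) \<in> L" if "f \<in> L" "k \<in> L" for f k
    using L(3)[OF that] by (simp add: Va)
  \<comment> \<open>Multiplying the values of a multiplication map by \<open>r\<close> is
    precomposition with multiplication by \<open>r\<close>, so it belongs to the action of
    \<open>S\<close>.\<close>
  have L_smult: "(\<lambda>a\<in>carrier A. f (r \<odot> a)) \<in> L" if r: "r \<in> carrier R" and f: "f \<in> L" for f r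
  proof -
    have "(\<lambda>a\<in>carrier A. r \<odot> a) \<odot>\<^bsub>E.right_module\<^esub> f \<in> L" using L(4) scalS[OF r] f by simp
    moreover have "(\<lambda>a\<in>carrier A. r \<odot> a) \<odot>\<^bsub>E.right_module\<^esub> f = (\<lambda>a\<in>carrier A. f (r \<odot> a))"
      unfolding Vs using r by (intro restrict_ext) simp
    ultimately show ?thesis by simp
  qed
  \<comment> \<open>\<open>U\<close> uses only generators in both arguments of \<open>w\<close>.
    Since \<open>w u v\<close> is additive and \<open>R\<close>-homogeneous in \<open>u\<close> and
    in \<open>v\<close>, the general case follows one argument at a time.\<close>
  have wL: "(\<lambda>a\<in>carrier A. \<mu> \<odot> w u v a) \<in> L"
    if \<mu>: "\<mu> \<in> \<mm>" and u: "u \<in> carrier A" and v: "v \<in> carrier A" for \<mu> u v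
  proof -
    let ?T = "\<lambda>u v. \<lambda>a\<in>carrier A. \<mu> \<odot> w u v a"
    have gen: "?T b c \<in> L" if bc: "b \<in> B" "c \<in> B" for b c
    proof -
      have "(\<lambda>a\<in>carrier A. \<mu> \<odot> a) \<in> \<aa>" using \<mu> scalS by (auto simp: \<aa>_def)
      moreover have "w b c \<in> U" using bc by (auto simp: U_def)
      ultimately have "(\<lambda>a\<in>carrier A. \<mu> \<odot> a) \<odot>\<^bsub>E.right_module\<^esub> w b c \<in> L"
        unfolding L_def using U(2) \<aa>_def by (intro V.lin_span_smult_mem) auto
      moreover have "(\<lambda>a\<in>carrier A. \<mu> \<odot> a) \<odot>\<^bsub>E.right_module\<^esub> w b c = ?T b c"
        unfolding Vs using bc B(2) \<mu> w_mult mult_maps_smult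
        by (intro restrict_ext) (simp add: subset_iff)
      ultimately show ?thesis by simp
    qed
    have left: "?T u c \<in> L" if c: "c \<in> carrier A" "\<And>b. b \<in> B \<Longrightarrow> ?T b c \<in> L" and u: "u \<in> carrier A" for u c
    proof -
      let ?K = "{u \<in> carrier A. ?T u c \<in> L}"
      have "submodule ?K R A"
      proof (rule submoduleI')
        show "?K \<subseteq> carrier A" by blast
        have "?T \<zero> c = (\<lambda>a\<in>carrier A. \<zero>)" using c \<mu> by (intro restrict_ext) (simp add: w_eq)
        then show "\<zero> \<in> ?K" using L(2) V0 by simp
        fix x y assume xy: "x \<in> ?K" "y \<in> ?K"
        have "?T (x \<oplus> y) c = (\<lambda>a\<in>carrier A. ?T x c a \<oplus> ?T y c a)"
          using c \<mu> xy by (intro restrict_ext) (simp add: w_eq A.l_distr smult_r_distr)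
        then show "x \<oplus> y \<in> ?K" using L_add xy by (simp del: restrict_apply)
      next
        fix r x assume r: "r \<in> carrier R" and x: "x \<in> ?K"
        have wr: "w x c (r \<odot> a) = r \<odot> w x c a" if "a \<in> carrier A" for a
          using mult_maps_smult[OF w_mult] x c r that by blast
        have "?T (r \<odot> x) c = (\<lambda>a\<in>carrier A. ?T x c (r \<odot> a))"
        proof (rule restrict_ext)
          fix a assume a: "a \<in> carrier A"
          have "\<mu> \<odot> w (r \<odot> x) c a = \<mu> \<odot> (r \<odot> w x c a)"
            using a c x r by (simp add: w_eq smult_mult_left)
          then show "\<mu> \<odot> w (r \<odot> x) c a = ?T x c (r \<odot> a)" using a r by (simp add: wr)
        qed
        then show "r \<odot> x \<in> ?K" using L_smult[OF r, of "?T x c"] x r by (simp del: restrict_apply)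
      qed
      then have "lin_span A (carrier R) B {\<zero>} \<subseteq> ?K"
        by (rule lin_span_minimal)
          (use c(2) B(2) submodule_facts[OF \<open>submodule ?K R A\<close>] in \<open>auto simp del: restrict_apply\<close>)
      then show ?thesis using B(4) u by blast
    qed
    have right: "?T b v \<in> L" if b: "b \<in> B" and v: "v \<in> carrier A" for b v
    proof -
      have bA: "b \<in> carrier A" using b B by auto
      let ?K = "{v \<in> carrier A. ?T b v \<in> L}"
      have "submodule ?K R A"
      proof (rule submoduleI')
        show "?K \<subseteq> carrier A" by blast
        have "?T b \<zero> = (\<lambda>a\<in>carrier A. \<zero>)" using bA \<mu>
          by (intro restrict_ext) (simp add: w_eq A.minus_eq)
        then show "\<zero> \<in> ?K" using L(2) V0 by simp
        fix x y assume xy: "x \<in> ?K" "y \<in> ?K"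
        have "?T b (x \<oplus> y) = (\<lambda>a\<in>carrier A. ?T b x a \<oplus> ?T b y a)"
        proof (rule restrict_ext)
          fix a assume a: "a \<in> carrier A"
          have c: "x \<in> carrier A" "y \<in> carrier A" using xy by auto
          have "b \<otimes> ((x \<oplus> y) \<otimes> a \<ominus> a \<otimes> (x \<oplus> y)) = b \<otimes> (x \<otimes> a \<ominus> a \<otimes> x) \<oplus> b \<otimes> (y \<otimes> a \<ominus> a \<otimes> y)"
            using bA a c by algebra
          then have "w b (x \<oplus> y) a = w b x a \<oplus> w b y a" using a by (simp add: w_eq)
          then show "\<mu> \<odot> w b (x \<oplus> y) a = ?T b x a \<oplus> ?T b y a"
            using a \<mu> w_mult[OF bA] c by (simp add: smult_r_distr)
        qed
        then show "x \<oplus> y \<in> ?K" using L_add xy by (simp del: restrict_apply)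
      next
        fix r x assume r: "r \<in> carrier R" and x: "x \<in> ?K"
        have wr: "w b x (r \<odot> a) = r \<odot> w b x a" if "a \<in> carrier A" for a
          using mult_maps_smult[OF w_mult] x bA r that by blast
        have "?T b (r \<odot> x) = (\<lambda>a\<in>carrier A. ?T b x (r \<odot> a))"
        proof (rule restrict_ext)
          fix a assume a: "a \<in> carrier A"
          have c: "x \<in> carrier A" using x by auto
          have "b \<otimes> (r \<odot> (x \<otimes> a) \<ominus> r \<odot> (a \<otimes> x)) = b \<otimes> (r \<odot> (x \<otimes> a \<ominus> a \<otimes> x))"
            using a c r by (simp add: A.minus_eq smult_r_distr smult_r_minus)
          then have "w b (r \<odot> x) a = r \<odot> w b x a"
            using a c r bA by (simp add: w_eq smult_mult_left smult_mult_right)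
          then show "\<mu> \<odot> w b (r \<odot> x) a = ?T b x (r \<odot> a)" using a r by (simp add: wr)
        qed
        then show "r \<odot> x \<in> ?K" using L_smult[OF r, of "?T b x"] x r by (simp del: restrict_apply)
      qed
      then have "lin_span A (carrier R) B {\<zero>} \<subseteq> ?K"
        by (rule lin_span_minimal)
          (use gen[OF b] B(2) submodule_facts[OF \<open>submodule ?K R A\<close>] in \<open>auto simp del: restrict_apply\<close>)
      then show ?thesis using B(4) v by blast
    qed
    show ?thesis using left[OF v right[OF _ v] u] by blast
  qed
  \<comment> \<open>For a single term, \<open>\<mu> (u a v)\<close> minus
    \<open>\<mu> (u v a)\<close> is \<open>- \<mu> (w u v a)\<close>. In particular a small map that
    vanishes at \<open>\<one>\<close> lies in \<open>L\<close>.\<close>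
  have small_L: "(\<lambda>a\<in>carrier A. n a \<ominus> n \<one> \<otimes> a) \<in> L" if "n \<in> small_maps" for n
    using that
  proof induction
    case (small_single \<mu> u v)
    have "(\<lambda>a\<in>carrier A. (\<lambda>a\<in>carrier A. \<mu> \<odot> (u \<otimes> a \<otimes> v)) a \<ominus> (\<lambda>a\<in>carrier A. \<mu> \<odot> (u \<otimes> a \<otimes> v)) \<one> \<otimes> a)
      = (\<lambda>a\<in>carrier A. (\<ominus>\<^bsub>R\<^esub> \<mu>) \<odot> w u v a)"
    proof (rule restrict_ext)
      fix a assume a: "a \<in> carrier A"
      have "u \<otimes> a \<otimes> v \<ominus> u \<otimes> v \<otimes> a = \<ominus> (u \<otimes> (v \<otimes> a \<ominus> a \<otimes> v))"
        using small_single(2,3) a by algebra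
      then have "\<mu> \<odot> (u \<otimes> a \<otimes> v \<ominus> u \<otimes> v \<otimes> a) = (\<ominus>\<^bsub>R\<^esub> \<mu>) \<odot> w u v a"
        using a small_single by (simp add: w_eq smult_l_minus smult_r_minus)
      moreover have "\<mu> \<odot> (u \<otimes> a \<otimes> v \<ominus> u \<otimes> v \<otimes> a) = \<mu> \<odot> (u \<otimes> a \<otimes> v) \<ominus> \<mu> \<odot> (u \<otimes> v) \<otimes> a"
        using a small_single
        by (simp add: A.minus_eq smult_r_distr smult_r_minus smult_mult_left)
      ultimately show "(\<lambda>a\<in>carrier A. \<mu> \<odot> (u \<otimes> a \<otimes> v)) a
          \<ominus> (\<lambda>a\<in>carrier A. \<mu> \<odot> (u \<otimes> a \<otimes> v)) \<one> \<otimes> a = (\<ominus>\<^bsub>R\<^esub> \<mu>) \<odot> w u v a"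
        using a small_single by simp
    qed
    then show ?case using wL[of "\<ominus>\<^bsub>R\<^esub> \<mu>" u v] small_single by (simp del: restrict_apply)
  next
    case (small_sum f k)
    have "(\<lambda>a\<in>carrier A. (\<lambda>a\<in>carrier A. f a \<oplus> k a) a \<ominus> (\<lambda>a\<in>carrier A. f a \<oplus> k a) \<one> \<otimes> a)
      = (\<lambda>a\<in>carrier A. (\<lambda>a\<in>carrier A. f a \<ominus> f \<one> \<otimes> a) a \<oplus> (\<lambda>a\<in>carrier A. k a \<ominus> k \<one> \<otimes> a) a)"
    proof (rule restrict_ext)
      fix a assume a: "a \<in> carrier A"
      have "f a \<in> carrier A" "k a \<in> carrier A" "f \<one> \<in> carrier A" "k \<one> \<in> carrier A"
        using small_sum a by auto
      then have "f a \<oplus> k a \<ominus> (f \<one> \<oplus> k \<one>) \<otimes> a = (f a \<ominus> f \<one> \<otimes> a) \<oplus> (k a \<ominus> k \<one> \<otimes> a)"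
        using a by algebra
      then show "(\<lambda>a\<in>carrier A. f a \<oplus> k a) a \<ominus> (\<lambda>a\<in>carrier A. f a \<oplus> k a) \<one> \<otimes> a =
         (\<lambda>a\<in>carrier A. f a \<ominus> f \<one> \<otimes> a) a \<oplus> (\<lambda>a\<in>carrier A. k a \<ominus> k \<one> \<otimes> a) a"
        using a by simp
    qed
    then show ?case using L_add small_sum by (simp del: restrict_apply)
  qed
  \<comment> \<open>The splitting is \<open>u = u \<circ> (id - g) + u \<circ> g\<close>. The
    identity minus \<open>g\<close> vanishes at \<open>\<one>\<close> and so lies in
    \<open>\<aa>\<close>; \<open>u \<circ> g\<close> has values in \<open>mA\<close>, because
    \<open>g\<close> is scalar modulo \<open>mA\<close> and \<open>u\<close> kills scalars, so it is
    small and lies in \<open>L\<close>.\<close>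
  have UL: "U \<subseteq> L"
  proof
    fix u assume u: "u \<in> U"
    then obtain b c where bc: "b \<in> carrier A" "c \<in> carrier A" "u = w b c" using B(2) by (auto simp: U_def)
    have uM: "u \<in> mult_maps A" using bc w_mult by simp
    let ?f = "\<lambda>a\<in>carrier A. (\<lambda>a\<in>carrier A. a) a \<ominus> g a"
    have fM: "?f \<in> mult_maps A" by (intro A.mult_maps_diff A.mult_maps_id g)
    have "?f = \<one>\<^bsub>E\<^esub> \<oplus>\<^bsub>E\<^esub> \<ominus>\<^bsub>E\<^esub> g"
      unfolding minus[OF g(1)] E1 Ea by (intro restrict_ext) (simp add: A.minus_eq)
    then have "?f \<in> S" using S(3,5,7) gS by simp
    moreover have "?f \<one> = \<zero>\<^bsub>R\<^esub> \<odot> \<one>" using g(2) by (simp add: A.minus_eq A.r_neg)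
    ultimately have f: "?f \<in> \<aa>" unfolding \<aa>_def using \<mm>.zero_closed by blast
    let ?n = "\<lambda>a\<in>carrier A. u (g a)"
    have "?n a \<in> mA" if a: "a \<in> carrier A" for a
    proof -
      obtain r where r: "r \<in> carrier R" "g a \<doteq> r \<odot> \<one>" using g(3) a by blast
      have "u (g a) \<doteq> u (r \<odot> \<one>)" using uM r eqm_mult_map by blast
      also have "u (r \<odot> \<one>) = \<zero>"
        using r bc mult_map_scalars[OF uM r(1)] by (simp add: w_eq A.minus_eq A.r_neg)
      finally have z: "u (g a) \<doteq> \<zero>" .
      show ?thesis using z eqm_zero_iff[OF eqm_carrier(1)[OF z]] a by simp
    qed
    then have "?n \<in> small_maps" using A.mult_maps_comp[OF uM g(1)] by (intro small_mapsI) auto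
    moreover have "?n \<one> = \<zero>" using bc g(2) by (simp add: w_eq A.minus_eq A.r_neg)
    ultimately have "(\<lambda>a\<in>carrier A. ?n a \<ominus> \<zero> \<otimes> a) \<in> L" using small_L[of ?n] by (simp del: restrict_apply)
    moreover have "(\<lambda>a\<in>carrier A. ?n a \<ominus> \<zero> \<otimes> a) = ?n"
      using uM g(1) by (intro restrict_ext) (simp add: A.minus_eq)
    ultimately have n: "?n \<in> L" by (simp del: restrict_apply)
    have "?f \<odot>\<^bsub>E.right_module\<^esub> u \<oplus>\<^bsub>E.right_module\<^esub> ?n \<in> L"
      unfolding L_def by (rule lin_span.step) (use f u n L_def in auto)
    moreover have "?f \<odot>\<^bsub>E.right_module\<^esub> u \<oplus>\<^bsub>E.right_module\<^esub> ?n = u"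
    proof (rule A.mult_maps_eqI[OF uM, symmetric])
      show "?f \<odot>\<^bsub>E.right_module\<^esub> u \<oplus>\<^bsub>E.right_module\<^esub> ?n \<in> extensional (carrier A)"
        unfolding Va by simp
      fix a assume a: "a \<in> carrier A"
      have c: "u a \<in> carrier A" "u (g a) \<in> carrier A" using a uM g by auto
      have "u (a \<ominus> g a) \<oplus> u (g a) = u a"
        using A.mult_maps_minus[OF uM a, of "g a"] a g c by (simp add: A.minus_eq A.a_assoc A.l_neg)
      then show "u a = (?f \<odot>\<^bsub>E.right_module\<^esub> u \<oplus>\<^bsub>E.right_module\<^esub> ?n) a"
        unfolding Va Vs using a by simp
    qed
    ultimately show "u \<in> L" by simp
  qed
  \<comment> \<open>With zero as target, Nakayama's lemma gives \<open>w b c \<circ> s = 0\<close>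
    for all generators \<open>b\<close>, \<open>c\<close>. Taking \<open>b = \<one>\<close> shows
    that the values of \<open>s\<close> commute with every generator.\<close>
  obtain s where s: "s \<in> carrier ?S" "s \<ominus>\<^bsub>?S\<^esub> \<one>\<^bsub>?S\<^esub> \<in> \<aa>"
    "\<And>u. u \<in> U \<Longrightarrow> s \<odot>\<^bsub>E.right_module\<^esub> u \<in> {\<zero>\<^bsub>E.right_module\<^esub>}"
    using V.nakayama[OF \<aa> V.zero_submodule U] UL unfolding L_def by blast
  have sM: "s \<in> mult_maps A" using s SM Ec by auto
  obtain \<rho> where \<rho>: "\<rho> \<in> \<mm>" "(s \<ominus>\<^bsub>?S\<^esub> \<one>\<^bsub>?S\<^esub>) \<one> = \<rho> \<odot> \<one>" using s(2) by (auto simp: \<aa>_def)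
  have "s = (s \<ominus>\<^bsub>?S\<^esub> \<one>\<^bsub>?S\<^esub>) \<oplus>\<^bsub>?S\<^esub> \<one>\<^bsub>?S\<^esub>"
    by (rule V.R.diff_add[OF s(1) V.R.one_closed, symmetric])
  then have "s = (s \<ominus>\<^bsub>?S\<^esub> \<one>\<^bsub>?S\<^esub>) \<oplus>\<^bsub>E\<^esub> \<one>\<^bsub>E\<^esub>" by simp
  then have "s \<one> = \<rho> \<odot> \<one> \<oplus> \<one>" using \<rho>(2) by (metis (no_types, lifting) A.one_closed E1 Ea restrict_apply')
  then have s1: "s \<one> = (\<rho> \<oplus>\<^bsub>R\<^esub> \<one>\<^bsub>R\<^esub>) \<odot> \<one>" using \<rho> by (simp add: smult_l_distr)
  show thesis
  proof (rule that[OF sM _ _ s1])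
    have \<rho>R: "\<rho> \<in> carrier R" using \<rho> by simp
    then show "\<rho> \<oplus>\<^bsub>R\<^esub> \<one>\<^bsub>R\<^esub> \<in> carrier R" by simp
    have "\<rho> \<oplus>\<^bsub>R\<^esub> \<one>\<^bsub>R\<^esub> \<ominus>\<^bsub>R\<^esub> \<one>\<^bsub>R\<^esub> = \<rho>" using \<rho>R by algebra
    then show "\<rho> \<oplus>\<^bsub>R\<^esub> \<one>\<^bsub>R\<^esub> \<ominus>\<^bsub>R\<^esub> \<one>\<^bsub>R\<^esub> \<in> \<mm>" using \<rho> by simp
    fix a assume a: "a \<in> carrier A"
    let ?c = "s a"
    have c: "?c \<in> carrier A" using a sM by simp
    have "submodule {b \<in> carrier A. ?c \<otimes> b = b \<otimes> ?c} R A"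
      using c by (intro submoduleI') (auto simp: A.l_distr A.r_distr smult_mult_left smult_mult_right)
    moreover have "?c \<otimes> b = b \<otimes> ?c" if b: "b \<in> B" for b
    proof -
      have bA: "b \<in> carrier A" using b B by auto
      have "w \<one> b \<in> U" using b B(3) by (auto simp: U_def)
      then have "(s \<odot>\<^bsub>E.right_module\<^esub> w \<one> b) a = \<zero>" using s(3) a by (auto simp: V0)
      then have "b \<otimes> ?c \<ominus> ?c \<otimes> b = \<zero>" using a bA c by (simp add: Vs w_eq)
      then show ?thesis using bA c by simp
    qed
    ultimately have "lin_span A (carrier R) B {\<zero>} \<subseteq> {b \<in> carrier A. ?c \<otimes> b = b \<otimes> ?c}"
      using B(2) c by (intro lin_span_minimal) (auto simp: smult_mult_left smult_mult_right)
    then show "?c \<in> center A" using c B(4) by (auto simp: center_def)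
  qed
qed

end

section \<open>The center and local dual bases\<close>

context azumaya_at
begin

lemma smult_span:
  assumes B: "B \<subseteq> carrier A" "lin_span A (carrier R) B {\<zero>} = carrier A"
    and K: "submodule K R A" and gen: "\<And>\<mu> b. \<lbrakk>\<mu> \<in> \<mm>; b \<in> B\<rbrakk> \<Longrightarrow> \<mu> \<odot> b \<in> K"
  shows "mA \<subseteq> K"
proof (rule mA_minimal[OF K])
  note K' = submodule_facts[OF K]
  fix \<mu> a assume \<mu>: "\<mu> \<in> \<mm>" and a: "a \<in> carrier A"
  have "submodule {a \<in> carrier A. \<mu> \<odot> a \<in> K} R A"
  proof (rule submoduleI')
    fix r x assume r: "r \<in> carrier R" and x: "x \<in> {a \<in> carrier A. \<mu> \<odot> a \<in> K}"
    have "\<mu> \<odot> (r \<odot> x) = r \<odot> (\<mu> \<odot> x)" using r x \<mu> by (simp add: R.m_comm flip: smult_assoc1)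
    then show "r \<odot> x \<in> {a \<in> carrier A. \<mu> \<odot> a \<in> K}" using r x K'(4) by simp
  qed (use \<mu> K' in \<open>auto simp: smult_r_distr\<close>)
  note sub = this submodule_facts(2,4)[OF this]
  have "lin_span A (carrier R) B {\<zero>} \<subseteq> {a \<in> carrier A. \<mu> \<odot> a \<in> K}"
    by (rule lin_span_minimal[OF sub(1)]) (use sub(2,3) gen[OF \<mu>] B(1) in auto)
  then show "\<mu> \<odot> a \<in> K" using B(2) a by blast
qed

text \<open>On the center \<open>e\<close> is multiplication by \<open>t\<close>, so it suffices to
  make the image of \<open>e\<close> scalar by one denominator. This is Nakayama's lemma for the
  elements \<open>e b\<close>, \<open>b\<close> a generator, modulo the scalars.\<close>

lemma center_locally_scalar:
  obtains s where "s \<in> carrier R" "s \<notin> \<mm>" "\<And>z. z \<in> center A \<Longrightarrow> s \<odot> z \<in> scalars"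
proof -
  obtain B where B: "finite B" "B \<subseteq> carrier A" "\<one> \<in> B" "lin_span A (carrier R) B {\<zero>} = carrier A"
    by (rule generators)
  obtain e t where e: "e \<in> mult_maps A" "t \<in> carrier R" "t \<ominus>\<^bsub>R\<^esub> \<one>\<^bsub>R\<^esub> \<in> \<mm>" "e \<one> = t \<odot> \<one>"
    "\<And>a. a \<in> carrier A \<Longrightarrow> e a \<in> center A"
    using separability_map by blast
  have ez: "e z = t \<odot> z" if z: "z \<in> center A" for z
  proof -
    have "z \<in> carrier A" using z by (simp add: center_def)
    then show ?thesis using A.mult_maps_center[OF e(1) z A.one_closed] e by (simp add: smult_mult_right)
  qed
  have eB: "e ` B \<subseteq> carrier A" using e(1) B(2) by auto
  define L where "L = lin_span A \<mm> (e ` B) scalars"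
  have Lsub: "submodule L R A" unfolding L_def
    by (rule lin_span_submodule[OF \<mm>.is_ideal eB scalars_submodule])
  note L = submodule_facts[OF Lsub]
  have scL: "scalars \<subseteq> L" by (auto simp: L_def intro: lin_span.base)
  have "submodule {a \<in> carrier A. e a \<in> L} R A"
    by (rule submoduleI') (use e(1) L in \<open>auto simp: A.mult_maps_add mult_maps_smult A.mult_maps_zero\<close>)
  then have mAL: "mA \<subseteq> {a \<in> carrier A. e a \<in> L}"
  proof (rule smult_span[OF B(2,4)])
    fix \<mu> b assume \<mu>: "\<mu> \<in> \<mm>" and b: "b \<in> B"
    have "\<mu> \<odot> e b \<in> L" unfolding L_def
      by (rule lin_span_smult_mem)
        (use \<mu> b eB submodule_facts(2)[OF scalars_submodule] in auto)
    then show "\<mu> \<odot> b \<in> {a \<in> carrier A. e a \<in> L}"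
      using \<mu> b B(2) e(1) mult_maps_smult by (auto simp: subset_iff)
  qed
  have "e ` B \<subseteq> L"
  proof
    fix c assume "c \<in> e ` B"
    then obtain b where b: "b \<in> B" "c = e b" by blast
    have c: "c \<in> center A" "c \<in> carrier A" using b e(5) B(2) eB by auto
    \<comment> \<open>The central element \<open>c\<close> is congruent to a scalar. Applying
      \<open>e\<close> to the difference shows \<open>t \<odot> c \<in> L\<close>, since
      \<open>e\<close> maps \<open>mA\<close> into \<open>L\<close> and acts on \<open>c\<close> as
      \<open>t\<close>; the error \<open>(t - 1) c\<close> is in \<open>L\<close> because
      \<open>t - 1\<close> is in \<open>\<mm>\<close>.\<close>
    have "c \<otimes> a \<ominus> a \<otimes> c \<in> mA" if "a \<in> carrier A" for a
      using c that mA_facts(2) by (auto simp: center_def A.minus_eq A.r_neg)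
    then obtain r where r: "r \<in> carrier R" "c \<ominus> r \<odot> \<one> \<in> mA" using fibre_central[OF c(2)] by blast
    have "e (c \<ominus> r \<odot> \<one>) \<in> L" using mAL r by blast
    moreover have "e (r \<odot> \<one>) \<in> L"
    proof -
      have "e (r \<odot> \<one>) = (r \<otimes>\<^bsub>R\<^esub> t) \<odot> \<one>" using mult_map_scalars[OF e(1) r(1)] e r by (simp add: smult_assoc1)
      moreover have "(r \<otimes>\<^bsub>R\<^esub> t) \<odot> \<one> \<in> scalars" using r(1) e(2) by (intro scalarsI R.m_closed)
      ultimately show ?thesis using scL by auto
    qed
    ultimately have "e (c \<ominus> r \<odot> \<one>) \<oplus> e (r \<odot> \<one>) \<in> L" using L(3) by blast
    moreover have "e (c \<ominus> r \<odot> \<one>) \<oplus> e (r \<odot> \<one>) = t \<odot> c"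
      using A.mult_maps_add[OF e(1), of "c \<ominus> r \<odot> \<one>" "r \<odot> \<one>"] A.diff_add[of c "r \<odot> \<one>"] ez[OF c(1)] r c
      by simp
    ultimately have tc: "t \<odot> c \<in> L" by simp
    have "(t \<ominus>\<^bsub>R\<^esub> \<one>\<^bsub>R\<^esub>) \<odot> c \<in> L" unfolding L_def
      by (rule lin_span_smult_mem)
        (use e(3) b eB submodule_facts(2)[OF scalars_submodule] in auto)
    then have "t \<odot> c \<oplus> \<ominus> ((t \<ominus>\<^bsub>R\<^esub> \<one>\<^bsub>R\<^esub>) \<odot> c) \<in> L" using tc L by blast
    moreover have "t \<odot> c \<oplus> \<ominus> ((t \<ominus>\<^bsub>R\<^esub> \<one>\<^bsub>R\<^esub>) \<odot> c) = c"
    proof -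
      have tc': "t \<odot> c \<in> carrier A" using e(2) c(2) by simp
      have "(t \<ominus>\<^bsub>R\<^esub> \<one>\<^bsub>R\<^esub>) \<odot> c = t \<odot> c \<ominus> c"
        using e(2) c(2) by (simp add: R.minus_eq A.minus_eq smult_l_distr smult_l_minus)
      then show ?thesis using tc' c(2) by algebra
    qed
    ultimately show "c \<in> L" by simp
  qed
  then obtain s where s: "s \<in> carrier R" "s \<ominus>\<^bsub>R\<^esub> \<one>\<^bsub>R\<^esub> \<in> \<mm>" "\<And>u. u \<in> e ` B \<Longrightarrow> s \<odot> u \<in> scalars"
    using nakayama[OF \<mm>.is_ideal scalars_submodule finite_imageI[OF B(1)] eB] unfolding L_def by blast
  note sc = submodule_facts[OF scalars_submodule]
  have sub: "submodule {a \<in> carrier A. s \<odot> e a \<in> scalars} R A"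
  proof (rule submoduleI')
    fix r x assume r: "r \<in> carrier R" and x: "x \<in> {a \<in> carrier A. s \<odot> e a \<in> scalars}"
    have "s \<odot> e (r \<odot> x) = r \<odot> (s \<odot> e x)"
      using r x s(1) e(1) by (simp add: mult_maps_smult R.m_comm flip: smult_assoc1)
    then show "r \<odot> x \<in> {a \<in> carrier A. s \<odot> e a \<in> scalars}" using r x sc(4) by simp
  qed (use s(1) e(1) sc in \<open>auto simp: A.mult_maps_add A.mult_maps_zero smult_r_distr\<close>)
  have "lin_span A (carrier R) B {\<zero>} \<subseteq> {a \<in> carrier A. s \<odot> e a \<in> scalars}"
    by (rule lin_span_minimal[OF sub])
      (use s(3) B(2) submodule_facts(2,4)[OF sub] in auto)
  then have se: "s \<odot> e a \<in> scalars" if "a \<in> carrier A" for a using B(4) that by blast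
  show thesis
  proof (rule that[of "s \<otimes>\<^bsub>R\<^esub> t"])
    show "s \<otimes>\<^bsub>R\<^esub> t \<in> carrier R" using s e by simp
    show "s \<otimes>\<^bsub>R\<^esub> t \<notin> \<mm>"
      using R.maximalideal_mult_notin[OF maximal s(1) e(2)]
        R.maximalideal_one_plus[OF maximal] s e by blast
    fix z assume z: "z \<in> center A"
    then have "z \<in> carrier A" by (simp add: center_def)
    then show "(s \<otimes>\<^bsub>R\<^esub> t) \<odot> z \<in> scalars" using se[of z] ez[OF z] s e by (simp add: smult_assoc1)
  qed
qed

end

section \<open>From local to global: the center\<close>

lemma (in azumaya) azumaya_at: "maximalideal \<mm> R \<Longrightarrow> azumaya_at A R \<mm>"
  by (intro azumaya_at.intro azumaya_at_axioms.intro azumaya_axioms)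

text \<open>The scalars that take \<open>a\<close> into \<open>N\<close> form an ideal contained in
  no maximal ideal.\<close>

lemma (in azumaya) locally_in_submodule:
  assumes N: "submodule N R A" and a: "a \<in> carrier A"
    and loc: "\<And>\<mm>. maximalideal \<mm> R \<Longrightarrow> \<exists>s\<in>carrier R. s \<notin> \<mm> \<and> s \<odot> a \<in> N"
  shows "a \<in> N"
proof -
  note N' = submodule_facts[OF N]
  define J where "J = {r \<in> carrier R. r \<odot> a \<in> N}"
  have J: "ideal J R"
  proof (rule idealI[OF R.ring_axioms R.add.subgroupI])
    have "\<zero>\<^bsub>R\<^esub> \<in> J" using a N' by (simp add: J_def)
    then show "J \<noteq> {}" by blast
  next
    fix r x assume r: "r \<in> J" and x: "x \<in> carrier R"
    then have "x \<odot> (r \<odot> a) \<in> N" using N'(4) by (simp add: J_def)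
    then have "x \<otimes>\<^bsub>R\<^esub> r \<in> J" using r x a by (simp add: J_def smult_assoc1)
    then show "x \<otimes>\<^bsub>R\<^esub> r \<in> J" "r \<otimes>\<^bsub>R\<^esub> x \<in> J" using r x by (simp_all add: J_def R.m_comm)
  qed (use a N' in \<open>auto simp: J_def smult_l_distr smult_l_minus\<close>)
  have "J = carrier R"
  proof (rule ccontr)
    assume "J \<noteq> carrier R"
    then obtain \<mm> where "maximalideal \<mm> R" "J \<subseteq> \<mm>" using R.exists_maximalideal[OF J] by blast
    then show False using loc by (auto simp: J_def)
  qed
  then have "\<one>\<^bsub>R\<^esub> \<in> J" by simp
  then show ?thesis using a by (simp add: J_def)
qed

text \<open>Being a scalar is membership in a submodule, hence a local question.\<close>

lemma (in azumaya) center_eq: "center A = scalars"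
proof
  show "scalars \<subseteq> center A" using smult_one_center by (auto simp: scalars_def)
  show "center A \<subseteq> scalars"
  proof
    fix z assume z: "z \<in> center A"
    then have "z \<in> carrier A" by (simp add: center_def)
    with scalars_submodule show "z \<in> scalars"
    proof (rule locally_in_submodule)
      fix \<mm> assume "maximalideal \<mm> R"
      then interpret at: azumaya_at A R \<mm> by (rule azumaya_at)
      show "\<exists>s\<in>carrier R. s \<notin> \<mm> \<and> s \<odot> z \<in> scalars"
        using at.center_locally_scalar z by metis
    qed
  qed
qed

section \<open>Linear forms extracted from dual systems\<close>

context azumaya_at
begin

text \<open>Following \<open>h c\<close> by the separability map makes its values central, hence
  scalars, and faithfulness makes these scalars unique. The diagonal values become congruent to
  \<open>t\<close>, which is outside \<open>\<mm>\<close>.\<close>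

lemma approximate_dual_forms:
  assumes C: "dual_system C h"
  obtains \<eta> where "\<And>c. c \<in> C \<Longrightarrow> linear_form (\<eta> c)" "\<And>c. c \<in> C \<Longrightarrow> \<eta> c c \<notin> \<mm>"
    "\<And>c d. \<lbrakk>c \<in> C; d \<in> C; c \<noteq> d\<rbrakk> \<Longrightarrow> \<eta> c d \<in> \<mm>"
proof -
  note C' = dual_systemD[OF C]
  obtain e t where e: "e \<in> mult_maps A" "t \<in> carrier R" "t \<ominus>\<^bsub>R\<^esub> \<one>\<^bsub>R\<^esub> \<in> \<mm>" "e \<one> = t \<odot> \<one>"
    "\<And>a. a \<in> carrier A \<Longrightarrow> e a \<in> center A"
    using separability_map by blast
  have tm: "t \<notin> \<mm>" using R.maximalideal_one_plus[OF maximal] e by blast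
  define \<eta> where "\<eta> c a = (SOME r. r \<in> carrier R \<and> r \<odot> \<one> = e (h c a))" for c a
  have \<eta>: "\<eta> c a \<in> carrier R \<and> \<eta> c a \<odot> \<one> = e (h c a)" if c: "c \<in> C" and a: "a \<in> carrier A" for c a
  proof -
    have "e (h c a) \<in> scalars" using e(5) C'(3)[OF c] a center_eq by auto
    then have "\<exists>r. r \<in> carrier R \<and> r \<odot> \<one> = e (h c a)" by (auto simp: scalars_def)
    then show ?thesis unfolding \<eta>_def by (rule someI_ex)
  qed
  show thesis
  proof (rule that[of \<eta>])
    fix c assume c: "c \<in> C"
    show "linear_form (\<eta> c)"
    proof (rule linear_formI)
      fix a assume a: "a \<in> carrier A"
      show "\<eta> c a \<in> carrier R" using \<eta> c a by blast
      fix b assume b: "b \<in> carrier A"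
      show "\<eta> c (a \<oplus> b) = \<eta> c a \<oplus>\<^bsub>R\<^esub> \<eta> c b"
        using \<eta>[OF c a] \<eta>[OF c b] \<eta>[OF c, of "a \<oplus> b"] a b c C'(3) e(1)
        by (intro smult_one_inj) (auto simp: smult_l_distr A.mult_maps_add)
    next
      fix r a assume r: "r \<in> carrier R" and a: "a \<in> carrier A"
      show "\<eta> c (r \<odot> a) = r \<otimes>\<^bsub>R\<^esub> \<eta> c a"
        using \<eta>[OF c a] \<eta>[OF c, of "r \<odot> a"] r a c C'(3) e(1)
        by (intro smult_one_inj) (auto simp: smult_assoc1 mult_maps_smult)
    qed
    have cA: "c \<in> carrier A" using c C' by auto
    have "e (h c c) \<doteq> e \<one>" using C'(4)[OF c] e(1) eqm_mult_map by blast
    then have "\<eta> c c \<odot> \<one> \<doteq> t \<odot> \<one>" using \<eta>[OF c cA] e(4) by simp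
    then have "\<eta> c c \<odot> \<one> \<in> mA \<longleftrightarrow> t \<odot> \<one> \<in> mA" by (rule eqm_mA)
    then show "\<eta> c c \<notin> \<mm>" using \<eta>[OF c cA] tm smult_one_mA[OF e(2)] smult_one_mA[of "\<eta> c c"] by simp
    fix d assume d: "d \<in> C" "c \<noteq> d"
    then have dA: "d \<in> carrier A" using C' by auto
    have "e (h c d) \<in> mA" using C'(5)[OF c d] e(1) A.mult_maps_ideal[OF mA_ideal] by blast
    then show "\<eta> c d \<in> \<mm>" using \<eta>[OF c dA] smult_one_mA by metis
  qed
qed

text \<open>Modulo \<open>\<mm>\<close> the matrix of the \<open>\<eta> c d\<close> is diagonal and
  invertible. Fraction-free Gauss-Jordan elimination makes it exactly \<open>T\<close> times the
  identity, where \<open>T\<close> collects the pivots.\<close>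

lemma diagonal_dual_forms:
  assumes C: "finite C" "C \<subseteq> carrier A"
    and \<eta>: "\<And>c. c \<in> C \<Longrightarrow> linear_form (\<eta> c)" "\<And>c. c \<in> C \<Longrightarrow> \<eta> c c \<notin> \<mm>"
      "\<And>c d. \<lbrakk>c \<in> C; d \<in> C; c \<noteq> d\<rbrakk> \<Longrightarrow> \<eta> c d \<in> \<mm>"
  obtains T \<epsilon> where "T \<in> carrier R" "T \<notin> \<mm>" "\<And>c. c \<in> C \<Longrightarrow> linear_form (\<epsilon> c)"
    "\<And>c d. \<lbrakk>c \<in> C; d \<in> C\<rbrakk> \<Longrightarrow> \<epsilon> c d = (if c = d then T else \<zero>\<^bsub>R\<^esub>)"
proof -
  have "\<exists>T\<in>carrier R. T \<notin> \<mm> \<and> (\<exists>\<epsilon>. \<forall>c\<in>D. linear_form (\<epsilon> c) \<and>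
      (\<forall>d\<in>D. \<epsilon> c d = (if c = d then T else \<zero>\<^bsub>R\<^esub>)))" if "finite D" "D \<subseteq> C" for D
    using that
  proof (induction D)
    case empty
    then show ?case using R.maximalideal_one_notin[OF maximal] by (intro bexI[of _ "\<one>\<^bsub>R\<^esub>"]) auto
  next
    case (insert c D)
    then obtain T where T: "T \<in> carrier R" "T \<notin> \<mm>" and "\<exists>\<epsilon>. \<forall>c\<in>D. linear_form (\<epsilon> c) \<and>
      (\<forall>d\<in>D. \<epsilon> c d = (if c = d then T else \<zero>\<^bsub>R\<^esub>))" by auto
    then obtain \<epsilon> where lf: "\<And>c. c \<in> D \<Longrightarrow> linear_form (\<epsilon> c)"
      and \<epsilon>: "\<And>c d. \<lbrakk>c \<in> D; d \<in> D\<rbrakk> \<Longrightarrow> \<epsilon> c d = (if c = d then T else \<zero>\<^bsub>R\<^esub>)" by blast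
    have c: "c \<in> C" "c \<in> carrier A" "c \<notin> D" using insert C by auto
    have D: "\<And>d. d \<in> D \<Longrightarrow> d \<in> C" "\<And>d. d \<in> D \<Longrightarrow> d \<in> carrier A" using insert C by auto
    note \<eta>c = linear_formD[OF \<eta>(1)[OF c(1)]]
    note \<epsilon>c = linear_formD[OF lf]
    \<comment> \<open>\<open>\<eta> c\<close> with its values on \<open>D\<close> removed; the
      factor \<open>T\<close> replaces a division by the diagonal value of the earlier
      forms.\<close>
    define \<eta>' where "\<eta>' a = T \<otimes>\<^bsub>R\<^esub> \<eta> c a \<ominus>\<^bsub>R\<^esub> (\<Oplus>\<^bsub>R\<^esub>d\<in>D. \<eta> c d \<otimes>\<^bsub>R\<^esub> \<epsilon> d a)" for a
    have lf': "linear_form \<eta>'" unfolding \<eta>'_def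
      by (intro linear_form_diff linear_form_scale linear_form_sum \<eta>(1) c T insert.hyps lf \<eta>c(1) D)
    note \<eta>'c = linear_formD[OF lf']
    define T' where "T' = \<eta>' c"
    have T'R: "T' \<in> carrier R" using \<eta>'c(1) c by (simp add: T'_def)
    have \<eta>'0: "\<eta>' d = \<zero>\<^bsub>R\<^esub>" if d: "d \<in> D" for d
    proof -
      have "(\<Oplus>\<^bsub>R\<^esub>d'\<in>D. \<eta> c d' \<otimes>\<^bsub>R\<^esub> \<epsilon> d' d)
        = (\<Oplus>\<^bsub>R\<^esub>d'\<in>D. if d = d' then \<eta> c d' \<otimes>\<^bsub>R\<^esub> T else \<zero>\<^bsub>R\<^esub>)"
        using d D T \<eta>c(1) \<epsilon> by (intro R.finsum_cong') auto
      also have "\<dots> = \<eta> c d \<otimes>\<^bsub>R\<^esub> T"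
        using d D T \<eta>c(1) insert.hyps by (intro R.finsum_singleton) auto
      finally show ?thesis using d D T \<eta>c(1) by (simp add: \<eta>'_def R.m_comm R.minus_eq R.r_neg)
    qed
    \<comment> \<open>At \<open>c\<close> the subtracted sum lies in \<open>\<mm>\<close>, its
      coefficients being off-diagonal, whereas \<open>T\<close> times \<open>\<eta> c c\<close> does
      not.\<close>
    have T'm: "T' \<notin> \<mm>"
    proof
      assume T'm: "T' \<in> \<mm>"
      have s: "(\<Oplus>\<^bsub>R\<^esub>d\<in>D. \<eta> c d \<otimes>\<^bsub>R\<^esub> \<epsilon> d c) \<in> \<mm>"
        using D c \<eta>(3)[OF c(1)] \<epsilon>c(1) by (intro R.ideal_finsum_closed \<mm>.is_ideal insert.hyps \<mm>.I_r_closed) auto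
      have "T \<otimes>\<^bsub>R\<^esub> \<eta> c c \<in> carrier R" using T c \<eta>c(1) by simp
      then have "T \<otimes>\<^bsub>R\<^esub> \<eta> c c = T' \<oplus>\<^bsub>R\<^esub> (\<Oplus>\<^bsub>R\<^esub>d\<in>D. \<eta> c d \<otimes>\<^bsub>R\<^esub> \<epsilon> d c)"
        using s R.diff_add[of "T \<otimes>\<^bsub>R\<^esub> \<eta> c c"] by (simp add: T'_def \<eta>'_def)
      then have "T \<otimes>\<^bsub>R\<^esub> \<eta> c c \<in> \<mm>" using T'm s by simp
      then show False
        using R.maximalideal_mult_notin[OF maximal T(1) _ T(2) \<eta>(2)[OF c(1)]] \<eta>c(1) c by blast
    qed
    \<comment> \<open>Cross multiplication by \<open>T\<close> and \<open>T'\<close> clears the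
      values at \<open>c\<close> and gives all forms the same diagonal value
      \<open>T T'\<close>.\<close>
    define \<epsilon>' where "\<epsilon>' d = (if d = c then \<lambda>a. T \<otimes>\<^bsub>R\<^esub> \<eta>' a
      else (\<lambda>a. T' \<otimes>\<^bsub>R\<^esub> \<epsilon> d a \<ominus>\<^bsub>R\<^esub> \<epsilon> d c \<otimes>\<^bsub>R\<^esub> \<eta>' a))" for d
    have "linear_form (\<epsilon>' d)" if "d \<in> insert c D" for d
      unfolding \<epsilon>'_def using that lf lf' T T'R \<epsilon>c(1) c
      by (auto intro!: linear_form_scale linear_form_diff)
    moreover have "\<epsilon>' d d' = (if d = d' then T \<otimes>\<^bsub>R\<^esub> T' else \<zero>\<^bsub>R\<^esub>)"
      if "d \<in> insert c D" "d' \<in> insert c D" for d d'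
    proof (cases "d = c")
      case True
      then show ?thesis using that \<eta>'0 T T'R c by (auto simp: \<epsilon>'_def T'_def)
    next
      case False
      then have d: "d \<in> D" using that by blast
      have dc: "\<epsilon> d c \<in> carrier R" using d c \<epsilon>c(1) by simp
      show ?thesis
      proof (cases "d' = c")
        case True
        have "\<epsilon>' d c = T' \<otimes>\<^bsub>R\<^esub> \<epsilon> d c \<ominus>\<^bsub>R\<^esub> \<epsilon> d c \<otimes>\<^bsub>R\<^esub> T'"
          using False by (simp add: \<epsilon>'_def T'_def)
        also have "\<dots> = \<zero>\<^bsub>R\<^esub>" using dc T'R by algebra
        finally show ?thesis using True False by simp
      next
        case d': False
        then have "d' \<in> D" using that by blast
        then show ?thesis using False d dc \<epsilon> \<eta>'0 T T'R
          by (simp add: \<epsilon>'_def R.m_comm R.minus_eq)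
      qed
    qed
    moreover have "T \<otimes>\<^bsub>R\<^esub> T' \<in> carrier R" "T \<otimes>\<^bsub>R\<^esub> T' \<notin> \<mm>"
      using R.maximalideal_mult_notin[OF maximal T(1) T'R T(2) T'm] T T'R by auto
    ultimately show ?case by blast
  qed
  from this[OF C(1) order_refl] show thesis using that by blast
qed

text \<open>\<open>C\<close> becomes a basis of \<open>A\<close> after inverting a single \<open>T\<close> outside \<open>\<mm>\<close>.\<close>

lemma dual_basis:
  assumes C: "dual_system C h" "mspan C = carrier A"
  obtains T \<epsilon> where "T \<in> carrier R" "T \<notin> \<mm>" "scaled_dual_basis T C \<epsilon>"
proof -
  note C' = dual_systemD[OF C(1)]
  obtain B where B: "finite B" "B \<subseteq> carrier A" "\<one> \<in> B" "lin_span A (carrier R) B {\<zero>} = carrier A"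
    by (rule generators)
  obtain \<eta> where \<eta>: "\<And>c. c \<in> C \<Longrightarrow> linear_form (\<eta> c)" "\<And>c. c \<in> C \<Longrightarrow> \<eta> c c \<notin> \<mm>"
    "\<And>c d. \<lbrakk>c \<in> C; d \<in> C; c \<noteq> d\<rbrakk> \<Longrightarrow> \<eta> c d \<in> \<mm>"
    using approximate_dual_forms[OF C(1)] by blast
  obtain T \<epsilon> where T: "T \<in> carrier R" "T \<notin> \<mm>" and lf: "\<And>c. c \<in> C \<Longrightarrow> linear_form (\<epsilon> c)"
    and \<epsilon>: "\<And>c d. \<lbrakk>c \<in> C; d \<in> C\<rbrakk> \<Longrightarrow> \<epsilon> c d = (if c = d then T else \<zero>\<^bsub>R\<^esub>)"
    using diagonal_dual_forms[OF C'(1,2) \<eta>] by blast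
  note \<epsilon>c = linear_formD[OF lf]
  \<comment> \<open>The exact span of \<open>C\<close>. From \<open>A = N + mA\<close> Nakayama's
    lemma yields \<open>s\<close> outside \<open>\<mm>\<close> with \<open>s A\<close> contained in
    \<open>N\<close>.\<close>
  define N where "N = lin_span A (carrier R) C {\<zero>}"
  have Nsub: "submodule N R A"
    unfolding N_def by (rule lin_span_submodule[OF R.oneideal C'(2) zero_submodule])
  note N = submodule_facts[OF Nsub]
  have Lsub: "submodule (lin_span A \<mm> B N) R A" by (rule lin_span_submodule[OF \<mm>.is_ideal B(2) Nsub])
  note L = submodule_facts[OF Lsub]
  have NL: "N \<subseteq> lin_span A \<mm> B N" by (auto intro: lin_span.base)
  have "mA \<subseteq> lin_span A \<mm> B N"
    by (rule smult_span[OF B(2,4) Lsub], rule lin_span_smult_mem) (use B(2) N(2) in auto)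
  moreover have "r \<odot> c \<in> lin_span A \<mm> B N" if "r \<in> carrier R" "c \<in> C" for r c
  proof -
    have "c \<in> N" using lin_span_superset[OF C'(2), of "{\<zero>}"] that by (auto simp: N_def)
    then show ?thesis using NL N(4) that by blast
  qed
  ultimately have "mspan C \<subseteq> lin_span A \<mm> B N"
    unfolding mspan_def by (intro lin_span_minimal[OF Lsub])
  then have "B \<subseteq> lin_span A \<mm> B N" using B(2) C(2) by blast
  then obtain s where s: "s \<in> carrier R" "s \<ominus>\<^bsub>R\<^esub> \<one>\<^bsub>R\<^esub> \<in> \<mm>" "\<And>b. b \<in> B \<Longrightarrow> s \<odot> b \<in> N"
    using nakayama[OF \<mm>.is_ideal Nsub B(1,2)] by blast
  have sm: "s \<notin> \<mm>" using R.maximalideal_one_plus[OF maximal] s by blast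
  have Ksub: "submodule {a \<in> carrier A. s \<odot> a \<in> N} R A"
  proof (rule submoduleI')
    fix r x assume r: "r \<in> carrier R" and x: "x \<in> {a \<in> carrier A. s \<odot> a \<in> N}"
    have "s \<odot> (r \<odot> x) = r \<odot> (s \<odot> x)" using r x s by (simp add: R.m_comm flip: smult_assoc1)
    then show "r \<odot> x \<in> {a \<in> carrier A. s \<odot> a \<in> N}" using r x N(4) by simp
  qed (use s N in \<open>auto simp: smult_r_distr\<close>)
  have "lin_span A (carrier R) B {\<zero>} \<subseteq> {a \<in> carrier A. s \<odot> a \<in> N}"
    by (rule lin_span_minimal[OF Ksub]) (use s(3) B(2) submodule_facts(2,4)[OF Ksub] in auto)
  then have sN: "s \<odot> a \<in> N" if "a \<in> carrier A" for a using B(4) that by blast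
  have [simp]: "c \<in> carrier A" if "c \<in> C" for c using that C' by auto
  \<comment> \<open>The expansion formula is linear in \<open>a\<close> and holds on
    \<open>C\<close>, hence on \<open>N\<close>. For general \<open>a\<close> it is applied to
    \<open>s \<odot> a\<close>, which costs the extra factor \<open>s\<close> in the
    denominator.\<close>
  let ?H = "{a \<in> carrier A. T \<odot> a = (\<Oplus>c\<in>C. \<epsilon> c a \<odot> c)}"
  have Hsub: "submodule ?H R A"
  proof (rule submoduleI')
    have "\<epsilon> c \<zero> = \<zero>\<^bsub>R\<^esub>" if "c \<in> C" for c
      using \<epsilon>c(3)[OF that, of "\<zero>\<^bsub>R\<^esub>" \<zero>] \<epsilon>c(1)[OF that] by simp
    then have "(\<Oplus>c\<in>C. \<epsilon> c \<zero> \<odot> c) = \<zero>" by (intro A.add.finprod_one_eqI) auto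
    then show "\<zero> \<in> ?H" using T by simp
    fix a b assume ab: "a \<in> ?H" "b \<in> ?H"
    have "(\<Oplus>c\<in>C. \<epsilon> c (a \<oplus> b) \<odot> c) = (\<Oplus>c\<in>C. \<epsilon> c a \<odot> c \<oplus> \<epsilon> c b \<odot> c)"
      using ab \<epsilon>c by (intro A.finsum_cong') (auto simp: smult_l_distr)
    also have "\<dots> = (\<Oplus>c\<in>C. \<epsilon> c a \<odot> c) \<oplus> (\<Oplus>c\<in>C. \<epsilon> c b \<odot> c)"
      using ab \<epsilon>c by (intro A.finsum_addf) auto
    finally show "a \<oplus> b \<in> ?H" using ab T by (simp add: smult_r_distr)
  next
    fix r a assume r: "r \<in> carrier R" and a: "a \<in> ?H"
    then have aA: "a \<in> carrier A" by simp
    have "(\<Oplus>c\<in>C. \<epsilon> c (r \<odot> a) \<odot> c) = (\<Oplus>c\<in>C. r \<odot> (\<epsilon> c a \<odot> c))"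
      using r a \<epsilon>c by (intro A.finsum_cong') (auto simp: smult_assoc1)
    also have "\<dots> = r \<odot> (\<Oplus>c\<in>C. \<epsilon> c a \<odot> c)"
      using r a \<epsilon>c C'(1) by (intro finsum_smult_ldistr[symmetric]) auto
    also have "\<dots> = r \<odot> (T \<odot> a)" using a by simp
    also have "\<dots> = T \<odot> (r \<odot> a)" using r aA T(1) R.m_comm[of r T] by (simp flip: smult_assoc1)
    finally show "r \<odot> a \<in> ?H" using r a by simp
  qed auto
  have "d \<in> ?H" if d: "d \<in> C" for d
  proof -
    have "(\<Oplus>c\<in>C. \<epsilon> c d \<odot> c) = (\<Oplus>c\<in>C. if d = c then T \<odot> c else \<zero>)"
      using d \<epsilon> T by (intro A.finsum_cong') auto
    also have "\<dots> = T \<odot> d" using d T C'(1) by (intro A.finsum_singleton) auto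
    finally show ?thesis using d by simp
  qed
  then have "N \<subseteq> ?H" unfolding N_def
    by (intro lin_span_minimal[OF Hsub]) (use submodule_facts(2,4)[OF Hsub] in auto)
  have "scaled_dual_basis (s \<otimes>\<^bsub>R\<^esub> T) C (\<lambda>c a. s \<otimes>\<^bsub>R\<^esub> \<epsilon> c a)"
    unfolding scaled_dual_basis_def
  proof (intro conjI ballI)
    show "linear_form (\<lambda>a. s \<otimes>\<^bsub>R\<^esub> \<epsilon> c a)" if "c \<in> C" for c
      by (rule linear_form_scale[OF lf[OF that] s(1)])
    show "s \<otimes>\<^bsub>R\<^esub> \<epsilon> c d = (if c = d then s \<otimes>\<^bsub>R\<^esub> T else \<zero>\<^bsub>R\<^esub>)" if "c \<in> C" "d \<in> C" for c d
      using \<epsilon>[OF that] s by simp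
    fix a assume a: "a \<in> carrier A"
    have "s \<odot> a \<in> ?H" using sN[OF a] \<open>N \<subseteq> ?H\<close> by blast
    then have "T \<odot> (s \<odot> a) = (\<Oplus>c\<in>C. \<epsilon> c (s \<odot> a) \<odot> c)" by simp
    also have "\<dots> = (\<Oplus>c\<in>C. (s \<otimes>\<^bsub>R\<^esub> \<epsilon> c a) \<odot> c)"
      using a s \<epsilon>c by (intro A.finsum_cong') auto
    finally show "(s \<otimes>\<^bsub>R\<^esub> T) \<odot> a = (\<Oplus>c\<in>C. (s \<otimes>\<^bsub>R\<^esub> \<epsilon> c a) \<odot> c)"
      using a s T by (simp add: R.m_comm flip: smult_assoc1)
  qed
  moreover have "s \<otimes>\<^bsub>R\<^esub> T \<in> carrier R" "s \<otimes>\<^bsub>R\<^esub> T \<notin> \<mm>"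
    using R.maximalideal_mult_notin[OF maximal s(1) T(1) sm T(2)] s T by auto
  ultimately show thesis using that by blast
qed

end

section \<open>Free rank and localization\<close>

context module
begin

text \<open>\<open>finite_basis\<close> in terms of coordinate forms: unlike unique coefficient
  families, linear forms can be evaluated on another basis, which yields the matrices that compare
  two bases.\<close>

definition coordinates :: "'c set \<Rightarrow> ('c \<Rightarrow> 'c \<Rightarrow> 'a) \<Rightarrow> bool" where
  "coordinates B f \<longleftrightarrow> finite B \<and> B \<subseteq> carrier M \<and> (\<forall>b\<in>B. linear_form (f b)) \<and>
     (\<forall>b\<in>B. \<forall>b'\<in>B. f b b' = (if b = b' then \<one> else \<zero>)) \<and>
     (\<forall>x\<in>carrier M. x = (\<Oplus>\<^bsub>M\<^esub>b\<in>B. f b x \<odot>\<^bsub>M\<^esub> b))"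

lemma coordinates_finite_basis:
  assumes "coordinates B f"
  shows "finite_basis R M B"
proof -
  have B: "finite B" "B \<subseteq> carrier M" and lf: "\<And>b. b \<in> B \<Longrightarrow> linear_form (f b)"
    and \<delta>: "\<And>b b'. \<lbrakk>b \<in> B; b' \<in> B\<rbrakk> \<Longrightarrow> f b b' = (if b = b' then \<one> else \<zero>)"
    and ex: "\<And>x. x \<in> carrier M \<Longrightarrow> x = (\<Oplus>\<^bsub>M\<^esub>b\<in>B. f b x \<odot>\<^bsub>M\<^esub> b)"
    using assms unfolding coordinates_def by blast+
  note f = linear_formD[OF lf]
  have [simp]: "b \<in> carrier M" if "b \<in> B" for b using that B by auto
  have "\<exists>!c. c \<in> B \<rightarrow>\<^sub>E carrier R \<and> x = (\<Oplus>\<^bsub>M\<^esub>b\<in>B. c b \<odot>\<^bsub>M\<^esub> b)" if x: "x \<in> carrier M" for x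
  proof (rule ex1I[of _ "\<lambda>b\<in>B. f b x"], intro conjI)
    show "(\<lambda>b\<in>B. f b x) \<in> B \<rightarrow>\<^sub>E carrier R" using f(1) x by auto
    have "(\<Oplus>\<^bsub>M\<^esub>b\<in>B. (\<lambda>b\<in>B. f b x) b \<odot>\<^bsub>M\<^esub> b) = (\<Oplus>\<^bsub>M\<^esub>b\<in>B. f b x \<odot>\<^bsub>M\<^esub> b)"
      using f(1) x by (intro M.finsum_cong') auto
    then show "x = (\<Oplus>\<^bsub>M\<^esub>b\<in>B. (\<lambda>b\<in>B. f b x) b \<odot>\<^bsub>M\<^esub> b)" using ex[OF x] by simp
    fix c assume c: "c \<in> B \<rightarrow>\<^sub>E carrier R \<and> x = (\<Oplus>\<^bsub>M\<^esub>b\<in>B. c b \<odot>\<^bsub>M\<^esub> b)"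
    then have cB: "c \<in> B \<rightarrow> carrier R" by auto
    then have cR: "c b \<in> carrier R" if "b \<in> B" for b using that by blast
    have "c b = f b x" if b: "b \<in> B" for b
    proof -
      have "f b x = (\<Oplus>b'\<in>B. c b' \<otimes> f b b')"
        using linear_form_lincomb[OF lf[OF b] B cB] c by simp
      also have "\<dots> = (\<Oplus>b'\<in>B. if b = b' then c b' else \<zero>)"
        using b cR \<delta> by (intro R.finsum_cong') auto
      also have "\<dots> = c b" using cR b B by (intro R.finsum_singleton) auto
      finally show ?thesis by simp
    qed
    then show "c = (\<lambda>b\<in>B. f b x)" using c by (intro extensionalityI[of _ B]) (auto simp: PiE_def)
  qed
  then show ?thesis using B by (simp add: finite_basis_def)
qed

text \<open>Uniqueness of the coefficients forces them to depend linearly on the vector.\<close>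

lemma finite_basis_coordinates:
  assumes "finite_basis R M B"
  obtains f where "coordinates B f"
proof -
  have B: "finite B" "B \<subseteq> carrier M"
    and ex1: "\<And>x. x \<in> carrier M \<Longrightarrow> \<exists>!c. c \<in> B \<rightarrow>\<^sub>E carrier R \<and> x = (\<Oplus>\<^bsub>M\<^esub>b\<in>B. c b \<odot>\<^bsub>M\<^esub> b)"
    using assms unfolding finite_basis_def by auto
  have [simp]: "b \<in> carrier M" if "b \<in> B" for b using that B by auto
  define co where "co x = (THE c. c \<in> B \<rightarrow>\<^sub>E carrier R \<and> x = (\<Oplus>\<^bsub>M\<^esub>b\<in>B. c b \<odot>\<^bsub>M\<^esub> b))" for x
  have co: "co x \<in> B \<rightarrow>\<^sub>E carrier R \<and> x = (\<Oplus>\<^bsub>M\<^esub>b\<in>B. co x b \<odot>\<^bsub>M\<^esub> b)" if "x \<in> carrier M" for x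
    unfolding co_def by (rule theI'[OF ex1[OF that]])
  have coR [simp]: "co x b \<in> carrier R" if "x \<in> carrier M" "b \<in> B" for x b
    using co[OF that(1)] that(2) by auto
  have unique: "co x b = c b"
    if "x \<in> carrier M" "\<And>b. b \<in> B \<Longrightarrow> c b \<in> carrier R" "x = (\<Oplus>\<^bsub>M\<^esub>b\<in>B. c b \<odot>\<^bsub>M\<^esub> b)" "b \<in> B" for x c b
  proof -
    have "(\<Oplus>\<^bsub>M\<^esub>b\<in>B. (\<lambda>b\<in>B. c b) b \<odot>\<^bsub>M\<^esub> b) = (\<Oplus>\<^bsub>M\<^esub>b\<in>B. c b \<odot>\<^bsub>M\<^esub> b)"
      using that(2) by (intro M.finsum_cong') auto
    then have "(\<lambda>b\<in>B. c b) \<in> B \<rightarrow>\<^sub>E carrier R \<and> x = (\<Oplus>\<^bsub>M\<^esub>b\<in>B. (\<lambda>b\<in>B. c b) b \<odot>\<^bsub>M\<^esub> b)"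
      using that(2,3) by auto
    then have "co x = (\<lambda>b\<in>B. c b)" using ex1[OF that(1)] co[OF that(1)] by blast
    then show ?thesis using that(4) by simp
  qed
  have "coordinates B (\<lambda>b x. co x b)"
    unfolding coordinates_def
  proof (intro conjI ballI)
    show "finite B" "B \<subseteq> carrier M" by (fact B)+
    fix b assume b: "b \<in> B"
    show "linear_form (\<lambda>x. co x b)"
    proof (rule linear_formI)
      fix x y assume xy: "x \<in> carrier M" "y \<in> carrier M"
      have "(\<Oplus>\<^bsub>M\<^esub>b\<in>B. (co x b \<oplus> co y b) \<odot>\<^bsub>M\<^esub> b)
        = (\<Oplus>\<^bsub>M\<^esub>b\<in>B. co x b \<odot>\<^bsub>M\<^esub> b \<oplus>\<^bsub>M\<^esub> co y b \<odot>\<^bsub>M\<^esub> b)"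
        using xy by (intro M.finsum_cong') (auto simp: smult_l_distr)
      also have "\<dots> = (\<Oplus>\<^bsub>M\<^esub>b\<in>B. co x b \<odot>\<^bsub>M\<^esub> b) \<oplus>\<^bsub>M\<^esub> (\<Oplus>\<^bsub>M\<^esub>b\<in>B. co y b \<odot>\<^bsub>M\<^esub> b)"
        using xy by (intro M.finsum_addf) auto
      also have "\<dots> = x \<oplus>\<^bsub>M\<^esub> y" using co[OF xy(1)] co[OF xy(2)] by simp
      finally show "co (x \<oplus>\<^bsub>M\<^esub> y) b = co x b \<oplus> co y b" using xy b by (intro unique) auto
    next
      fix r x assume r: "r \<in> carrier R" and x: "x \<in> carrier M"
      have "(\<Oplus>\<^bsub>M\<^esub>b\<in>B. (r \<otimes> co x b) \<odot>\<^bsub>M\<^esub> b) = (\<Oplus>\<^bsub>M\<^esub>b\<in>B. r \<odot>\<^bsub>M\<^esub> (co x b \<odot>\<^bsub>M\<^esub> b))"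
        using r x by (intro M.finsum_cong') (auto simp: smult_assoc1)
      also have "\<dots> = r \<odot>\<^bsub>M\<^esub> (\<Oplus>\<^bsub>M\<^esub>b\<in>B. co x b \<odot>\<^bsub>M\<^esub> b)"
        using r x B by (intro finsum_smult_ldistr[symmetric]) auto
      also have "\<dots> = r \<odot>\<^bsub>M\<^esub> x" using co[OF x] by simp
      finally show "co (r \<odot>\<^bsub>M\<^esub> x) b = r \<otimes> co x b" using r x b by (intro unique) auto
    qed (use b in simp)
    fix b' assume b': "b' \<in> B"
    have "(\<Oplus>\<^bsub>M\<^esub>c\<in>B. (if c = b' then \<one> else \<zero>) \<odot>\<^bsub>M\<^esub> c) = (\<Oplus>\<^bsub>M\<^esub>c\<in>B. if b' = c then c else \<zero>\<^bsub>M\<^esub>)"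
      by (intro M.finsum_cong') auto
    also have "\<dots> = b'" using b' B by (intro M.finsum_singleton) auto
    finally show "co b' b = (if b = b' then \<one> else \<zero>)" using b b' by (intro unique) auto
  next
    fix x assume "x \<in> carrier M"
    then show "x = (\<Oplus>\<^bsub>M\<^esub>b\<in>B. co x b \<odot>\<^bsub>M\<^esub> b)" using co by blast
  qed
  then show thesis by (rule that)
qed

end

section \<open>Invariance of the size of a finite basis\<close>

context cring
begin

text \<open>Gaussian elimination in the residue field \<open>R / J\<close>.\<close>

lemma underdetermined_system:
  assumes J: "maximalideal J R" and "finite I" "finite K" "card I < card K"
    and "\<And>i k. \<lbrakk>i \<in> I; k \<in> K\<rbrakk> \<Longrightarrow> Y i k \<in> carrier R"
  shows "\<exists>x. (\<forall>k\<in>K. x k \<in> carrier R) \<and> (\<exists>k\<in>K. x k \<notin> J) \<and> (\<forall>i\<in>I. (\<Oplus>k\<in>K. Y i k \<otimes> x k) \<in> J)"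
  using assms(2-)
proof (induction I arbitrary: K Y)
  case empty
  then have "K \<noteq> {}" by auto
  then show ?case using maximalideal_one_notin[OF J] by (intro exI[of _ "\<lambda>_. \<one>"]) auto
next
  case (insert i I)
  interpret J: maximalideal J R by fact
  have [simp]: "j \<in> J \<Longrightarrow> j \<in> carrier R" for j by (rule J.Icarr)
  show ?case
  proof (cases "\<forall>k\<in>K. Y i k \<in> J")
    \<comment> \<open>Row \<open>i\<close> vanishes modulo \<open>J\<close> and imposes no
      condition.\<close>
    case True
    have "\<exists>x. (\<forall>k\<in>K. x k \<in> carrier R) \<and> (\<exists>k\<in>K. x k \<notin> J) \<and> (\<forall>i\<in>I. (\<Oplus>k\<in>K. Y i k \<otimes> x k) \<in> J)"
      using insert.prems insert.hyps by (intro insert.IH) auto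
    then obtain x where x: "\<forall>k\<in>K. x k \<in> carrier R" "\<exists>k\<in>K. x k \<notin> J"
      "\<forall>i\<in>I. (\<Oplus>k\<in>K. Y i k \<otimes> x k) \<in> J" by blast
    have "(\<Oplus>k\<in>K. Y i k \<otimes> x k) \<in> J"
      using True x(1) insert.prems(1) J.is_ideal by (intro ideal_finsum_closed J.I_r_closed) auto
    then show ?thesis using x by blast
  next
    case False
    then obtain l where l: "l \<in> K" "Y i l \<notin> J" by blast
    have YR [simp]: "Y j k \<in> carrier R" if "j \<in> insert i I" "k \<in> K" for j k
      using insert.prems that by blast
    obtain s where s: "s \<in> carrier R" "s \<otimes> Y i l \<ominus> \<one> \<in> J"
      using maximalideal_inverse[OF J _ l(2)] l(1) by auto
    define K' where "K' = K - {l}"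
    have K': "finite K'" "l \<notin> K'" "K = insert l K'" "card K = Suc (card K')"
      using insert.prems l by (auto simp: K'_def card_Suc_Diff1)
    have YK [simp]: "Y j k \<in> carrier R" if "j \<in> insert i I" "k \<in> K'" for j k
      using YR that K'(3) by blast
    have "\<exists>x. (\<forall>k\<in>K'. x k \<in> carrier R) \<and> (\<exists>k\<in>K'. x k \<notin> J) \<and>
      (\<forall>j\<in>I. (\<Oplus>k\<in>K'. (Y j k \<ominus> s \<otimes> Y j l \<otimes> Y i k) \<otimes> x k) \<in> J)"
      by (rule insert.IH) (use insert K' s l in auto)
    then obtain x where x: "\<And>k. k \<in> K' \<Longrightarrow> x k \<in> carrier R" "\<exists>k\<in>K'. x k \<notin> J"
      "\<And>j. j \<in> I \<Longrightarrow> (\<Oplus>k\<in>K'. (Y j k \<ominus> s \<otimes> Y j l \<otimes> Y i k) \<otimes> x k) \<in> J" by blast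
    define \<Sigma> where "\<Sigma> j = (\<Oplus>k\<in>K'. Y j k \<otimes> x k)" for j
    have \<Sigma>: "\<Sigma> j \<in> carrier R" if "j \<in> insert i I" for j
      unfolding \<Sigma>_def using x that by (intro finsum_closed) auto
    \<comment> \<open>Back substitution: as \<open>s\<close> inverts the pivot modulo
      \<open>J\<close>, this value in the pivot column solves row \<open>i\<close>. The other rows
      were reduced by the matching multiples of row \<open>i\<close> and remain solved.\<close>
    define x' where "x' = x(l := \<ominus> (s \<otimes> \<Sigma> i))"
    have row: "(\<Oplus>k\<in>K. Y j k \<otimes> x' k) = Y j l \<otimes> (\<ominus> (s \<otimes> \<Sigma> i)) \<oplus> \<Sigma> j" if j: "j \<in> insert i I" for j
    proof -
      have "(\<Oplus>k\<in>K'. Y j k \<otimes> x' k) = \<Sigma> j"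
        unfolding \<Sigma>_def using j x(1) K' by (intro finsum_cong') (auto simp: x'_def)
      moreover have "(\<Oplus>k\<in>K. Y j k \<otimes> x' k) = Y j l \<otimes> x' l \<oplus> (\<Oplus>k\<in>K'. Y j k \<otimes> x' k)"
        unfolding K'(3) using j x(1) K' s \<Sigma> l by (intro finsum_insert) (auto simp: x'_def)
      ultimately show ?thesis by (simp add: x'_def)
    qed
    have "(\<Oplus>k\<in>K. Y j k \<otimes> x' k) \<in> J" if j: "j \<in> I" for j
    proof -
      have "(\<Oplus>k\<in>K'. (Y j k \<ominus> s \<otimes> Y j l \<otimes> Y i k) \<otimes> x k)
        = (\<Oplus>k\<in>K'. Y j k \<otimes> x k \<oplus> (\<ominus> (s \<otimes> Y j l)) \<otimes> (Y i k \<otimes> x k))"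
      proof (intro finsum_cong')
        fix k assume k: "k \<in> K'"
        have c: "Y j k \<in> carrier R" "Y i k \<in> carrier R" "Y j l \<in> carrier R" "x k \<in> carrier R"
          using j k l x by auto
        show "(Y j k \<ominus> s \<otimes> Y j l \<otimes> Y i k) \<otimes> x k
          = Y j k \<otimes> x k \<oplus> (\<ominus> (s \<otimes> Y j l)) \<otimes> (Y i k \<otimes> x k)"
          using c s(1) by algebra
      qed (use j l x s in auto)
      also have "\<dots> = \<Sigma> j \<oplus> (\<Oplus>k\<in>K'. (\<ominus> (s \<otimes> Y j l)) \<otimes> (Y i k \<otimes> x k))"
        unfolding \<Sigma>_def using j l x s by (intro finsum_addf) auto
      also have "(\<Oplus>k\<in>K'. (\<ominus> (s \<otimes> Y j l)) \<otimes> (Y i k \<otimes> x k)) = (\<ominus> (s \<otimes> Y j l)) \<otimes> \<Sigma> i"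
        unfolding \<Sigma>_def using j l x s K' by (intro finsum_rdistr[symmetric]) auto
      also have "\<Sigma> j \<oplus> (\<ominus> (s \<otimes> Y j l)) \<otimes> \<Sigma> i = Y j l \<otimes> (\<ominus> (s \<otimes> \<Sigma> i)) \<oplus> \<Sigma> j"
      proof -
        have "Y j l \<in> carrier R" "\<Sigma> i \<in> carrier R" "\<Sigma> j \<in> carrier R" using j l \<Sigma> by auto
        then show ?thesis using s(1) by algebra
      qed
      finally show ?thesis using x(3)[OF j] row j by simp
    qed
    moreover have "(\<Oplus>k\<in>K. Y i k \<otimes> x' k) \<in> J"
    proof -
      have c: "Y i l \<in> carrier R" "\<Sigma> i \<in> carrier R" using l \<Sigma> by auto
      have "Y i l \<otimes> (\<ominus> (s \<otimes> \<Sigma> i)) \<oplus> \<Sigma> i = \<ominus> ((s \<otimes> Y i l \<ominus> \<one>) \<otimes> \<Sigma> i)"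
        using c s(1) by algebra
      also have "\<dots> \<in> J" using J.I_r_closed[OF s(2) c(2)] by simp
      finally show ?thesis using row by simp
    qed
    moreover have "\<forall>k\<in>K. x' k \<in> carrier R" using x(1) s \<Sigma> K' by (auto simp: x'_def)
    moreover have "\<exists>k\<in>K. x' k \<notin> J" using x(2) K' by (auto simp: x'_def)
    ultimately show ?thesis by (intro exI[of _ x']) auto
  qed
qed

end

context module
begin

text \<open>If \<open>D\<close> were larger, the change of basis would have a kernel modulo a
  maximal ideal \<open>J\<close>: a combination of \<open>D\<close> with a coefficient outside
  \<open>J\<close> whose coordinates in \<open>E\<close> all lie in \<open>J\<close>. Expressing it
  in \<open>D\<close> again puts that coefficient into \<open>J\<close>.\<close>

lemma finite_basis_card_le:
  assumes nontrivial: "\<one> \<noteq> \<zero>" and D: "finite_basis R M D" and E: "finite_basis R M E"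
  shows "card D \<le> card E"
proof (rule ccontr)
  assume "\<not> card D \<le> card E"
  then have less: "card E < card D" by simp
  have "{\<zero>} \<noteq> carrier R" using nontrivial by auto
  then obtain J where J: "maximalideal J R" using R.exists_maximalideal[OF R.zeroideal] by blast
  interpret J: maximalideal J R by fact
  obtain f g where fg: "coordinates D f" "coordinates E g"
    using D E finite_basis_coordinates by metis
  note f = fg(1)[unfolded coordinates_def] and g = fg(2)[unfolded coordinates_def]
  have fin: "finite D" "finite E" "D \<subseteq> carrier M" "E \<subseteq> carrier M" using f g by blast+
  have lf: "\<And>d. d \<in> D \<Longrightarrow> linear_form (f d)" and lg: "\<And>e. e \<in> E \<Longrightarrow> linear_form (g e)"
    using f g by blast+
  have "\<exists>x. (\<forall>d\<in>D. x d \<in> carrier R) \<and> (\<exists>d\<in>D. x d \<notin> J) \<and> (\<forall>e\<in>E. (\<Oplus>d\<in>D. g e d \<otimes> x d) \<in> J)"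
    using fin less linear_formD(1)[OF lg] by (intro R.underdetermined_system[OF J]) auto
  then obtain x d where x: "\<And>d. d \<in> D \<Longrightarrow> x d \<in> carrier R" and d: "d \<in> D" "x d \<notin> J"
    and gx: "\<And>e. e \<in> E \<Longrightarrow> (\<Oplus>d\<in>D. g e d \<otimes> x d) \<in> J" by blast
  have c [simp]: "\<And>d. d \<in> D \<Longrightarrow> d \<in> carrier M" "\<And>e. e \<in> E \<Longrightarrow> e \<in> carrier M" using fin by auto
  have xD: "x \<in> D \<rightarrow> carrier R" using x by blast
  define z where "z = (\<Oplus>\<^bsub>M\<^esub>d\<in>D. x d \<odot>\<^bsub>M\<^esub> d)"
  have z: "z \<in> carrier M" unfolding z_def using x by (intro M.finsum_closed) auto
  have gz: "g e z \<in> J" if e: "e \<in> E" for e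
  proof -
    have "g e z = (\<Oplus>d\<in>D. x d \<otimes> g e d)"
      unfolding z_def by (rule linear_form_lincomb[OF lg[OF e] fin(1,3) xD])
    also have "\<dots> = (\<Oplus>d\<in>D. g e d \<otimes> x d)"
      using x linear_formD(1)[OF lg[OF e]] by (intro R.finsum_cong') (auto simp: R.m_comm)
    finally show ?thesis using gx[OF e] by simp
  qed
  have "z = (\<Oplus>\<^bsub>M\<^esub>e\<in>E. g e z \<odot>\<^bsub>M\<^esub> e)" using g z by blast
  then have "f d z = f d (\<Oplus>\<^bsub>M\<^esub>e\<in>E. g e z \<odot>\<^bsub>M\<^esub> e)" by simp
  also have "\<dots> = (\<Oplus>e\<in>E. g e z \<otimes> f d e)"
    using linear_formD(1)[OF lg] z by (intro linear_form_lincomb[OF lf[OF d(1)] fin(2,4)]) auto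
  also have "\<dots> \<in> J"
    using gz linear_formD(1)[OF lf[OF d(1)]]
    by (intro R.ideal_finsum_closed[OF J.is_ideal fin(2)] J.I_r_closed) auto
  finally have "f d z \<in> J" .
  moreover have "f d z = x d"
  proof -
    have "f d z = (\<Oplus>d'\<in>D. x d' \<otimes> f d d')"
      unfolding z_def by (rule linear_form_lincomb[OF lf[OF d(1)] fin(1,3) xD])
    also have "\<dots> = (\<Oplus>d'\<in>D. if d = d' then x d' else \<zero>)"
      using x d(1) f by (intro R.finsum_cong') auto
    also have "\<dots> = x d" using x d fin by (intro R.finsum_singleton) auto
    finally show ?thesis .
  qed
  ultimately show False using d by simp
qed

lemma free_rank_eq:
  assumes "\<one> \<noteq> \<zero>" "finite_basis R M B"
  shows "free_rank R M = card B"
  unfolding free_rank_def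
proof (rule the_equality)
  show "\<exists>B'. finite_basis R M B' \<and> card B' = card B" using assms by blast
  fix n assume "\<exists>B'. finite_basis R M B' \<and> card B' = n"
  then show "n = card B" using finite_basis_card_le[OF assms(1)] assms(2) by (metis order_antisym)
qed

end

text \<open>Operations on classes are given as unions over representatives; with this lemma
  independence of representatives evaluates them.\<close>

lemma UN_const_eq: "\<lbrakk>U \<noteq> {}; \<And>x. x \<in> U \<Longrightarrow> f x = Y\<rbrakk> \<Longrightarrow> (\<Union>x\<in>U. f x) = Y"
  by blast

section \<open>Rings of fractions\<close>

locale denominators = cring R for R (structure) +
  fixes S
  assumes S_subset: "S \<subseteq> carrier R" and S_one [simp]: "\<one> \<in> S"
    and S_mult [simp]: "\<lbrakk>s \<in> S; t \<in> S\<rbrakk> \<Longrightarrow> s \<otimes> t \<in> S"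
begin

abbreviation frac where "frac \<equiv> fraction R S"
abbreviation L where "L \<equiv> localization R S"

lemma S_carrier [simp]: "s \<in> S \<Longrightarrow> s \<in> carrier R" using S_subset by blast

lemma frac_rel_equiv: "equiv (carrier R \<times> S) (frac_rel R S)"
proof (rule equivI)
  show "frac_rel R S \<subseteq> (carrier R \<times> S) \<times> (carrier R \<times> S)" by (auto simp: frac_rel_def)
  show "refl_on (carrier R \<times> S) (frac_rel R S)"
    by (auto simp: refl_on_def frac_rel_def minus_eq r_neg intro!: bexI[of _ \<one>])
  show "sym (frac_rel R S)"
  proof (rule symI, clarify)
    fix a s b t assume "((a, s), (b, t)) \<in> frac_rel R S"
    then obtain u where u: "a \<in> carrier R" "b \<in> carrier R" "s \<in> S" "t \<in> S" "u \<in> S"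
      "u \<otimes> (t \<otimes> a \<ominus> s \<otimes> b) = \<zero>" by (auto simp: frac_rel_def)
    have "u \<in> carrier R" "s \<in> carrier R" "t \<in> carrier R" using u by auto
    then have "u \<otimes> (s \<otimes> b \<ominus> t \<otimes> a) = \<ominus> (u \<otimes> (t \<otimes> a \<ominus> s \<otimes> b))" using u(1,2) by algebra
    then show "((b, t), (a, s)) \<in> frac_rel R S" using u by (auto simp: frac_rel_def)
  qed
  show "trans (frac_rel R S)"
  proof (rule transI, clarify)
    fix a s b t c x assume "((a, s), (b, t)) \<in> frac_rel R S" "((b, t), (c, x)) \<in> frac_rel R S"
    then obtain u v where u: "a \<in> carrier R" "b \<in> carrier R" "c \<in> carrier R" "s \<in> S" "t \<in> S" "x \<in> S"
      "u \<in> S" "v \<in> S" "u \<otimes> (t \<otimes> a \<ominus> s \<otimes> b) = \<zero>" "v \<otimes> (x \<otimes> b \<ominus> t \<otimes> c) = \<zero>"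
      by (auto simp: frac_rel_def)
    have c: "u \<in> carrier R" "v \<in> carrier R" "s \<in> carrier R" "t \<in> carrier R" "x \<in> carrier R"
      using u by auto
    \<comment> \<open>The middle denominator \<open>t\<close> has to enter the multiplier, since
      \<open>R\<close> may have zero divisors and \<open>t\<close> cannot be cancelled.\<close>
    have "(u \<otimes> v \<otimes> t) \<otimes> (x \<otimes> a \<ominus> s \<otimes> c)
      = v \<otimes> x \<otimes> (u \<otimes> (t \<otimes> a \<ominus> s \<otimes> b)) \<oplus> u \<otimes> s \<otimes> (v \<otimes> (x \<otimes> b \<ominus> t \<otimes> c))"
      using c u(1-3) by algebra
    also have "\<dots> = \<zero>" unfolding u(9,10) using c by simp
    finally show "((a, s), (c, x)) \<in> frac_rel R S" using u by (auto simp: frac_rel_def)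
  qed
qed

lemma frac_eq_iff:
  assumes "a \<in> carrier R" "b \<in> carrier R" "s \<in> S" "t \<in> S"
  shows "frac a s = frac b t \<longleftrightarrow> (\<exists>u\<in>S. u \<otimes> (t \<otimes> a \<ominus> s \<otimes> b) = \<zero>)"
  using eq_equiv_class_iff[OF frac_rel_equiv, of "(a, s)" "(b, t)"] assms
  by (simp add: fraction_def frac_rel_def)

lemma frac_eqI:
  assumes "a \<in> carrier R" "b \<in> carrier R" "s \<in> S" "t \<in> S" "t \<otimes> a = s \<otimes> b"
  shows "frac a s = frac b t"
  using assms by (subst frac_eq_iff) (auto simp: minus_eq r_neg intro!: bexI[of _ \<one>])

lemma frac_mem:
  assumes "(a', s') \<in> frac a s"
  shows "a' \<in> carrier R" "s' \<in> S" "a \<in> carrier R" "s \<in> S" "frac a' s' = frac a s"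
proof -
  have r: "((a, s), (a', s')) \<in> frac_rel R S" using assms by (simp add: fraction_def)
  then show "a' \<in> carrier R" "s' \<in> S" "a \<in> carrier R" "s \<in> S" by (auto simp: frac_rel_def)
  show "frac a' s' = frac a s"
    unfolding fraction_def using equiv_class_eq[OF frac_rel_equiv r] by simp
qed

lemma frac_self: "\<lbrakk>a \<in> carrier R; s \<in> S\<rbrakk> \<Longrightarrow> (a, s) \<in> frac a s"
  unfolding fraction_def by (rule equiv_class_self[OF frac_rel_equiv]) simp

lemma loc_carrier: "carrier L = {frac a s | a s. a \<in> carrier R \<and> s \<in> S}"
  by (auto simp: localization_def quotient_def fraction_def)

lemma frac_closed [simp]: "\<lbrakk>a \<in> carrier R; s \<in> S\<rbrakk> \<Longrightarrow> frac a s \<in> carrier L"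
  by (auto simp: loc_carrier)

lemma loc_one: "\<one>\<^bsub>L\<^esub> = frac \<one> \<one>" and loc_zero: "\<zero>\<^bsub>L\<^esub> = frac \<zero> \<one>"
  by (simp_all add: localization_def)

lemma loc_mult:
  assumes "a \<in> carrier R" "b \<in> carrier R" "s \<in> S" "t \<in> S"
  shows "frac a s \<otimes>\<^bsub>L\<^esub> frac b t = frac (a \<otimes> b) (s \<otimes> t)"
proof -
  have eq: "frac (a' \<otimes> b') (s' \<otimes> t') = frac (a \<otimes> b) (s \<otimes> t)"
    if m: "(a', s') \<in> frac a s" "(b', t') \<in> frac b t" for a' s' b' t'
  proof -
    note m1 = frac_mem[OF m(1)] and m2 = frac_mem[OF m(2)]
    obtain u where u: "u \<in> S" "u \<otimes> (s \<otimes> a' \<ominus> s' \<otimes> a) = \<zero>"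
      using m1 frac_eq_iff[of a' a s' s] by auto
    obtain v where v: "v \<in> S" "v \<otimes> (t \<otimes> b' \<ominus> t' \<otimes> b) = \<zero>"
      using m2 frac_eq_iff[of b' b t' t] by auto
    have c: "u \<in> carrier R" "v \<in> carrier R" "s \<in> carrier R" "t \<in> carrier R" "s' \<in> carrier R" "t' \<in> carrier R"
      "a \<in> carrier R" "b \<in> carrier R" "a' \<in> carrier R" "b' \<in> carrier R"
      using u v m1 m2 by auto
    have "(u \<otimes> v) \<otimes> ((s \<otimes> t) \<otimes> (a' \<otimes> b') \<ominus> (s' \<otimes> t') \<otimes> (a \<otimes> b))
      = v \<otimes> t \<otimes> b' \<otimes> (u \<otimes> (s \<otimes> a' \<ominus> s' \<otimes> a)) \<oplus> u \<otimes> s' \<otimes> a \<otimes> (v \<otimes> (t \<otimes> b' \<ominus> t' \<otimes> b))"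
      using c by algebra
    also have "\<dots> = \<zero>" unfolding u(2) v(2) using c by simp
    finally show ?thesis using c u v m1 m2 by (subst frac_eq_iff) auto
  qed
  have "frac a s \<otimes>\<^bsub>L\<^esub> frac b t
    = (\<Union>p\<in>frac a s. \<Union>q\<in>frac b t. frac (fst p \<otimes> fst q) (snd p \<otimes> snd q))"
    by (simp add: localization_def case_prod_beta)
  also have "\<dots> = frac (a \<otimes> b) (s \<otimes> t)"
  proof (intro UN_const_eq)
    show "frac a s \<noteq> {}" "frac b t \<noteq> {}"
      using frac_self[OF assms(1,3)] frac_self[OF assms(2,4)] by blast+
  qed (rule eq; simp only: prod.collapse)
  finally show ?thesis .
qed

lemma loc_add:
  assumes "a \<in> carrier R" "b \<in> carrier R" "s \<in> S" "t \<in> S"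
  shows "frac a s \<oplus>\<^bsub>L\<^esub> frac b t = frac (t \<otimes> a \<oplus> s \<otimes> b) (s \<otimes> t)"
proof -
  have eq: "frac (t' \<otimes> a' \<oplus> s' \<otimes> b') (s' \<otimes> t') = frac (t \<otimes> a \<oplus> s \<otimes> b) (s \<otimes> t)"
    if m: "(a', s') \<in> frac a s" "(b', t') \<in> frac b t" for a' s' b' t'
  proof -
    note m1 = frac_mem[OF m(1)] and m2 = frac_mem[OF m(2)]
    obtain u where u: "u \<in> S" "u \<otimes> (s \<otimes> a' \<ominus> s' \<otimes> a) = \<zero>"
      using m1 frac_eq_iff[of a' a s' s] by auto
    obtain v where v: "v \<in> S" "v \<otimes> (t \<otimes> b' \<ominus> t' \<otimes> b) = \<zero>"
      using m2 frac_eq_iff[of b' b t' t] by auto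
    have c: "u \<in> carrier R" "v \<in> carrier R" "s \<in> carrier R" "t \<in> carrier R" "s' \<in> carrier R" "t' \<in> carrier R"
      "a \<in> carrier R" "b \<in> carrier R" "a' \<in> carrier R" "b' \<in> carrier R"
      using u v m1 m2 by auto
    have "(u \<otimes> v) \<otimes> ((s \<otimes> t) \<otimes> (t' \<otimes> a' \<oplus> s' \<otimes> b') \<ominus> (s' \<otimes> t') \<otimes> (t \<otimes> a \<oplus> s \<otimes> b))
      = v \<otimes> t \<otimes> t' \<otimes> (u \<otimes> (s \<otimes> a' \<ominus> s' \<otimes> a)) \<oplus> u \<otimes> s \<otimes> s' \<otimes> (v \<otimes> (t \<otimes> b' \<ominus> t' \<otimes> b))"
      using c by algebra
    also have "\<dots> = \<zero>" unfolding u(2) v(2) using c by simp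
    finally show ?thesis using c u v m1 m2 by (subst frac_eq_iff) auto
  qed
  have "frac a s \<oplus>\<^bsub>L\<^esub> frac b t
    = (\<Union>p\<in>frac a s. \<Union>q\<in>frac b t. frac (snd q \<otimes> fst p \<oplus> snd p \<otimes> fst q) (snd p \<otimes> snd q))"
    by (simp add: localization_def case_prod_beta)
  also have "\<dots> = frac (t \<otimes> a \<oplus> s \<otimes> b) (s \<otimes> t)"
  proof (intro UN_const_eq)
    show "frac a s \<noteq> {}" "frac b t \<noteq> {}"
      using frac_self[OF assms(1,3)] frac_self[OF assms(2,4)] by blast+
  qed (rule eq; simp only: prod.collapse)
  finally show ?thesis .
qed

lemma loc_smult:
  assumes "r \<in> carrier R" "a \<in> carrier R" "s \<in> S"
  shows "r \<odot>\<^bsub>L\<^esub> frac a s = frac (r \<otimes> a) s"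
proof -
  have eq: "frac (r \<otimes> a') s' = frac (r \<otimes> a) s" if m: "(a', s') \<in> frac a s" for a' s'
  proof -
    note m1 = frac_mem[OF m]
    obtain u where u: "u \<in> S" "u \<otimes> (s \<otimes> a' \<ominus> s' \<otimes> a) = \<zero>"
      using m1 frac_eq_iff[of a' a s' s] by auto
    have c: "u \<in> carrier R" "s \<in> carrier R" "s' \<in> carrier R" "a \<in> carrier R" "a' \<in> carrier R"
      using u m1 by auto
    have "u \<otimes> (s \<otimes> (r \<otimes> a') \<ominus> s' \<otimes> (r \<otimes> a)) = r \<otimes> (u \<otimes> (s \<otimes> a' \<ominus> s' \<otimes> a))"
      using c assms(1) by algebra
    then show ?thesis using c u m1 assms by (subst frac_eq_iff) auto
  qed
  have "r \<odot>\<^bsub>L\<^esub> frac a s = (\<Union>p\<in>frac a s. frac (r \<otimes> fst p) (snd p))"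
    by (simp add: localization_def case_prod_beta)
  also have "\<dots> = frac (r \<otimes> a) s"
  proof (intro UN_const_eq)
    show "frac a s \<noteq> {}" using frac_self[OF assms(2,3)] by blast
  qed (rule eq; simp only: prod.collapse)
  finally show ?thesis .
qed

lemma loc_cring: "cring L"
proof (rule cringI)
  show "abelian_group L"
  proof (rule abelian_groupI)
    fix x y assume x: "x \<in> carrier L" and y: "y \<in> carrier L"
    obtain a s where a: "x = frac a s" "a \<in> carrier R" "s \<in> S" using x by (auto simp: loc_carrier)
    obtain b t where b: "y = frac b t" "b \<in> carrier R" "t \<in> S" using y by (auto simp: loc_carrier)
    note c = a(2) b(2) S_carrier[OF a(3)] S_carrier[OF b(3)]
    show "x \<oplus>\<^bsub>L\<^esub> y \<in> carrier L" using a b c by (simp add: loc_add)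
    have "s \<otimes> b \<oplus> t \<otimes> a = t \<otimes> a \<oplus> s \<otimes> b" "t \<otimes> s = s \<otimes> t" using c by algebra+
    then show "x \<oplus>\<^bsub>L\<^esub> y = y \<oplus>\<^bsub>L\<^esub> x" using a b c by (simp add: loc_add)
    fix z assume z: "z \<in> carrier L"
    obtain d u where d: "z = frac d u" "d \<in> carrier R" "u \<in> S" using z by (auto simp: loc_carrier)
    note c = c d(2) S_carrier[OF d(3)]
    have "u \<otimes> (t \<otimes> a \<oplus> s \<otimes> b) \<oplus> s \<otimes> t \<otimes> d = t \<otimes> u \<otimes> a \<oplus> s \<otimes> (u \<otimes> b \<oplus> t \<otimes> d)"
      "s \<otimes> t \<otimes> u = s \<otimes> (t \<otimes> u)" using c by algebra+
    then show "x \<oplus>\<^bsub>L\<^esub> y \<oplus>\<^bsub>L\<^esub> z = x \<oplus>\<^bsub>L\<^esub> (y \<oplus>\<^bsub>L\<^esub> z)" using a b d c by (simp add: loc_add)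
  next
    show "\<zero>\<^bsub>L\<^esub> \<in> carrier L" by (simp add: loc_zero)
    fix x assume x: "x \<in> carrier L"
    obtain a s where a: "x = frac a s" "a \<in> carrier R" "s \<in> S" using x by (auto simp: loc_carrier)
    show "\<zero>\<^bsub>L\<^esub> \<oplus>\<^bsub>L\<^esub> x = x" using a by (simp add: loc_zero loc_add)
    have "frac (\<ominus> a) s \<oplus>\<^bsub>L\<^esub> x = frac (s \<otimes> \<ominus> a \<oplus> s \<otimes> a) (s \<otimes> s)" using a by (simp add: loc_add)
    also have "\<dots> = \<zero>\<^bsub>L\<^esub>" unfolding loc_zero using a
      by (intro frac_eqI) (auto simp: r_minus l_neg)
    finally show "\<exists>y\<in>carrier L. y \<oplus>\<^bsub>L\<^esub> x = \<zero>\<^bsub>L\<^esub>" using a by (intro bexI[of _ "frac (\<ominus> a) s"]) auto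
  qed
  show "comm_monoid L"
  proof (rule comm_monoidI)
    fix x y assume x: "x \<in> carrier L" and y: "y \<in> carrier L"
    obtain a s where a: "x = frac a s" "a \<in> carrier R" "s \<in> S" using x by (auto simp: loc_carrier)
    obtain b t where b: "y = frac b t" "b \<in> carrier R" "t \<in> S" using y by (auto simp: loc_carrier)
    show "x \<otimes>\<^bsub>L\<^esub> y \<in> carrier L" using a b by (simp add: loc_mult)
    show "x \<otimes>\<^bsub>L\<^esub> y = y \<otimes>\<^bsub>L\<^esub> x" using a b by (simp add: loc_mult m_comm)
    fix z assume z: "z \<in> carrier L"
    obtain d u where d: "z = frac d u" "d \<in> carrier R" "u \<in> S" using z by (auto simp: loc_carrier)
    show "x \<otimes>\<^bsub>L\<^esub> y \<otimes>\<^bsub>L\<^esub> z = x \<otimes>\<^bsub>L\<^esub> (y \<otimes>\<^bsub>L\<^esub> z)" using a b d by (simp add: loc_mult m_assoc)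
  next
    show "\<one>\<^bsub>L\<^esub> \<in> carrier L" by (simp add: loc_one)
    fix x assume x: "x \<in> carrier L"
    obtain a s where a: "x = frac a s" "a \<in> carrier R" "s \<in> S" using x by (auto simp: loc_carrier)
    then show "\<one>\<^bsub>L\<^esub> \<otimes>\<^bsub>L\<^esub> x = x" by (simp add: loc_one loc_mult)
  qed
  fix x y z assume x: "x \<in> carrier L" and y: "y \<in> carrier L" and z: "z \<in> carrier L"
  obtain a s where a: "x = frac a s" "a \<in> carrier R" "s \<in> S" using x by (auto simp: loc_carrier)
  obtain b t where b: "y = frac b t" "b \<in> carrier R" "t \<in> S" using y by (auto simp: loc_carrier)
  obtain d u where d: "z = frac d u" "d \<in> carrier R" "u \<in> S" using z by (auto simp: loc_carrier)
  note c = a(2) b(2) d(2) S_carrier[OF a(3)] S_carrier[OF b(3)] S_carrier[OF d(3)]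
  have "s \<otimes> u \<otimes> (t \<otimes> u) \<otimes> ((t \<otimes> a \<oplus> s \<otimes> b) \<otimes> d)
    = s \<otimes> t \<otimes> u \<otimes> (t \<otimes> u \<otimes> (a \<otimes> d) \<oplus> s \<otimes> u \<otimes> (b \<otimes> d))" using c by algebra
  then show "(x \<oplus>\<^bsub>L\<^esub> y) \<otimes>\<^bsub>L\<^esub> z = x \<otimes>\<^bsub>L\<^esub> z \<oplus>\<^bsub>L\<^esub> y \<otimes>\<^bsub>L\<^esub> z"
    using a b d c by (simp add: loc_add loc_mult) (intro frac_eqI, auto)
qed

lemma loc_module: "module R L"
proof (rule moduleI[OF is_cring])
  show "abelian_group L" using loc_cring by (simp add: cring_def ring_def)
  fix r x assume r: "r \<in> carrier R" and x: "x \<in> carrier L"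
  obtain a s where a: "x = frac a s" "a \<in> carrier R" "s \<in> S" using x by (auto simp: loc_carrier)
  show "r \<odot>\<^bsub>L\<^esub> x \<in> carrier L" using r a by (simp add: loc_smult)
  fix y assume y: "y \<in> carrier L"
  obtain b t where b: "y = frac b t" "b \<in> carrier R" "t \<in> S" using y by (auto simp: loc_carrier)
  have "r \<otimes> (t \<otimes> a \<oplus> s \<otimes> b) = t \<otimes> (r \<otimes> a) \<oplus> s \<otimes> (r \<otimes> b)"
    using r a(2) b(2) S_carrier[OF a(3)] S_carrier[OF b(3)] by algebra
  then show "r \<odot>\<^bsub>L\<^esub> (x \<oplus>\<^bsub>L\<^esub> y) = r \<odot>\<^bsub>L\<^esub> x \<oplus>\<^bsub>L\<^esub> r \<odot>\<^bsub>L\<^esub> y"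
    using r a b by (simp add: loc_smult loc_add)
next
  fix x assume "x \<in> carrier L"
  then show "\<one> \<odot>\<^bsub>L\<^esub> x = x" by (auto simp: loc_carrier loc_smult)
next
  fix r r' x assume r: "r \<in> carrier R" "r' \<in> carrier R" and x: "x \<in> carrier L"
  obtain a s where a: "x = frac a s" "a \<in> carrier R" "s \<in> S" using x by (auto simp: loc_carrier)
  note c = r a(2) S_carrier[OF a(3)]
  have "s \<otimes> s \<otimes> ((r \<oplus> r') \<otimes> a) = s \<otimes> (s \<otimes> (r \<otimes> a) \<oplus> s \<otimes> (r' \<otimes> a))" using c by algebra
  then show "(r \<oplus> r') \<odot>\<^bsub>L\<^esub> x = r \<odot>\<^bsub>L\<^esub> x \<oplus>\<^bsub>L\<^esub> r' \<odot>\<^bsub>L\<^esub> x"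
    using c a by (simp add: loc_smult loc_add) (intro frac_eqI, auto)
  show "(r \<otimes> r') \<odot>\<^bsub>L\<^esub> x = r \<odot>\<^bsub>L\<^esub> (r' \<odot>\<^bsub>L\<^esub> x)" using c a by (simp add: loc_smult m_assoc)
qed

lemma loc_smult_mult:
  assumes "r \<in> carrier R" "x \<in> carrier L" "y \<in> carrier L"
  shows "(r \<odot>\<^bsub>L\<^esub> x) \<otimes>\<^bsub>L\<^esub> y = r \<odot>\<^bsub>L\<^esub> (x \<otimes>\<^bsub>L\<^esub> y)"
  using assms by (auto simp: loc_carrier loc_smult loc_mult m_assoc)

lemma loc_inverse:
  assumes "s \<in> S" shows "s \<odot>\<^bsub>L\<^esub> frac \<one> s = \<one>\<^bsub>L\<^esub>"
  using assms unfolding loc_one by (simp add: loc_smult) (intro frac_eqI, auto)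

lemma loc_nontrivial:
  assumes "\<zero> \<notin> S" shows "\<one>\<^bsub>L\<^esub> \<noteq> \<zero>\<^bsub>L\<^esub>"
  using assms unfolding loc_one loc_zero by (auto simp: frac_eq_iff minus_eq)

end

section \<open>Base change\<close>

text \<open>\<open>S\<close> is a commutative \<open>R\<close>-algebra whose single record carries
  both its ring and its module structure, as \<open>localization\<close> does.\<close>

locale scalar_extension = S: cring S + SR: module R S + module R N
  for S :: "('r, 'b, 's) module_scheme" (structure) and R :: "('r, 'p) ring_scheme"
    and N :: "('r, 'a, 'q) module_scheme" +
  assumes smult_mult: "\<lbrakk>r \<in> carrier R; x \<in> carrier S; y \<in> carrier S\<rbrakk>
    \<Longrightarrow> (r \<odot> x) \<otimes> y = r \<odot> (x \<otimes> y)"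
begin

abbreviation G where "G \<equiv> free_Abelian_group (carrier N \<times> carrier S)"
abbreviation K where "K \<equiv> tensor_kernel R N S"
abbreviation E where "E \<equiv> base_change R N S"

text \<open>The group operation is addition of finitely supported functions, so cosets can be
  compared by differences in \<open>K\<close> for arbitrary \<open>c\<close>, without membership in
  \<open>carrier G\<close>.\<close>

definition cls :: "('a \<times> 'b \<Rightarrow>\<^sub>0 int) \<Rightarrow> ('a \<times> 'b \<Rightarrow>\<^sub>0 int) set" where
  "cls c = K #>\<^bsub>G\<^esub> c"

definition scale :: "'b \<Rightarrow> ('a \<times> 'b \<Rightarrow>\<^sub>0 int) \<Rightarrow> ('a \<times> 'b \<Rightarrow>\<^sub>0 int)" where
  "scale s = frag_extend (\<lambda>(x, y). frag_of (x, s \<otimes> y))"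

lemma smult_mult_right: "\<lbrakk>r \<in> carrier R; x \<in> carrier S; y \<in> carrier S\<rbrakk> \<Longrightarrow> x \<otimes> (r \<odot> y) = r \<odot> (x \<otimes> y)"
  using smult_mult[of r y x] by (simp add: S.m_comm)

lemma keys_add_subset: "\<lbrakk>c \<in> carrier G; d \<in> carrier G\<rbrakk> \<Longrightarrow> c + d \<in> carrier G"
  and keys_diff_subset: "\<lbrakk>c \<in> carrier G; d \<in> carrier G\<rbrakk> \<Longrightarrow> c - d \<in> carrier G"
  using keys_add[of c d] keys_diff[of c d] by auto

lemma frag_of_carrier: "\<lbrakk>x \<in> carrier N; y \<in> carrier S\<rbrakk> \<Longrightarrow> frag_of (x, y) \<in> carrier G"
  by simp

lemma relators_carrier: "tensor_relators R N S \<subseteq> carrier G"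
  unfolding tensor_relators_def by (auto intro!: keys_diff_subset simp del: carrier_free_Abelian_group_iff)

lemma K_subgroup: "subgroup K G"
  unfolding tensor_kernel_def
  by (rule group.generate_is_subgroup[OF group_free_Abelian_group relators_carrier])

lemma K_carrier: "k \<in> K \<Longrightarrow> k \<in> carrier G" by (rule subgroup.mem_carrier[OF K_subgroup])
lemma K_zero: "0 \<in> K" using subgroup.one_closed[OF K_subgroup] by simp
lemma K_add: "\<lbrakk>k \<in> K; l \<in> K\<rbrakk> \<Longrightarrow> k + l \<in> K" using subgroup.m_closed[OF K_subgroup] by simp
lemma K_minus: "k \<in> K \<Longrightarrow> - k \<in> K"
  using subgroup.m_inv_closed[OF K_subgroup, of k] K_carrier[of k] by simp
lemma K_diff: "\<lbrakk>k \<in> K; l \<in> K\<rbrakk> \<Longrightarrow> k - l \<in> K" using K_add[OF _ K_minus] by simp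
lemma K_relator: "c \<in> tensor_relators R N S \<Longrightarrow> c \<in> K"
  unfolding tensor_kernel_def by (rule generate.incl)

lemma K_induct [consumes 1]:
  assumes "k \<in> K" "P 0" "\<And>c. c \<in> tensor_relators R N S \<Longrightarrow> P c" "\<And>c. P c \<Longrightarrow> P (- c)"
    "\<And>c d. \<lbrakk>c \<in> carrier G; d \<in> carrier G; P c; P d\<rbrakk> \<Longrightarrow> P (c + d)"
  shows "P k"
  using assms(1) unfolding tensor_kernel_def
proof induction
  case one
  then show ?case using assms(2) by simp
next
  case (incl h)
  then show ?case using assms(3) by simp
next
  case (inv h)
  then have "h \<in> carrier G" using relators_carrier by blast
  then show ?case using assms(3,4) inv by simp
next
  case (eng h1 h2)
  then show ?case using assms(5) K_carrier unfolding tensor_kernel_def by simp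
qed

lemma mem_cls: "d \<in> cls c \<longleftrightarrow> d - c \<in> K"
proof
  assume "d \<in> cls c"
  then show "d - c \<in> K" by (auto simp: cls_def r_coset_def)
next
  assume "d - c \<in> K"
  then have "\<exists>k\<in>K. d = k + c" by (intro bexI[of _ "d - c"]) auto
  then show "d \<in> cls c" by (auto simp: cls_def r_coset_def)
qed

lemma cls_eq_iff: "cls c = cls d \<longleftrightarrow> c - d \<in> K"
proof
  assume "cls c = cls d"
  moreover have "c \<in> cls c" using K_zero by (simp add: mem_cls)
  ultimately show "c - d \<in> K" by (simp add: mem_cls)
next
  assume cd: "c - d \<in> K"
  have "x - c \<in> K \<longleftrightarrow> x - d \<in> K" for x
    using K_add[OF _ cd, of "x - c"] K_diff[OF _ cd, of "x - d"] by auto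
  then show "cls c = cls d" by (auto simp: mem_cls)
qed

lemma E_carrier: "carrier E = cls ` carrier G"
  by (auto simp: base_change_def tensor_group_def FactGroup_def RCOSETS_def cls_def)

lemma cls_closed [simp]: "c \<in> carrier G \<Longrightarrow> cls c \<in> carrier E"
  by (simp only: E_carrier image_eqI)

lemma E_zero: "\<zero>\<^bsub>E\<^esub> = cls 0"
  by (simp add: base_change_def tensor_group_def FactGroup_def cls_def r_coset_def)

lemma E_add: "cls c \<oplus>\<^bsub>E\<^esub> cls d = cls (c + d)"
proof -
  have "cls c \<oplus>\<^bsub>E\<^esub> cls d = {x + y | x y. x \<in> cls c \<and> y \<in> cls d}"
    by (auto simp: base_change_def tensor_group_def FactGroup_def set_mult_def)
  also have "\<dots> = cls (c + d)"
  proof (intro equalityI subsetI)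
    fix z assume "z \<in> {x + y | x y. x \<in> cls c \<and> y \<in> cls d}"
    then obtain x y where xy: "z = x + y" "x - c \<in> K" "y - d \<in> K" by (auto simp: mem_cls)
    then show "z \<in> cls (c + d)" using K_add[OF xy(2,3)] by (simp add: mem_cls algebra_simps)
  next
    fix z assume "z \<in> cls (c + d)"
    then have "z - d \<in> cls c" by (simp add: mem_cls algebra_simps)
    moreover have "d \<in> cls d" using K_zero by (simp add: mem_cls)
    moreover have "z = (z - d) + d" by simp
    ultimately show "z \<in> {x + y | x y. x \<in> cls c \<and> y \<in> cls d}" by blast
  qed
  finally show ?thesis .
qed

lemma scale_of [simp]: "scale s (frag_of (x, y)) = frag_of (x, s \<otimes> y)"
  by (simp add: scale_def)

lemma scale_add: "scale s (c + d) = scale s c + scale s d"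
  and scale_diff: "scale s (c - d) = scale s c - scale s d"
  and scale_minus: "scale s (- c) = - scale s c"
  and scale_zero [simp]: "scale s 0 = 0"
  by (simp_all add: scale_def frag_extend_add frag_extend_diff frag_extend_minus)

lemma scale_carrier:
  assumes "s \<in> carrier S" "c \<in> carrier G" shows "scale s c \<in> carrier G"
proof -
  have "Poly_Mapping.keys (scale s c) \<subseteq> (\<Union>p\<in>Poly_Mapping.keys c. Poly_Mapping.keys (case p of (x, y) \<Rightarrow> frag_of (x, s \<otimes> y)))"
    unfolding scale_def by (rule keys_frag_extend)
  also have "\<dots> \<subseteq> carrier N \<times> carrier S" using assms by fastforce
  finally show ?thesis by simp
qed

lemma relator_cases:
  assumes "c \<in> tensor_relators R N S"
  obtains x x' y where "c = frag_of (x \<oplus>\<^bsub>N\<^esub> x', y) - frag_of (x, y) - frag_of (x', y)"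
      "x \<in> carrier N" "x' \<in> carrier N" "y \<in> carrier S"
  | x y y' where "c = frag_of (x, y \<oplus> y') - frag_of (x, y) - frag_of (x, y')"
      "x \<in> carrier N" "y \<in> carrier S" "y' \<in> carrier S"
  | r x y where "c = frag_of (r \<odot>\<^bsub>N\<^esub> x, y) - frag_of (x, r \<odot> y)"
      "r \<in> carrier R" "x \<in> carrier N" "y \<in> carrier S"
  using assms unfolding tensor_relators_def by blast

lemma K_bilinear:
  shows K_left: "\<lbrakk>x \<in> carrier N; x' \<in> carrier N; y \<in> carrier S\<rbrakk>
      \<Longrightarrow> frag_of (x \<oplus>\<^bsub>N\<^esub> x', y) - frag_of (x, y) - frag_of (x', y) \<in> K"
    and K_right: "\<lbrakk>x \<in> carrier N; y \<in> carrier S; y' \<in> carrier S\<rbrakk>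
      \<Longrightarrow> frag_of (x, y \<oplus> y') - frag_of (x, y) - frag_of (x, y') \<in> K"
    and K_balanced: "\<lbrakk>r \<in> carrier R; x \<in> carrier N; y \<in> carrier S\<rbrakk>
      \<Longrightarrow> frag_of (r \<odot>\<^bsub>N\<^esub> x, y) - frag_of (x, r \<odot> y) \<in> K"
  by (rule K_relator, unfold tensor_relators_def, blast)+

lemma scale_K:
  assumes s: "s \<in> carrier S" and "k \<in> K" shows "scale s k \<in> K"
  using assms(2)
proof (induction rule: K_induct)
  case (2 c)
  then show ?case
    by (cases rule: relator_cases)
      (use s in \<open>simp_all add: scale_diff S.r_distr smult_mult_right K_left K_right K_balanced\<close>)
qed (auto simp: K_zero scale_minus scale_add intro: K_minus K_add)

text \<open>The union over representatives is constant because scaling maps \<open>K\<close> into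
  itself.\<close>

lemma E_smult:
  assumes s: "s \<in> carrier S"
  shows "s \<odot>\<^bsub>E\<^esub> cls c = cls (scale s c)"
proof -
  have "s \<odot>\<^bsub>E\<^esub> cls c = (\<Union>d\<in>cls c. cls (scale s d))"
    by (simp add: base_change_def cls_def scale_def)
  also have "\<dots> = cls (scale s c)"
  proof (rule UN_const_eq)
    show "cls c \<noteq> {}" using K_zero mem_cls[of c c] by auto
    fix d assume "d \<in> cls c"
    then show "cls (scale s d) = cls (scale s c)"
      using scale_K[OF s, of "d - c"] by (simp add: mem_cls cls_eq_iff scale_diff)
  qed
  finally show ?thesis .
qed

lemma scale_induct [consumes 1, case_names zero diff single]:
  assumes "c \<in> carrier G" "P 0"
    "\<And>c d. \<lbrakk>c \<in> carrier G; d \<in> carrier G; P c; P d\<rbrakk> \<Longrightarrow> P (c - d)"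
    "\<And>x y. \<lbrakk>x \<in> carrier N; y \<in> carrier S\<rbrakk> \<Longrightarrow> P (frag_of (x, y))"
  shows "P c"
proof (rule free_Abelian_group_induct[of c "carrier N \<times> carrier S"])
  show "Poly_Mapping.keys c \<subseteq> carrier N \<times> carrier S" using assms(1) by simp
qed (use assms in auto)

lemma E_abelian_group: "abelian_group E"
proof (rule abelian_groupI)
  fix x assume "x \<in> carrier E"
  then obtain c where c: "c \<in> carrier G" "x = cls c" by (auto simp only: E_carrier)
  have "- c \<in> carrier G" using c by simp
  then have "cls (- c) \<in> carrier E" by (rule cls_closed)
  moreover have "cls (- c) \<oplus>\<^bsub>E\<^esub> x = \<zero>\<^bsub>E\<^esub>" using c by (simp add: E_add E_zero)
  ultimately show "\<exists>y\<in>carrier E. y \<oplus>\<^bsub>E\<^esub> x = \<zero>\<^bsub>E\<^esub>" by blast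
next
  show "\<zero>\<^bsub>E\<^esub> \<in> carrier E" unfolding E_zero by (rule cls_closed) simp
next
  fix x y assume "x \<in> carrier E" "y \<in> carrier E"
  then obtain c d where c: "c \<in> carrier G" "x = cls c" "d \<in> carrier G" "y = cls d"
    by (auto simp only: E_carrier)
  show "x \<oplus>\<^bsub>E\<^esub> y \<in> carrier E" unfolding c E_add by (rule cls_closed[OF keys_add_subset[OF c(1,3)]])
qed (auto simp only: E_carrier E_add E_zero add_0_left add_0_right ac_simps)

lemma E_module: "module S E"
proof (rule moduleI[OF S.is_cring E_abelian_group])
  fix s u assume s: "s \<in> carrier S" and "u \<in> carrier E"
  then obtain c where c: "c \<in> carrier G" "u = cls c" by (auto simp only: E_carrier)
  show "s \<odot>\<^bsub>E\<^esub> u \<in> carrier E" unfolding c E_smult[OF s] by (rule cls_closed[OF scale_carrier[OF s c(1)]])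
  fix v assume "v \<in> carrier E"
  then obtain d where d: "d \<in> carrier G" "v = cls d" by (auto simp only: E_carrier)
  show "s \<odot>\<^bsub>E\<^esub> (u \<oplus>\<^bsub>E\<^esub> v) = s \<odot>\<^bsub>E\<^esub> u \<oplus>\<^bsub>E\<^esub> s \<odot>\<^bsub>E\<^esub> v"
    using s by (simp add: c d E_add E_smult scale_add)
next
  fix s t u assume s: "s \<in> carrier S" "t \<in> carrier S" and "u \<in> carrier E"
  then obtain c where c: "c \<in> carrier G" "u = cls c" by (auto simp only: E_carrier)
  have "scale (s \<oplus> t) c - (scale s c + scale t c) \<in> K" using c(1)
  proof (induction rule: scale_induct)
    case (diff c d)
    then show ?case using K_diff[OF diff.IH] by (simp add: scale_diff algebra_simps)
  next
    case (single x y)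
    then show ?case using s K_right[of x "s \<otimes> y" "t \<otimes> y"] by (simp add: S.l_distr algebra_simps)
  qed (simp add: K_zero)
  then show "(s \<oplus> t) \<odot>\<^bsub>E\<^esub> u = s \<odot>\<^bsub>E\<^esub> u \<oplus>\<^bsub>E\<^esub> t \<odot>\<^bsub>E\<^esub> u"
    using s by (simp add: c E_smult E_add cls_eq_iff)
  have "scale (s \<otimes> t) c = scale s (scale t c)" using c(1)
    by (induction rule: scale_induct) (use s in \<open>simp_all add: scale_diff S.m_assoc\<close>)
  then show "(s \<otimes> t) \<odot>\<^bsub>E\<^esub> u = s \<odot>\<^bsub>E\<^esub> (t \<odot>\<^bsub>E\<^esub> u)"
    using s by (simp add: c E_smult)
next
  fix u assume "u \<in> carrier E"
  then obtain c where c: "c \<in> carrier G" "u = cls c" by (auto simp only: E_carrier)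
  have "scale \<one> c = c" using c(1) by (induction rule: scale_induct) (simp_all add: scale_diff)
  then show "\<one> \<odot>\<^bsub>E\<^esub> u = u" by (simp add: c E_smult)
qed

definition tensor :: "'a \<Rightarrow> 'b \<Rightarrow> ('a \<times> 'b \<Rightarrow>\<^sub>0 int) set" where
  "tensor x y = cls (frag_of (x, y))"

lemma tensor_closed [simp]: "\<lbrakk>x \<in> carrier N; y \<in> carrier S\<rbrakk> \<Longrightarrow> tensor x y \<in> carrier E"
  unfolding tensor_def by (rule cls_closed[OF frag_of_carrier])

lemma tensor_add_left:
  "\<lbrakk>x \<in> carrier N; x' \<in> carrier N; y \<in> carrier S\<rbrakk>
    \<Longrightarrow> tensor (x \<oplus>\<^bsub>N\<^esub> x') y = tensor x y \<oplus>\<^bsub>E\<^esub> tensor x' y"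
  using K_left[of x x' y] by (simp add: tensor_def E_add cls_eq_iff algebra_simps)

lemma tensor_balanced:
  "\<lbrakk>r \<in> carrier R; x \<in> carrier N; y \<in> carrier S\<rbrakk>
    \<Longrightarrow> tensor (r \<odot>\<^bsub>N\<^esub> x) y = tensor x (r \<odot> y)"
  using K_balanced[of r x y] by (simp add: tensor_def cls_eq_iff)

lemma tensor_smult:
  "\<lbrakk>s \<in> carrier S; x \<in> carrier N; y \<in> carrier S\<rbrakk> \<Longrightarrow> s \<odot>\<^bsub>E\<^esub> tensor x y = tensor x (s \<otimes> y)"
  by (simp add: tensor_def E_smult)

sublocale E: module S E by (rule E_module)

lemma tensor_zero_left: "y \<in> carrier S \<Longrightarrow> tensor \<zero>\<^bsub>N\<^esub> y = \<zero>\<^bsub>E\<^esub>"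
  using tensor_balanced[of "\<zero>\<^bsub>R\<^esub>" "\<zero>\<^bsub>N\<^esub>" y] tensor_smult[of \<zero> "\<zero>\<^bsub>N\<^esub>" y] by simp

lemma tensor_finsum_left:
  assumes "finite C" "f \<in> C \<rightarrow> carrier N" "y \<in> carrier S"
  shows "tensor (\<Oplus>\<^bsub>N\<^esub>c\<in>C. f c) y = (\<Oplus>\<^bsub>E\<^esub>c\<in>C. tensor (f c) y)"
  using assms(1,2)
proof (induction C)
  case empty
  then show ?case using assms(3) by (simp add: tensor_zero_left)
next
  case (insert c C)
  have m: "f \<in> C \<rightarrow> carrier N" "f c \<in> carrier N" "(\<lambda>c. tensor (f c) y) \<in> C \<rightarrow> carrier E"
    using insert.prems assms(3) by (auto simp: Pi_iff)
  then show ?case using insert assms(3)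
    by (simp add: tensor_add_left M.finsum_insert E.M.finsum_insert)
qed

text \<open>This is \<open>\<epsilon>\<close> tensor the identity of \<open>S\<close>. The universal
  property of the free group defines it there; it kills the three kinds of relators and therefore
  descends to classes.\<close>

lemma linear_form_extension:
  assumes \<epsilon>: "linear_form \<epsilon>"
  obtains \<kappa> where "E.linear_form \<kappa>"
    "\<And>x y. \<lbrakk>x \<in> carrier N; y \<in> carrier S\<rbrakk> \<Longrightarrow> \<kappa> (tensor x y) = \<epsilon> x \<odot> y"
proof -
  note \<epsilon>' = linear_formD[OF \<epsilon>]
  have "(\<lambda>(x, y). \<epsilon> x \<odot> y) ` (carrier N \<times> carrier S) \<subseteq> carrier (add_monoid S)"
    using \<epsilon>'(1) by auto
  then obtain h where h: "h \<in> hom G (add_monoid S)"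
    and hf: "\<And>p. p \<in> carrier N \<times> carrier S \<Longrightarrow> h (frag_of p) = (\<lambda>(x, y). \<epsilon> x \<odot> y) p"
    by (rule comm_group.free_Abelian_group_universal[OF S.a_comm_group])
      (rule that, assumption, blast)
  have h_of: "h (frag_of (x, y)) = \<epsilon> x \<odot> y" if "x \<in> carrier N" "y \<in> carrier S" for x y
    using hf[of "(x, y)"] that by simp
  have h_closed: "h c \<in> carrier S" if "c \<in> carrier G" for c
    using hom_in_carrier[OF h that] by simp
  have h_add: "h (c + d) = h c \<oplus> h d" if "c \<in> carrier G" "d \<in> carrier G" for c d
    using hom_mult[OF h that] by simp
  interpret gh: group_hom G "add_monoid S" h
    using h by (intro group_hom.intro group_hom_axioms.intro group_free_Abelian_group S.add.is_group)
  have h_zero: "h 0 = \<zero>" using gh.hom_one by simp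
  have h_minus: "h (- c) = \<ominus> h c" if "c \<in> carrier G" for c
    using gh.hom_inv[OF that] that by (simp add: a_inv_def)
  have h_diff: "h (c - d) = h c \<ominus> h d" if "c \<in> carrier G" "d \<in> carrier G" for c d
    using h_add[of c "- d"] h_minus[OF that(2)] that by (simp add: S.minus_eq)
  have hK: "k \<in> carrier G \<and> h k = \<zero>" if "k \<in> K" for k
    using that
  proof (induction rule: K_induct)
    case (2 c)
    then have cG: "c \<in> carrier G" using relators_carrier by blast
    from 2 have "h c = \<zero>"
    proof (cases rule: relator_cases)
      case (1 x x' y)
      then have g: "frag_of (x \<oplus>\<^bsub>N\<^esub> x', y) \<in> carrier G" "frag_of (x, y) \<in> carrier G"
        "frag_of (x', y) \<in> carrier G" by simp_all
      have e: "\<epsilon> x \<in> carrier R" "\<epsilon> x' \<in> carrier R" using 1 \<epsilon>' by auto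
      then have s: "\<epsilon> x \<odot> y \<in> carrier S" "\<epsilon> x' \<odot> y \<in> carrier S" using 1 by auto
      have "h c = \<epsilon> (x \<oplus>\<^bsub>N\<^esub> x') \<odot> y \<ominus> \<epsilon> x \<odot> y \<ominus> \<epsilon> x' \<odot> y"
        using 1 g by (simp only: h_diff keys_diff_subset h_of M.a_closed)
      also have "\<dots> = (\<epsilon> x \<odot> y \<oplus> \<epsilon> x' \<odot> y) \<ominus> \<epsilon> x \<odot> y \<ominus> \<epsilon> x' \<odot> y"
        using 1 \<epsilon>' e by (simp add: SR.smult_l_distr)
      also have "\<dots> = \<zero>" using s by algebra
      finally show ?thesis .
    next
      case (2 x y y')
      then have g: "frag_of (x, y \<oplus> y') \<in> carrier G" "frag_of (x, y) \<in> carrier G"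
        "frag_of (x, y') \<in> carrier G" by simp_all
      have s: "\<epsilon> x \<odot> y \<in> carrier S" "\<epsilon> x \<odot> y' \<in> carrier S" using 2 \<epsilon>' by auto
      have "h c = \<epsilon> x \<odot> (y \<oplus> y') \<ominus> \<epsilon> x \<odot> y \<ominus> \<epsilon> x \<odot> y'"
        using 2 g by (simp only: h_diff keys_diff_subset h_of S.a_closed)
      also have "\<dots> = (\<epsilon> x \<odot> y \<oplus> \<epsilon> x \<odot> y') \<ominus> \<epsilon> x \<odot> y \<ominus> \<epsilon> x \<odot> y'"
        using 2 \<epsilon>' by (simp add: SR.smult_r_distr)
      also have "\<dots> = \<zero>" using s by algebra
      finally show ?thesis .
    next
      case (3 r x y)
      then have g: "frag_of (r \<odot>\<^bsub>N\<^esub> x, y) \<in> carrier G" "frag_of (x, r \<odot> y) \<in> carrier G" by simp_all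
      have s: "\<epsilon> x \<odot> y \<in> carrier S" using 3 \<epsilon>' by auto
      have "h c = \<epsilon> (r \<odot>\<^bsub>N\<^esub> x) \<odot> y \<ominus> \<epsilon> x \<odot> (r \<odot> y)"
        using 3 g by (simp only: h_diff h_of smult_closed SR.smult_closed)
      also have "\<epsilon> (r \<odot>\<^bsub>N\<^esub> x) \<odot> y = \<epsilon> x \<odot> (r \<odot> y)"
        using 3 \<epsilon>' by (simp add: SR.R.m_comm flip: SR.smult_assoc1)
      finally show ?thesis using 3 \<epsilon>' by (simp add: S.minus_eq S.r_neg)
    qed
    then show ?case using cG by simp
  next
    case (3 c)
    then show ?case using h_minus by simp
  next
    case (4 c d)
    then show ?case using h_add keys_add_subset by (simp del: carrier_free_Abelian_group_iff)
  qed (simp_all add: h_zero)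
  \<comment> \<open>The representative is a matter of choice, but the value is not, because
    \<open>h\<close> vanishes on \<open>K\<close>.\<close>
  define \<kappa> where "\<kappa> u = h (SOME c. c \<in> carrier G \<and> cls c = u)" for u
  have \<kappa>: "\<kappa> (cls c) = h c" if c: "c \<in> carrier G" for c
  proof -
    define d where "d = (SOME d. d \<in> carrier G \<and> cls d = cls c)"
    have d: "d \<in> carrier G \<and> cls d = cls c" unfolding d_def
      by (rule someI[of _ c]) (rule conjI[OF c refl])
    then have "d - c \<in> K" by (simp add: cls_eq_iff)
    then have "h (d - c) = \<zero>" using hK by blast
    then have "h d \<ominus> h c = \<zero>" by (simp only: h_diff[OF conjunct1[OF d] c])
    then have "h d = h c" using h_closed d c by simp
    then show ?thesis by (simp add: \<kappa>_def d_def)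
  qed
  have h_scale: "h (scale s c) = s \<otimes> h c" if s: "s \<in> carrier S" and c: "c \<in> carrier G" for s c
    using c
  proof (induction rule: scale_induct)
    case (diff c d)
    have "h (scale s (c - d)) = s \<otimes> h c \<ominus> s \<otimes> h d"
      using diff h_diff[OF scale_carrier[OF s diff.hyps(1)] scale_carrier[OF s diff.hyps(2)]]
      by (simp only: scale_diff)
    also have "\<dots> = s \<otimes> (h c \<ominus> h d)" using s h_closed[OF diff.hyps(1)] h_closed[OF diff.hyps(2)] by algebra
    finally show ?case using h_diff diff by simp
  next
    case (single x y)
    then show ?case using s \<epsilon>' by (simp add: h_of smult_mult_right)
  qed (simp add: h_zero s)
  show thesis
  proof (rule that[of \<kappa>])
    show "E.linear_form \<kappa>"
    proof (rule E.linear_formI)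
      fix u assume "u \<in> carrier E"
      then obtain c where c: "c \<in> carrier G" "u = cls c" by (auto simp only: E_carrier)
      show "\<kappa> u \<in> carrier S" using \<kappa>[OF c(1)] h_closed[OF c(1)] c(2) by simp
      fix v assume "v \<in> carrier E"
      then obtain d where d: "d \<in> carrier G" "v = cls d" by (auto simp only: E_carrier)
      show "\<kappa> (u \<oplus>\<^bsub>E\<^esub> v) = \<kappa> u \<oplus> \<kappa> v"
        unfolding c(2) d(2) E_add \<kappa>[OF c(1)] \<kappa>[OF d(1)] \<kappa>[OF keys_add_subset[OF c(1) d(1)]]
        by (rule h_add[OF c(1) d(1)])
    next
      fix s u assume s: "s \<in> carrier S" and "u \<in> carrier E"
      then obtain c where c: "c \<in> carrier G" "u = cls c" by (auto simp only: E_carrier)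
      show "\<kappa> (s \<odot>\<^bsub>E\<^esub> u) = s \<otimes> \<kappa> u"
        unfolding c(2) E_smult[OF s] \<kappa>[OF c(1)] \<kappa>[OF scale_carrier[OF s c(1)]] by (rule h_scale[OF s c(1)])
    qed
    show "\<kappa> (tensor x y) = \<epsilon> x \<odot> y" if "x \<in> carrier N" "y \<in> carrier S" for x y
      unfolding tensor_def \<kappa>[OF frag_of_carrier[OF that]] by (rule h_of[OF that])
  qed
qed

text \<open>Where \<open>T\<close> has the inverse \<open>v\<close>, the tensors of the elements of
  \<open>C\<close> with \<open>\<one>\<close> form a basis, and \<open>v\<close> times the extended
  forms are its coordinates.\<close>

lemma base_change_rank:
  assumes C: "finite C" "C \<subseteq> carrier N"
    and T: "T \<in> carrier R" "v \<in> carrier S" "T \<odot> v = \<one>" and nontrivial: "\<one> \<noteq> \<zero>"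
    and "scaled_dual_basis T C \<epsilon>"
  shows "free_rank S E = card C"
proof -
  note lf = scaled_dual_basisD(1)[OF assms(7)] and \<epsilon> = scaled_dual_basisD(2)[OF assms(7)]
    and dual = scaled_dual_basisD(3)[OF assms(7)]
  have cN [simp]: "c \<in> carrier N" if "c \<in> C" for c using that C by auto
  note \<epsilon>' = linear_formD[OF lf]
  have "\<exists>\<kappa>. E.linear_form \<kappa> \<and> (\<forall>x\<in>carrier N. \<forall>y\<in>carrier S. \<kappa> (tensor x y) = \<epsilon> c x \<odot> y)"
    if "c \<in> C" for c using linear_form_extension[OF lf[OF that]] by metis
  then obtain \<kappa> where \<kappa>: "\<And>c. c \<in> C \<Longrightarrow> E.linear_form (\<kappa> c)"
    "\<And>c x y. \<lbrakk>c \<in> C; x \<in> carrier N; y \<in> carrier S\<rbrakk> \<Longrightarrow> \<kappa> c (tensor x y) = \<epsilon> c x \<odot> y" by metis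
  note \<kappa>' = E.linear_formD[OF \<kappa>(1)]
  let ?e = "\<lambda>c. tensor c \<one>"
  let ?f = "\<lambda>c u. v \<otimes> \<kappa> c u"
  have flf: "E.linear_form (?f c)" if c: "c \<in> C" for c
    by (rule E.linear_formI)
      (use T \<kappa>'[OF c] in \<open>auto simp: S.r_distr S.m_lcomm\<close>)
  have f_delta: "?f c (?e d) = (if c = d then \<one> else \<zero>)" if c: "c \<in> C" "d \<in> C" for c d
  proof -
    have "v \<otimes> (T \<odot> \<one>) = \<one>" using T smult_mult_right[of T v \<one>] by simp
    then show ?thesis using \<kappa>(2)[OF c(1) cN[OF c(2)] S.one_closed] \<epsilon>[OF c] T by simp
  qed
  \<comment> \<open>The rank counts tensors, so different elements of \<open>C\<close> must give
    different ones; a coordinate separates them because \<open>S\<close> is not the zero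
    ring.\<close>
  have inj: "inj_on ?e C"
  proof (rule inj_onI)
    fix c d assume cd: "c \<in> C" "d \<in> C" "?e c = ?e d"
    then have "?f c (?e d) = \<one>" using f_delta[OF cd(1,1)] by simp
    then show "c = d" using f_delta[OF cd(1,2)] nontrivial by (auto split: if_splits)
  qed
  have span: "u = (\<Oplus>\<^bsub>E\<^esub>c\<in>C. ?f c u \<odot>\<^bsub>E\<^esub> ?e c)" if u: "u \<in> carrier E" for u
  proof -
    obtain c where c: "c \<in> carrier G" "u = cls c" using u by (auto simp only: E_carrier)
    let ?s = "\<lambda>u. \<Oplus>\<^bsub>E\<^esub>c\<in>C. ?f c u \<odot>\<^bsub>E\<^esub> ?e c"
    have fE: "?f c u \<odot>\<^bsub>E\<^esub> ?e c \<in> carrier E" if "c \<in> C" "u \<in> carrier E" for c u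
      using that T \<kappa>'(1)[OF that] by simp
    have s_add: "?s (u \<oplus>\<^bsub>E\<^esub> w) = ?s u \<oplus>\<^bsub>E\<^esub> ?s w" if uw: "u \<in> carrier E" "w \<in> carrier E" for u w
    proof -
      have "?s (u \<oplus>\<^bsub>E\<^esub> w) = (\<Oplus>\<^bsub>E\<^esub>c\<in>C. ?f c u \<odot>\<^bsub>E\<^esub> ?e c \<oplus>\<^bsub>E\<^esub> ?f c w \<odot>\<^bsub>E\<^esub> ?e c)"
        using uw T \<kappa>' by (intro E.M.finsum_cong') (auto simp: S.r_distr E.smult_l_distr)
      also have "\<dots> = ?s u \<oplus>\<^bsub>E\<^esub> ?s w" using fE uw by (intro E.M.finsum_addf) auto
      finally show ?thesis .
    qed
    have s_closed: "?s u \<in> carrier E" if "u \<in> carrier E" for u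
      using fE that by (intro E.M.finsum_closed) auto
    have s_zero: "?s \<zero>\<^bsub>E\<^esub> = \<zero>\<^bsub>E\<^esub>"
      using E.linear_form_zero[OF \<kappa>(1)] T by (intro E.M.add.finprod_one_eqI) auto
    have "cls c = ?s (cls c)" using c(1)
    proof (induction rule: scale_induct)
      case zero
      show ?case using s_zero by (simp add: E_zero)
    next
      case (diff c d)
      have cd: "cls c \<in> carrier E" "cls d \<in> carrier E" "cls (c - d) \<in> carrier E"
        using diff.hyps by (auto intro!: cls_closed keys_diff_subset simp del: carrier_free_Abelian_group_iff)
      have e: "cls (c - d) \<oplus>\<^bsub>E\<^esub> cls d = cls c" by (simp add: E_add)
      have "?s (cls (c - d)) \<oplus>\<^bsub>E\<^esub> cls d = ?s (cls (c - d)) \<oplus>\<^bsub>E\<^esub> ?s (cls d)"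
        using diff.IH by simp
      also have "\<dots> = ?s (cls c)" using s_add[OF cd(3,2)] e by simp
      also have "\<dots> = cls (c - d) \<oplus>\<^bsub>E\<^esub> cls d" using diff.IH e by simp
      finally have "?s (cls (c - d)) \<oplus>\<^bsub>E\<^esub> cls d = cls (c - d) \<oplus>\<^bsub>E\<^esub> cls d" .
      then show ?case using E.M.add.right_cancel[OF cd(2) s_closed[OF cd(3)] cd(3)] by simp
    next
      case (single x y)
      have vy: "v \<otimes> y \<in> carrier S" using T single by simp
      \<comment> \<open>Inserting \<open>T \<odot> v = \<one>\<close> and balancing moves
        \<open>T\<close> to the left factor, where the scaled dual basis expands
        \<open>T x\<close>.\<close>
      have "tensor x y = tensor x (T \<odot> (v \<otimes> y))"
        using T single by (simp flip: smult_mult)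
      also have "\<dots> = tensor (T \<odot>\<^bsub>N\<^esub> x) (v \<otimes> y)" using T single vy by (simp add: tensor_balanced)
      also have "\<dots> = (\<Oplus>\<^bsub>E\<^esub>c\<in>C. tensor (\<epsilon> c x \<odot>\<^bsub>N\<^esub> c) (v \<otimes> y))"
        unfolding dual[OF single(1)] using single \<epsilon>' vy by (intro tensor_finsum_left C) auto
      also have "\<dots> = ?s (tensor x y)"
      proof (rule E.M.finsum_cong')
        fix c assume c: "c \<in> C"
        have e: "\<epsilon> c x \<in> carrier R" using c single \<epsilon>' by blast
        have "tensor (\<epsilon> c x \<odot>\<^bsub>N\<^esub> c) (v \<otimes> y) = tensor c (\<epsilon> c x \<odot> (v \<otimes> y))"
          using c e vy by (simp add: tensor_balanced)
        also have "\<epsilon> c x \<odot> (v \<otimes> y) = v \<otimes> (\<epsilon> c x \<odot> y)" using e T single by (simp add: smult_mult_right)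
        also have "tensor c \<dots> = ?f c (tensor x y) \<odot>\<^bsub>E\<^esub> ?e c"
          using c e T single \<kappa>(2)[OF c] by (simp add: tensor_smult)
        finally show "tensor (\<epsilon> c x \<odot>\<^bsub>N\<^esub> c) (v \<otimes> y) = ?f c (tensor x y) \<odot>\<^bsub>E\<^esub> ?e c" .
      qed (use fE single in auto)
      finally show ?case by (simp add: tensor_def)
    qed
    then show ?thesis using c by simp
  qed
  let ?g = "\<lambda>b. ?f (inv_into C ?e b)"
  have g: "inv_into C ?e (?e c) = c" if "c \<in> C" for c by (rule inv_into_f_f[OF inj that])
  have "E.coordinates (?e ` C) ?g"
    unfolding E.coordinates_def
  proof (intro conjI ballI)
    show "finite (?e ` C)" "?e ` C \<subseteq> carrier E" using C by auto
    show "E.linear_form (?g b)" if "b \<in> ?e ` C" for b using that g flf by auto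
    show "?g b b' = (if b = b' then \<one> else \<zero>)" if "b \<in> ?e ` C" "b' \<in> ?e ` C" for b b'
    proof -
      obtain c d where cd: "b = ?e c" "b' = ?e d" "c \<in> C" "d \<in> C" using \<open>b \<in> ?e ` C\<close> \<open>b' \<in> ?e ` C\<close> by blast
      have "?e c = ?e d \<longleftrightarrow> c = d" using inj cd by (auto dest: inj_onD)
      then show ?thesis unfolding cd(1,2) g[OF cd(3)] using f_delta[OF cd(3,4)] by simp
    qed
    fix u assume u: "u \<in> carrier E"
    have "(\<Oplus>\<^bsub>E\<^esub>b\<in>?e ` C. ?g b u \<odot>\<^bsub>E\<^esub> b) = (\<Oplus>\<^bsub>E\<^esub>c\<in>C. ?g (?e c) u \<odot>\<^bsub>E\<^esub> ?e c)"
      using g u T \<kappa>'(1) by (intro E.M.finsum_reindex inj) auto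
    also have "\<dots> = (\<Oplus>\<^bsub>E\<^esub>c\<in>C. ?f c u \<odot>\<^bsub>E\<^esub> ?e c)"
      using g u T \<kappa>'(1) by (intro E.M.finsum_cong') auto
    finally show "u = (\<Oplus>\<^bsub>E\<^esub>b\<in>?e ` C. ?g b u \<odot>\<^bsub>E\<^esub> b)" using span[OF u] by simp
  qed
  then have "finite_basis S E (?e ` C)" by (rule E.coordinates_finite_basis)
  then have "free_rank S E = card (?e ` C)" by (rule E.free_rank_eq[OF nontrivial])
  then show ?thesis using card_image[OF inj] by simp
qed

end

text \<open>The denominator of the dual basis attached to \<open>C\<close> lies outside
  \<open>\<mm>\<close>, so it becomes invertible in the local ring and
  \<open>base_change_rank\<close> applies.\<close>

lemma (in azumaya_at) local_rank_eq:
  assumes C: "dual_system C h" "mspan C = carrier A"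
  shows "local_rank R \<mm> A = card C"
proof -
  note C' = dual_systemD[OF C(1)]
  obtain T \<epsilon> where T: "T \<in> carrier R" "T \<notin> \<mm>" "scaled_dual_basis T C \<epsilon>"
    by (rule dual_basis[OF C])
  interpret D: denominators R "carrier R - \<mm>"
  proof
    show "\<one>\<^bsub>R\<^esub> \<in> carrier R - \<mm>" using R.maximalideal_one_notin[OF maximal] by simp
    show "s \<otimes>\<^bsub>R\<^esub> t \<in> carrier R - \<mm>" if "s \<in> carrier R - \<mm>" "t \<in> carrier R - \<mm>" for s t
      using that R.maximalideal_mult_notin[OF maximal] by auto
  qed blast
  interpret LR: module R D.L by (rule D.loc_module)
  interpret L: cring D.L by (rule D.loc_cring)
  interpret X: scalar_extension D.L R A
    by unfold_locales (rule D.loc_smult_mult)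
  have "free_rank D.L (base_change R A D.L) = card C"
    using X.base_change_rank[OF C'(1,2) T(1) _ D.loc_inverse D.loc_nontrivial T(3)] T(1,2)
    by auto
  then show ?thesis by (simp add: local_rank_def local_ring_at_def)
qed

section \<open>Homomorphisms inducing an isomorphism of centers\<close>

lemma azumaya_algebra_azumaya:
  assumes "azumaya_algebra R A" shows "azumaya A R"
proof -
  interpret azumaya_algebra R A by fact
  show ?thesis
    by (intro azumaya.intro assms R.cring_axioms) (rule ring_axioms)
qed

lemma (in module) submodule_lincomb:
  assumes H: "submodule H R M" and D: "finite D" "D \<subseteq> H" "x \<in> D \<rightarrow> carrier R"
  shows "(\<Oplus>\<^bsub>M\<^esub>d\<in>D. x d \<odot>\<^bsub>M\<^esub> d) \<in> H"
  using D
proof (induction D)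
  case empty
  then show ?case using submodule_facts(2)[OF H] by simp
next
  case (insert d D)
  note H' = submodule_facts[OF H]
  have c: "d \<in> H" "x d \<in> carrier R" "\<And>e. e \<in> D \<Longrightarrow> e \<in> carrier M" "\<And>e. e \<in> D \<Longrightarrow> x e \<in> carrier R"
    "d \<in> carrier M"
    using insert.prems H'(1) by auto
  have "(\<Oplus>\<^bsub>M\<^esub>d\<in>insert d D. x d \<odot>\<^bsub>M\<^esub> d) = x d \<odot>\<^bsub>M\<^esub> d \<oplus>\<^bsub>M\<^esub> (\<Oplus>\<^bsub>M\<^esub>d\<in>D. x d \<odot>\<^bsub>M\<^esub> d)"
    using insert.hyps c by (intro M.finsum_insert) auto
  then show ?case using insert c H'(3,4) by simp
qed

text \<open>Surjectivity carries central elements to central elements; injectivity reflects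
  centrality.\<close>

lemma ring_iso_center:
  assumes A: "ring A" and iso: "\<phi> \<in> ring_iso A A'"
  shows "\<phi> \<in> ring_iso (center_ring A) (center_ring A')"
proof -
  have hom: "\<phi> \<in> ring_hom A A'" and bij: "bij_betw \<phi> (carrier A) (carrier A')"
    using iso by (auto simp: ring_iso_def)
  have img: "\<phi> ` carrier A = carrier A'" and inj: "inj_on \<phi> (carrier A)"
    using bij by (auto simp: bij_betw_def)
  have sub: "center A \<subseteq> carrier A" "center A' \<subseteq> carrier A'" by (auto simp: center_def)
  have iff: "\<phi> z \<in> center A' \<longleftrightarrow> z \<in> center A" if z: "z \<in> carrier A" for z
  proof
    assume c: "z \<in> center A"
    have "\<phi> z \<otimes>\<^bsub>A'\<^esub> b = b \<otimes>\<^bsub>A'\<^esub> \<phi> z" if "b \<in> carrier A'" for b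
    proof -
      obtain a where a: "a \<in> carrier A" "b = \<phi> a" using \<open>b \<in> carrier A'\<close> unfolding img[symmetric] by (rule imageE)
      have "\<phi> (z \<otimes>\<^bsub>A\<^esub> a) = \<phi> (a \<otimes>\<^bsub>A\<^esub> z)" using c a by (simp add: center_def)
      then show ?thesis using ring_hom_mult[OF hom z a(1)] ring_hom_mult[OF hom a(1) z] a(2) by simp
    qed
    then show "\<phi> z \<in> center A'" using ring_hom_closed[OF hom z] by (simp add: center_def)
  next
    assume c: "\<phi> z \<in> center A'"
    have "z \<otimes>\<^bsub>A\<^esub> a = a \<otimes>\<^bsub>A\<^esub> z" if a: "a \<in> carrier A" for a
    proof (rule inj_onD[OF inj])
      show "\<phi> (z \<otimes>\<^bsub>A\<^esub> a) = \<phi> (a \<otimes>\<^bsub>A\<^esub> z)"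
        using c a z ring_hom_mult[OF hom] ring_hom_closed[OF hom a] by (simp add: center_def)
    qed (use a z A ring.is_monoid monoid.m_closed in fast)+
    then show "z \<in> center A" using z by (simp add: center_def)
  qed
  have "\<phi> ` center A = center A'"
  proof
    show "\<phi> ` center A \<subseteq> center A'" using iff sub(1) by blast
    show "center A' \<subseteq> \<phi> ` center A"
    proof
      fix w assume w: "w \<in> center A'"
      then obtain z where "z \<in> carrier A" "w = \<phi> z" using img sub(2) by blast
      then show "w \<in> \<phi> ` center A" using iff w by blast
    qed
  qed
  moreover have "inj_on \<phi> (center A)" using inj sub(1) by (rule inj_on_subset)
  moreover have cA: "z \<in> carrier A" and \<phi>c: "\<phi> z \<in> center A'" if "z \<in> center A" for z
    using that sub(1) iff by auto
  then have "\<phi> \<in> ring_hom (center_ring A) (center_ring A')"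
    using hom cA \<phi>c by (auto simp: ring_hom_def center_ring_def)
  ultimately show ?thesis by (auto simp: ring_iso_def bij_betw_def center_ring_def)
qed

section \<open>The map induced on the base rings\<close>

locale azumaya_center_iso = dom: azumaya A R + cod: azumaya A' R'
  for A :: "('r, 'a, 'q) module_scheme" and R :: "('r, 'p) ring_scheme"
    and A' :: "('r2, 'a2, 'q2) module_scheme" and R' :: "('r2, 'p2) ring_scheme" +
  fixes \<phi>
  assumes hom: "\<phi> \<in> ring_hom A A'"
    and center_iso: "\<phi> \<in> ring_iso (center_ring A) (center_ring A')"
begin

sublocale hom: ring_hom_ring A A' \<phi>
  by (rule ring_hom_ringI2[OF dom.A.ring_axioms cod.A.ring_axioms hom])

text \<open>The isomorphism of centers, read on the base rings through their copies
  \<open>R \<one>\<close> and \<open>R' \<one>\<close>. It takes the place of linearity: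
  \<open>\<phi>\<close> is semilinear along it.\<close>

definition \<sigma> :: "'r \<Rightarrow> 'r2" where
  "\<sigma> r = (SOME r'. r' \<in> carrier R' \<and> \<phi> (r \<odot>\<^bsub>A\<^esub> \<one>\<^bsub>A\<^esub>) = r' \<odot>\<^bsub>A'\<^esub> \<one>\<^bsub>A'\<^esub>)"

lemma center_bij: "bij_betw \<phi> dom.scalars cod.scalars"
  using center_iso dom.center_eq cod.center_eq by (simp add: ring_iso_def center_ring_def)

lemma \<sigma>:
  assumes "r \<in> carrier R"
  shows "\<sigma> r \<in> carrier R'" "\<phi> (r \<odot>\<^bsub>A\<^esub> \<one>\<^bsub>A\<^esub>) = \<sigma> r \<odot>\<^bsub>A'\<^esub> \<one>\<^bsub>A'\<^esub>"
proof -
  have "\<phi> (r \<odot>\<^bsub>A\<^esub> \<one>\<^bsub>A\<^esub>) \<in> cod.scalars"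
    using center_bij dom.scalarsI[OF assms] by (auto simp: bij_betw_def)
  then have "\<exists>r'. r' \<in> carrier R' \<and> \<phi> (r \<odot>\<^bsub>A\<^esub> \<one>\<^bsub>A\<^esub>) = r' \<odot>\<^bsub>A'\<^esub> \<one>\<^bsub>A'\<^esub>"
    by (auto simp: cod.scalars_def)
  from someI_ex[OF this] show "\<sigma> r \<in> carrier R'" "\<phi> (r \<odot>\<^bsub>A\<^esub> \<one>\<^bsub>A\<^esub>) = \<sigma> r \<odot>\<^bsub>A'\<^esub> \<one>\<^bsub>A'\<^esub>"
    by (simp_all add: \<sigma>_def)
qed

lemma \<sigma>_unique:
  assumes "r \<in> carrier R" "r' \<in> carrier R'" "\<phi> (r \<odot>\<^bsub>A\<^esub> \<one>\<^bsub>A\<^esub>) = r' \<odot>\<^bsub>A'\<^esub> \<one>\<^bsub>A'\<^esub>"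
  shows "\<sigma> r = r'"
  using cod.smult_one_inj[OF \<sigma>(1)[OF assms(1)] assms(2)] \<sigma>(2)[OF assms(1)] assms(3) by simp

lemma \<phi>_smult:
  assumes "r \<in> carrier R" "a \<in> carrier A"
  shows "\<phi> (r \<odot>\<^bsub>A\<^esub> a) = \<sigma> r \<odot>\<^bsub>A'\<^esub> \<phi> a"
proof -
  have "\<phi> (r \<odot>\<^bsub>A\<^esub> a) = \<phi> ((r \<odot>\<^bsub>A\<^esub> \<one>\<^bsub>A\<^esub>) \<otimes>\<^bsub>A\<^esub> a)"
    using assms by (simp add: dom.smult_mult_one)
  also have "\<dots> = (\<sigma> r \<odot>\<^bsub>A'\<^esub> \<one>\<^bsub>A'\<^esub>) \<otimes>\<^bsub>A'\<^esub> \<phi> a"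
    using assms \<sigma>(2)[OF assms(1)] by simp
  finally show ?thesis using assms \<sigma>(1) by (simp add: cod.smult_mult_one)
qed

lemma \<sigma>_hom: "\<sigma> \<in> ring_hom R R'"
proof (rule ring_hom_memI)
  show "\<sigma> r \<in> carrier R'" if "r \<in> carrier R" for r by (rule \<sigma>(1)[OF that])
  show "\<sigma> \<one>\<^bsub>R\<^esub> = \<one>\<^bsub>R'\<^esub>" by (rule \<sigma>_unique) auto
  fix r s assume rs: "r \<in> carrier R" "s \<in> carrier R"
  show "\<sigma> (r \<otimes>\<^bsub>R\<^esub> s) = \<sigma> r \<otimes>\<^bsub>R'\<^esub> \<sigma> s"
    using rs \<sigma> by (intro \<sigma>_unique) (auto simp: dom.smult_assoc1 cod.smult_assoc1 \<phi>_smult)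
  show "\<sigma> (r \<oplus>\<^bsub>R\<^esub> s) = \<sigma> r \<oplus>\<^bsub>R'\<^esub> \<sigma> s"
    using rs \<sigma> by (intro \<sigma>_unique) (auto simp: dom.smult_l_distr cod.smult_l_distr)
qed

sublocale \<sigma>: ring_hom_ring R R' \<sigma>
  by (rule ring_hom_ringI2[OF dom.R.ring_axioms cod.R.ring_axioms \<sigma>_hom])

lemma \<sigma>_inj: "inj_on \<sigma> (carrier R)"
proof (rule inj_onI)
  fix r s assume rs: "r \<in> carrier R" "s \<in> carrier R" "\<sigma> r = \<sigma> s"
  then have "\<phi> (r \<odot>\<^bsub>A\<^esub> \<one>\<^bsub>A\<^esub>) = \<phi> (s \<odot>\<^bsub>A\<^esub> \<one>\<^bsub>A\<^esub>)" using \<sigma>(2) by simp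
  then have "r \<odot>\<^bsub>A\<^esub> \<one>\<^bsub>A\<^esub> = s \<odot>\<^bsub>A\<^esub> \<one>\<^bsub>A\<^esub>"
    using center_bij rs dom.scalarsI by (auto simp: bij_betw_def dest: inj_onD)
  then show "r = s" using rs dom.smult_one_inj by blast
qed

lemma \<sigma>_surj:
  assumes "r' \<in> carrier R'" obtains r where "r \<in> carrier R" "\<sigma> r = r'"
proof -
  have "r' \<odot>\<^bsub>A'\<^esub> \<one>\<^bsub>A'\<^esub> \<in> \<phi> ` dom.scalars"
    using center_bij cod.scalarsI[OF assms] by (auto simp: bij_betw_def)
  then obtain r where "r \<in> carrier R" "\<phi> (r \<odot>\<^bsub>A\<^esub> \<one>\<^bsub>A\<^esub>) = r' \<odot>\<^bsub>A'\<^esub> \<one>\<^bsub>A'\<^esub>"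
    by (auto simp: dom.scalars_def)
  then show thesis using that \<sigma>_unique assms by blast
qed

lemma corresponding_ideal_eq:
  assumes "\<mm> \<subseteq> carrier R"
  shows "corresponding_ideal A R' A' \<phi> \<mm> = \<sigma> ` \<mm>"
  unfolding corresponding_ideal_def
proof (intro equalityI subsetI)
  fix r' assume "r' \<in> {r' \<in> carrier R'. \<exists>r\<in>\<mm>. \<phi> (r \<odot>\<^bsub>A\<^esub> \<one>\<^bsub>A\<^esub>) = r' \<odot>\<^bsub>A'\<^esub> \<one>\<^bsub>A'\<^esub>}"
  then show "r' \<in> \<sigma> ` \<mm>" using \<sigma>_unique assms by blast
next
  fix r' assume "r' \<in> \<sigma> ` \<mm>"
  then show "r' \<in> {r' \<in> carrier R'. \<exists>r\<in>\<mm>. \<phi> (r \<odot>\<^bsub>A\<^esub> \<one>\<^bsub>A\<^esub>) = r' \<odot>\<^bsub>A'\<^esub> \<one>\<^bsub>A'\<^esub>}"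
    using \<sigma> assms by blast
qed

lemma maximalideal_image:
  assumes m: "maximalideal \<mm> R"
  shows "maximalideal (\<sigma> ` \<mm>) R'"
proof -
  interpret m: maximalideal \<mm> R by fact
  have c: "r \<in> \<mm> \<Longrightarrow> r \<in> carrier R" for r by (rule m.Icarr)
  have mem: "\<sigma> r \<in> \<sigma> ` \<mm> \<longleftrightarrow> r \<in> \<mm>" if "r \<in> carrier R" for r
    using \<sigma>_inj that c by (auto dest: inj_onD)
  have I: "ideal (\<sigma> ` \<mm>) R'"
  proof (rule idealI[OF cod.R.ring_axioms cod.R.add.subgroupI])
    show "\<sigma> ` \<mm> \<subseteq> carrier R'" using c \<sigma>(1) by auto
    show "\<sigma> ` \<mm> \<noteq> {}" using m.zero_closed by blast
    fix a assume "a \<in> \<sigma> ` \<mm>"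
    then obtain r where r: "r \<in> \<mm>" "a = \<sigma> r" by blast
    then have e: "\<ominus>\<^bsub>R'\<^esub> a = \<sigma> (\<ominus>\<^bsub>R\<^esub> r)" using c by simp
    show "\<ominus>\<^bsub>R'\<^esub> a \<in> \<sigma> ` \<mm>" unfolding e by (rule imageI[OF m.a_inv_closed[OF r(1)]])
    fix b assume "b \<in> \<sigma> ` \<mm>"
    then obtain s where s: "s \<in> \<mm>" "b = \<sigma> s" by blast
    then have e: "a \<oplus>\<^bsub>R'\<^esub> b = \<sigma> (r \<oplus>\<^bsub>R\<^esub> s)" using r c by simp
    show "a \<oplus>\<^bsub>R'\<^esub> b \<in> \<sigma> ` \<mm>" unfolding e by (rule imageI[OF m.a_closed[OF r(1) s(1)]])
  next
    fix a x assume "a \<in> \<sigma> ` \<mm>" and x: "x \<in> carrier R'"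
    then obtain r s where r: "r \<in> \<mm>" "a = \<sigma> r" "s \<in> carrier R" "x = \<sigma> s" using \<sigma>_surj[OF x] by blast
    have e: "x \<otimes>\<^bsub>R'\<^esub> a = \<sigma> (s \<otimes>\<^bsub>R\<^esub> r)" "a \<otimes>\<^bsub>R'\<^esub> x = \<sigma> (r \<otimes>\<^bsub>R\<^esub> s)" using r c by simp_all
    show "x \<otimes>\<^bsub>R'\<^esub> a \<in> \<sigma> ` \<mm>" unfolding e by (rule imageI[OF m.I_l_closed[OF r(1,3)]])
    show "a \<otimes>\<^bsub>R'\<^esub> x \<in> \<sigma> ` \<mm>" unfolding e by (rule imageI[OF m.I_r_closed[OF r(1,3)]])
  qed
  show ?thesis
  proof (rule maximalidealI[OF I])
    have "\<one>\<^bsub>R\<^esub> \<notin> \<mm>" by (rule dom.R.maximalideal_one_notin[OF m])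
    then have "\<one>\<^bsub>R'\<^esub> \<notin> \<sigma> ` \<mm>" using mem[of "\<one>\<^bsub>R\<^esub>"] by simp
    then show "carrier R' \<noteq> \<sigma> ` \<mm>" by auto
    fix J assume J: "ideal J R'" "\<sigma> ` \<mm> \<subseteq> J" "J \<subseteq> carrier R'"
    have "ideal {r \<in> carrier R. \<sigma> r \<in> J} R" by (rule \<sigma>.ideal_vimage[OF J(1)])
    moreover have "\<mm> \<subseteq> {r \<in> carrier R. \<sigma> r \<in> J}" using J(2) c by blast
    ultimately have "{r \<in> carrier R. \<sigma> r \<in> J} = \<mm> \<or> {r \<in> carrier R. \<sigma> r \<in> J} = carrier R"
      by (intro m.I_maximal) auto
    moreover have "\<sigma> ` {r \<in> carrier R. \<sigma> r \<in> J} = J"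
    proof
      show "J \<subseteq> \<sigma> ` {r \<in> carrier R. \<sigma> r \<in> J}"
      proof
        fix j assume j: "j \<in> J"
        then obtain r where "r \<in> carrier R" "\<sigma> r = j" using J(3) by (blast intro: \<sigma>_surj)
        then show "j \<in> \<sigma> ` {r \<in> carrier R. \<sigma> r \<in> J}" using j by blast
      qed
    qed blast
    moreover have "\<sigma> ` carrier R = carrier R'"
    proof
      show "carrier R' \<subseteq> \<sigma> ` carrier R" by (blast intro: \<sigma>_surj)
    qed (use \<sigma>(1) in blast)
    ultimately show "J = \<sigma> ` \<mm> \<or> J = carrier R'" by auto
  qed
qed

text \<open>The image is closed under scalars from \<open>R'\<close> because \<open>\<sigma>\<close>
  is onto.\<close>

lemma \<phi>_image_submodule: "submodule (\<phi> ` carrier A) R' A'"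
proof (rule cod.submoduleI')
  show "\<zero>\<^bsub>A'\<^esub> \<in> \<phi> ` carrier A" by (rule image_eqI[of _ _ "\<zero>\<^bsub>A\<^esub>"]) auto
  show "a \<oplus>\<^bsub>A'\<^esub> b \<in> \<phi> ` carrier A" if "a \<in> \<phi> ` carrier A" "b \<in> \<phi> ` carrier A" for a b
  proof -
    obtain x y where "x \<in> carrier A" "y \<in> carrier A" "a = \<phi> x" "b = \<phi> y" using \<open>a \<in> _\<close> \<open>b \<in> _\<close> by blast
    then show ?thesis by (intro image_eqI[of _ _ "x \<oplus>\<^bsub>A\<^esub> y"]) auto
  qed
  show "r \<odot>\<^bsub>A'\<^esub> a \<in> \<phi> ` carrier A" if "r \<in> carrier R'" "a \<in> \<phi> ` carrier A" for r a
  proof -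
    obtain s x where "s \<in> carrier R" "r = \<sigma> s" "x \<in> carrier A" "a = \<phi> x"
      using \<open>a \<in> _\<close> \<sigma>_surj[OF \<open>r \<in> _\<close>] by blast
    then show ?thesis by (intro image_eqI[of _ _ "s \<odot>\<^bsub>A\<^esub> x"]) (auto simp: \<phi>_smult)
  qed
qed auto

text \<open>The factors \<open>u\<close> and \<open>v\<close> of each summand are replaced by their
  images under \<open>\<phi>\<close>. The resulting map may depend on the presentation of
  \<open>f\<close>, so only existence is claimed.\<close>

lemma mult_map_transport:
  assumes "f \<in> mult_maps A"
  shows "\<exists>f'\<in>mult_maps A'. \<forall>a\<in>carrier A. f' (\<phi> a) = \<phi> (f a)"
  using assms
proof induction
  case (single u v)
  then show ?case
    by (intro bexI[OF _ mult_maps.single[of "\<phi> u" A' "\<phi> v"]]) auto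
next
  case (sum f g)
  then obtain f' g' where "f' \<in> mult_maps A'" "\<forall>a\<in>carrier A. f' (\<phi> a) = \<phi> (f a)"
    "g' \<in> mult_maps A'" "\<forall>a\<in>carrier A. g' (\<phi> a) = \<phi> (g a)" by blast
  then show ?case using sum.hyps
    by (intro bexI[OF _ mult_maps.sum[of f' A' g']]) auto
qed

end

section \<open>Comparison of the two algebras at one maximal ideal\<close>

locale azumaya_center_iso_at = azumaya_center_iso A R A' R' \<phi> + P: azumaya_at A R \<mm>
  for A :: "('r, 'a, 'q) module_scheme" and R :: "('r, 'p) ring_scheme"
    and A' :: "('r2, 'a2, 'q2) module_scheme" and R' :: "('r2, 'p2) ring_scheme"
    and \<phi> and \<mm>
begin

sublocale Q: azumaya_at A' R' "\<sigma> ` \<mm>"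
  by (rule cod.azumaya_at[OF maximalideal_image[OF P.maximal]])

lemma submodule_vimage:
  assumes "submodule H R' A'" shows "submodule {a \<in> carrier A. \<phi> a \<in> H} R A"
  by (rule dom.submoduleI') (use cod.submodule_facts[OF assms] \<sigma>(1) in \<open>auto simp: \<phi>_smult\<close>)

lemma \<phi>_mA: "a \<in> P.mA \<Longrightarrow> \<phi> a \<in> Q.mA"
proof -
  have "P.mA \<subseteq> {a \<in> carrier A. \<phi> a \<in> Q.mA}"
    by (rule P.mA_minimal[OF submodule_vimage[OF Q.mA_submodule]]) (auto simp: \<phi>_smult)
  then show "a \<in> P.mA \<Longrightarrow> \<phi> a \<in> Q.mA" by blast
qed

lemma \<phi>_eqm: "P.eqm a b \<Longrightarrow> Q.eqm (\<phi> a) (\<phi> b)"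
  using \<phi>_mA[of "a \<ominus>\<^bsub>A\<^esub> b"] by (simp add: P.eqm_def Q.eqm_def dom.A.minus_eq cod.A.minus_eq)

text \<open>The transported maps satisfy the same congruences because \<open>\<phi>\<close> carries
  \<open>P.mA\<close> into \<open>Q.mA\<close>. Two elements of \<open>C\<close> with a common image
  would force \<open>\<one>\<close> to vanish in the fibre of \<open>A'\<close>.\<close>

lemma dual_system_transport:
  assumes C: "P.dual_system C h"
  shows "inj_on \<phi> C" "\<exists>h'. Q.dual_system (\<phi> ` C) h'"
proof -
  note C' = P.dual_systemD[OF C]
  obtain k where k: "\<And>c. c \<in> C \<Longrightarrow> k c \<in> mult_maps A'"
    "\<And>c a. \<lbrakk>c \<in> C; a \<in> carrier A\<rbrakk> \<Longrightarrow> k c (\<phi> a) = \<phi> (h c a)"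
    using mult_map_transport[OF C'(3)] by metis
  have cA: "c \<in> carrier A" if "c \<in> C" for c using C'(2) that by blast
  have k1: "Q.eqm (k c (\<phi> c)) \<one>\<^bsub>A'\<^esub>" if "c \<in> C" for c
    using \<phi>_eqm[OF C'(4)[OF that]] k(2)[OF that cA[OF that]] by simp
  have k0: "k c (\<phi> d) \<in> Q.mA" if "c \<in> C" "d \<in> C" "c \<noteq> d" for c d
    using \<phi>_mA[OF C'(5)[OF that]] k(2)[OF that(1) cA[OF that(2)]] by simp
  show inj: "inj_on \<phi> C"
  proof (rule inj_onI, rule ccontr)
    fix c d assume cd: "c \<in> C" "d \<in> C" "\<phi> c = \<phi> d" "c \<noteq> d"
    then have "\<one>\<^bsub>A'\<^esub> \<in> Q.mA" using k0[OF cd(1,2,4)] k1[OF cd(1)] Q.eqm_mA by simp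
    then show False using Q.one_notin_mA by simp
  qed
  have inv: "inv_into C \<phi> (\<phi> c) = c" if "c \<in> C" for c using inv_into_f_f[OF inj that] .
  have "Q.dual_system (\<phi> ` C) (\<lambda>b. k (inv_into C \<phi> b))"
  proof (rule Q.dual_systemI)
    show "finite (\<phi> ` C)" "\<phi> ` C \<subseteq> carrier A'" using C' cA by auto
    fix b d assume "b \<in> \<phi> ` C" "d \<in> \<phi> ` C" "b \<noteq> d"
    then obtain x y where "b = \<phi> x" "d = \<phi> y" "x \<in> C" "y \<in> C" "x \<noteq> y" by blast
    then show "k (inv_into C \<phi> b) d \<in> Q.mA" using inv k0 by simp
  qed (use inv k(1) k1 in auto)
  then show "\<exists>h'. Q.dual_system (\<phi> ` C) h'" by blast
qed

lemma \<phi>_mspan: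
  assumes "C \<subseteq> carrier A" "a \<in> P.mspan C"
  shows "\<phi> a \<in> Q.mspan (\<phi> ` C)"
proof -
  have C: "\<phi> ` C \<subseteq> carrier A'" using assms(1) by auto
  note S = cod.submodule_facts[OF Q.mspan_submodule[OF C]]
  have "P.mspan C \<subseteq> {a \<in> carrier A. \<phi> a \<in> Q.mspan (\<phi> ` C)}"
    unfolding P.mspan_def
  proof (rule dom.lin_span_minimal[OF submodule_vimage[OF Q.mspan_submodule[OF C]]])
    show "P.mA \<subseteq> {a \<in> carrier A. \<phi> a \<in> Q.mspan (\<phi> ` C)}"
      using \<phi>_mA Q.mA_subset_mspan P.mA_facts(1) by blast
    fix r c assume r: "r \<in> carrier R" and c: "c \<in> C"
    have "\<phi> c \<in> Q.mspan (\<phi> ` C)" using Q.mspan_superset[OF C] c by blast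
    then show "r \<odot>\<^bsub>A\<^esub> c \<in> {a \<in> carrier A. \<phi> a \<in> Q.mspan (\<phi> ` C)}"
      using r c assms(1) S(4)[OF \<sigma>(1)[OF r]] by (auto simp: \<phi>_smult)
  qed
  then show ?thesis using assms(2) by blast
qed

lemma full_dual_system:
  obtains C h where "P.dual_system C h" "P.mspan C = carrier A"
proof -
  have "P.dual_system {} undefined" by (rule P.dual_systemI) auto
  from P.dual_system_extend[OF this] show thesis using that by metis
qed

text \<open>Surjectivity makes the image of a spanning dual system spanning again, so both ranks are
  the size of \<open>C\<close>.\<close>

lemma local_rank_image:
  assumes "\<phi> ` carrier A = carrier A'"
  shows "local_rank R \<mm> A = local_rank R' (\<sigma> ` \<mm>) A'"
proof -
  obtain C h where C: "P.dual_system C h" "P.mspan C = carrier A" by (rule full_dual_system)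
  obtain h' where h': "Q.dual_system (\<phi> ` C) h'" using dual_system_transport(2)[OF C(1)] by blast
  have "carrier A' \<subseteq> Q.mspan (\<phi> ` C)"
  proof
    fix b assume "b \<in> carrier A'"
    then obtain a where a: "a \<in> carrier A" "b = \<phi> a" using assms by blast
    show "b \<in> Q.mspan (\<phi> ` C)"
      unfolding a(2) by (rule \<phi>_mspan[OF P.dual_systemD(2)[OF C(1)]]) (use a C(2) in simp)
  qed
  then have "Q.mspan (\<phi> ` C) = carrier A'"
    using cod.submodule_facts(1)[OF Q.mspan_submodule[OF Q.dual_systemD(2)[OF h']]] by blast
  then show ?thesis
    using P.local_rank_eq[OF C] Q.local_rank_eq[OF h'] card_image[OF dual_system_transport(1)[OF C(1)]]
    by simp
qed

text \<open>With equal ranks the image of \<open>C\<close> is itself a spanning dual system. Its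
  dual basis writes a multiple of every element of \<open>A'\<close> as a combination of images; its
  forms, pulled back to \<open>A\<close>, show that a common multiplier kills the kernel.\<close>

lemma locally_bijective:
  assumes rank: "local_rank R \<mm> A = local_rank R' (\<sigma> ` \<mm>) A'"
  shows "\<exists>t\<in>carrier R. t \<notin> \<mm> \<and> (\<forall>b\<in>carrier A'. \<sigma> t \<odot>\<^bsub>A'\<^esub> b \<in> \<phi> ` carrier A)"
    and "\<exists>t\<in>carrier R. t \<notin> \<mm> \<and> (\<forall>a\<in>carrier A. \<phi> a = \<zero>\<^bsub>A'\<^esub> \<longrightarrow> t \<odot>\<^bsub>A\<^esub> a = \<zero>\<^bsub>A\<^esub>)"
proof -
  obtain C h where C: "P.dual_system C h" "P.mspan C = carrier A" by (rule full_dual_system)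
  note C' = P.dual_systemD[OF C(1)]
  note inj = dual_system_transport(1)[OF C(1)]
  obtain h' where h': "Q.dual_system (\<phi> ` C) h'" using dual_system_transport(2)[OF C(1)] by blast
  obtain D k where D: "\<phi> ` C \<subseteq> D" "Q.dual_system D k" "Q.mspan D = carrier A'"
    using Q.dual_system_extend[OF h'] by metis
  have "card (\<phi> ` C) = card D"
    using P.local_rank_eq[OF C] Q.local_rank_eq[OF D(2,3)] rank card_image[OF inj] by simp
  \<comment> \<open>Both sets are finite of the same size and one contains the other; this is where
    equality of the ranks is used.\<close>
  then have DC: "D = \<phi> ` C"
    using card_subset_eq[OF Q.dual_systemD(1)[OF D(2)] D(1)] by simp
  obtain T' \<epsilon>' where T': "T' \<in> carrier R'" "T' \<notin> \<sigma> ` \<mm>"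
    and E': "cod.scaled_dual_basis T' D \<epsilon>'"
    by (rule Q.dual_basis[OF D(2,3)]) 
  note lf' = cod.scaled_dual_basisD(1)[OF E'] and \<epsilon>' = cod.scaled_dual_basisD(2)[OF E']
    and dual' = cod.scaled_dual_basisD(3)[OF E']
  obtain t where t: "t \<in> carrier R" "\<sigma> t = T'" using \<sigma>_surj[OF T'(1)] by blast
  have tm: "t \<notin> \<mm>" using t T'(2) by blast
  have cA: "c \<in> carrier A" if "c \<in> C" for c using C'(2) that by blast
  have "\<sigma> t \<odot>\<^bsub>A'\<^esub> b \<in> \<phi> ` carrier A" if b: "b \<in> carrier A'" for b
  proof -
    have "D \<subseteq> \<phi> ` carrier A" using DC cA by blast
    then show ?thesis unfolding t(2) dual'[OF b]
      using cod.linear_formD(1)[OF lf'] b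
      by (intro cod.submodule_lincomb[OF \<phi>_image_submodule] Q.dual_systemD(1)[OF D(2)]) auto
  qed
  then show "\<exists>t\<in>carrier R. t \<notin> \<mm> \<and> (\<forall>b\<in>carrier A'. \<sigma> t \<odot>\<^bsub>A'\<^esub> b \<in> \<phi> ` carrier A)"
    using t tm by blast
  obtain T \<epsilon> where T: "T \<in> carrier R" "T \<notin> \<mm>"
    and E: "dom.scaled_dual_basis T C \<epsilon>"
    by (rule P.dual_basis[OF C]) 
  note lf = dom.scaled_dual_basisD(1)[OF E] and dual = dom.scaled_dual_basisD(3)[OF E]
  \<comment> \<open>The form \<open>\<epsilon>' (\<phi> d)\<close> after \<open>\<phi>\<close> has
    values in \<open>R'\<close> and is semilinear; taking preimages under \<open>\<sigma>\<close>
    gives a linear form on \<open>A\<close>.\<close>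
  define \<kappa> where "\<kappa> d a = (SOME r. r \<in> carrier R \<and> \<sigma> r = \<epsilon>' (\<phi> d) (\<phi> a))" for d a
  have \<kappa>: "\<kappa> d a \<in> carrier R \<and> \<sigma> (\<kappa> d a) = \<epsilon>' (\<phi> d) (\<phi> a)" if "d \<in> C" "a \<in> carrier A" for d a
  proof -
    have "\<epsilon>' (\<phi> d) (\<phi> a) \<in> carrier R'" using cod.linear_formD(1)[OF lf'] that DC by simp
    then have "\<exists>r. r \<in> carrier R \<and> \<sigma> r = \<epsilon>' (\<phi> d) (\<phi> a)" using \<sigma>_surj by metis
    then show ?thesis unfolding \<kappa>_def by (rule someI_ex)
  qed
  have \<kappa>_eq: "\<kappa> d a = r" if "d \<in> C" "a \<in> carrier A" "r \<in> carrier R" "\<sigma> r = \<epsilon>' (\<phi> d) (\<phi> a)" for d a r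
    using \<kappa>[OF that(1,2)] that by (intro inj_onD[OF \<sigma>_inj]) auto
  have \<kappa>_form: "dom.linear_form (\<kappa> d)" if d: "d \<in> C" for d
  proof -
    have dD: "\<phi> d \<in> D" using d DC by blast
    note l = cod.linear_formD[OF lf'[OF dD]]
    show ?thesis
    proof (rule dom.linear_formI)
      fix a assume a: "a \<in> carrier A"
      show "\<kappa> d a \<in> carrier R" using \<kappa> d a by blast
      show "\<kappa> d (a \<oplus>\<^bsub>A\<^esub> b) = \<kappa> d a \<oplus>\<^bsub>R\<^esub> \<kappa> d b" if b: "b \<in> carrier A" for b
        using \<kappa>[OF d a] \<kappa>[OF d b] l(2) a b d by (intro \<kappa>_eq) auto
      show "\<kappa> d (r \<odot>\<^bsub>A\<^esub> a) = r \<otimes>\<^bsub>R\<^esub> \<kappa> d a" if r: "r \<in> carrier R" for r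
        using \<kappa>[OF d a] l(3) a d r \<sigma>(1) by (intro \<kappa>_eq) (auto simp: \<phi>_smult)
    qed
  qed
  have \<kappa>_delta: "\<kappa> d c = (if d = c then t else \<zero>\<^bsub>R\<^esub>)" if "d \<in> C" "c \<in> C" for c d
    using that \<epsilon>'[of "\<phi> d" "\<phi> c"] DC t inj_on_eq_iff[OF inj that] cA by (intro \<kappa>_eq) auto
  have "(t \<otimes>\<^bsub>R\<^esub> T) \<odot>\<^bsub>A\<^esub> a = \<zero>\<^bsub>A\<^esub>" if a: "a \<in> carrier A" and \<phi>a: "\<phi> a = \<zero>\<^bsub>A'\<^esub>" for a
  proof -
    have \<epsilon>R: "\<epsilon> c a \<in> carrier R" if "c \<in> C" for c using dom.linear_formD(1)[OF lf[OF that] a] .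
    \<comment> \<open>The pulled back form vanishes at \<open>a\<close>. Evaluated on the expansion
      of \<open>T a\<close> in \<open>C\<close>, it isolates \<open>t\<close> times the coefficient
      at \<open>d\<close>, which is therefore zero.\<close>
    have "t \<otimes>\<^bsub>R\<^esub> \<epsilon> d a = \<zero>\<^bsub>R\<^esub>" if d: "d \<in> C" for d
    proof -
      note l = dom.linear_formD[OF \<kappa>_form[OF d]]
      have "\<kappa> d a = \<zero>\<^bsub>R\<^esub>"
        using d a \<phi>a cod.linear_form_zero[OF lf'] DC by (intro \<kappa>_eq) auto
      then have "\<zero>\<^bsub>R\<^esub> = \<kappa> d (T \<odot>\<^bsub>A\<^esub> a)" using l(3)[OF T(1) a] T(1) by simp
      also have "\<dots> = \<kappa> d (\<Oplus>\<^bsub>A\<^esub>c\<in>C. \<epsilon> c a \<odot>\<^bsub>A\<^esub> c)" by (simp only: dual[OF a])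
      also have "\<dots> = (\<Oplus>\<^bsub>R\<^esub>c\<in>C. \<epsilon> c a \<otimes>\<^bsub>R\<^esub> \<kappa> d c)"
        using \<epsilon>R by (intro dom.linear_form_lincomb[OF \<kappa>_form[OF d] C'(1,2)]) auto
      also have "\<dots> = (\<Oplus>\<^bsub>R\<^esub>c\<in>C. if d = c then \<epsilon> c a \<otimes>\<^bsub>R\<^esub> t else \<zero>\<^bsub>R\<^esub>)"
        using \<epsilon>R \<kappa>_delta[OF d] t(1) by (intro dom.R.finsum_cong') auto
      also have "\<dots> = \<epsilon> d a \<otimes>\<^bsub>R\<^esub> t"
        using \<epsilon>R t(1) d C'(1) by (intro dom.R.finsum_singleton) auto
      finally show ?thesis using \<epsilon>R[OF d] t(1) by (simp add: dom.R.m_comm)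
    qed
    then have z: "t \<odot>\<^bsub>A\<^esub> (\<epsilon> c a \<odot>\<^bsub>A\<^esub> c) = \<zero>\<^bsub>A\<^esub>" if "c \<in> C" for c
      using \<epsilon>R cA t(1) that by (simp flip: dom.smult_assoc1)
    have "(t \<otimes>\<^bsub>R\<^esub> T) \<odot>\<^bsub>A\<^esub> a = t \<odot>\<^bsub>A\<^esub> (\<Oplus>\<^bsub>A\<^esub>c\<in>C. \<epsilon> c a \<odot>\<^bsub>A\<^esub> c)"
      using T(1) t(1) a by (simp only: dom.smult_assoc1 dual)
    also have "\<dots> = (\<Oplus>\<^bsub>A\<^esub>c\<in>C. t \<odot>\<^bsub>A\<^esub> (\<epsilon> c a \<odot>\<^bsub>A\<^esub> c))"
      using \<epsilon>R cA t(1) C'(1) by (intro dom.finsum_smult_ldistr) auto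
    also have "\<dots> = \<zero>\<^bsub>A\<^esub>" using z by (intro dom.A.add.finprod_one_eqI) auto
    finally show ?thesis .
  qed
  moreover have "t \<otimes>\<^bsub>R\<^esub> T \<in> carrier R" "t \<otimes>\<^bsub>R\<^esub> T \<notin> \<mm>"
    using dom.R.maximalideal_mult_notin[OF P.maximal t(1) T(1) tm T(2)] t T by auto
  ultimately show "\<exists>t\<in>carrier R. t \<notin> \<mm> \<and> (\<forall>a\<in>carrier A. \<phi> a = \<zero>\<^bsub>A'\<^esub> \<longrightarrow> t \<odot>\<^bsub>A\<^esub> a = \<zero>\<^bsub>A\<^esub>)"
    by blast
qed

end

section \<open>Gluing over all maximal ideals\<close>

context azumaya_center_iso
begin

lemma at_maximal: "maximalideal \<mm> R \<Longrightarrow> azumaya_center_iso_at A R A' R' \<phi> \<mm>"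
  by (intro azumaya_center_iso_at.intro azumaya_center_iso_axioms dom.azumaya_at)

text \<open>An element of the kernel is killed, and an element of \<open>A'\<close> is carried into
  the image, by a denominator outside each maximal ideal; such denominators generate the unit
  ideal.\<close>

lemma ring_isoI:
  assumes rank: "\<And>\<mm>. maximalideal \<mm> R \<Longrightarrow> local_rank R \<mm> A = local_rank R' (\<sigma> ` \<mm>) A'"
  shows "\<phi> \<in> ring_iso A A'"
proof -
  have ker: "a = \<zero>\<^bsub>A\<^esub>" if a: "a \<in> carrier A" "\<phi> a = \<zero>\<^bsub>A'\<^esub>" for a
  proof -
    have "a \<in> {\<zero>\<^bsub>A\<^esub>}"
    proof (rule dom.locally_in_submodule[OF dom.zero_submodule a(1)])
      fix \<mm> assume m: "maximalideal \<mm> R"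
      interpret azumaya_center_iso_at A R A' R' \<phi> \<mm> by (rule at_maximal[OF m])
      show "\<exists>s\<in>carrier R. s \<notin> \<mm> \<and> s \<odot>\<^bsub>A\<^esub> a \<in> {\<zero>\<^bsub>A\<^esub>}"
        using locally_bijective(2)[OF rank[OF m]] a by blast
    qed
    then show ?thesis by simp
  qed
  have "a_kernel A A' \<phi> = {\<zero>\<^bsub>A\<^esub>}"
  proof
    show "a_kernel A A' \<phi> \<subseteq> {\<zero>\<^bsub>A\<^esub>}" unfolding a_kernel_def' using ker by blast
    show "{\<zero>\<^bsub>A\<^esub>} \<subseteq> a_kernel A A' \<phi>"
      unfolding a_kernel_def' using hom.hom_zero dom.A.zero_closed by blast
  qed
  then have "inj_on \<phi> (carrier A)" by (rule hom.trivial_ker_imp_inj)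
  moreover have "b \<in> \<phi> ` carrier A" if b: "b \<in> carrier A'" for b
  proof -
    note S = cod.submodule_facts[OF \<phi>_image_submodule]
    \<comment> \<open>The denominators are elements of \<open>R\<close> and act on \<open>A'\<close>
      through \<open>\<sigma>\<close>, so the argument of \<open>locally_in_submodule\<close> is
      repeated with an ideal of \<open>R\<close>.\<close>
    define I where "I = {r \<in> carrier R. \<sigma> r \<odot>\<^bsub>A'\<^esub> b \<in> \<phi> ` carrier A}"
    have I: "ideal I R"
    proof (rule idealI[OF dom.R.ring_axioms dom.R.add.subgroupI])
      show "I \<subseteq> carrier R" by (auto simp: I_def)
      have "\<zero>\<^bsub>R\<^esub> \<in> I" using b S(2) by (simp add: I_def)
      then show "I \<noteq> {}" by blast
      fix r assume r: "r \<in> I"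
      show "\<ominus>\<^bsub>R\<^esub> r \<in> I" using r b \<sigma>(1) S(5) by (simp add: I_def cod.smult_l_minus)
      show "r \<oplus>\<^bsub>R\<^esub> s \<in> I" if "s \<in> I" for s
        using r that b \<sigma>(1) S(3) by (simp add: I_def cod.smult_l_distr)
    next
      fix r x assume r: "r \<in> I" and x: "x \<in> carrier R"
      have "\<sigma> x \<odot>\<^bsub>A'\<^esub> (\<sigma> r \<odot>\<^bsub>A'\<^esub> b) \<in> \<phi> ` carrier A" using r x \<sigma>(1) S(4) by (simp add: I_def)
      then show xr: "x \<otimes>\<^bsub>R\<^esub> r \<in> I" using r x b \<sigma>(1) by (simp add: I_def cod.smult_assoc1)
      show "r \<otimes>\<^bsub>R\<^esub> x \<in> I" using xr r x dom.R.m_comm[of x r] by (simp add: I_def)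
    qed
    have "I = carrier R"
    proof (rule ccontr)
      assume "I \<noteq> carrier R"
      then obtain \<mm> where m: "maximalideal \<mm> R" "I \<subseteq> \<mm>" using dom.R.exists_maximalideal[OF I] by blast
      interpret azumaya_center_iso_at A R A' R' \<phi> \<mm> by (rule at_maximal[OF m(1)])
      show False using locally_bijective(1)[OF rank[OF m(1)]] m(2) b by (auto simp: I_def)
    qed
    then have "\<one>\<^bsub>R\<^esub> \<in> I" by simp
    then show ?thesis using b by (simp add: I_def)
  qed
  ultimately show ?thesis using hom by (auto simp: ring_iso_def bij_betw_def)
qed

end

theorem theorem5p3:
  fixes R :: "('r, 'p) ring_scheme" and A :: "('r, 'a, 'q) module_scheme"
    and R' :: "('r2, 'p2) ring_scheme" and A' :: "('r2, 'a2, 'q2) module_scheme"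
    and \<phi> :: "'a \<Rightarrow> 'a2"
  assumes "azumaya_algebra R A"
    and "azumaya_algebra R' A'"
    and "\<phi> \<in> ring_hom A A'"
  shows "\<phi> \<in> ring_iso A A' \<longleftrightarrow>
    \<phi> \<in> ring_iso (center_ring A) (center_ring A') \<and>
    (\<forall>\<mm>. maximalideal \<mm> R \<longrightarrow>
       local_rank R \<mm> A = local_rank R' (corresponding_ideal A R' A' \<phi> \<mm>) A')"
proof (cases "\<phi> \<in> ring_iso (center_ring A) (center_ring A')")
  case False
  \<comment> \<open>An isomorphism restricts to an isomorphism of centers, so both sides of the
    equivalence fail here.\<close>
  then show ?thesis using ring_iso_center[of A \<phi> A'] azumaya_algebra_azumaya[OF assms(1)]
    by (auto simp: azumaya_def)
next
  case True
  interpret azumaya_center_iso A R A' R' \<phi>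
    using assms True
    by (intro azumaya_center_iso.intro azumaya_center_iso_axioms.intro azumaya_algebra_azumaya)
  have corr: "corresponding_ideal A R' A' \<phi> \<mm> = \<sigma> ` \<mm>" if "maximalideal \<mm> R" for \<mm>
    using corresponding_ideal_eq ideal.Icarr[OF maximalideal.axioms(1)[OF that]] by blast
  show ?thesis
  proof
    assume iso: "\<phi> \<in> ring_iso A A'"
    then have img: "\<phi> ` carrier A = carrier A'" by (auto simp: ring_iso_def bij_betw_def)
    have "local_rank R \<mm> A = local_rank R' (corresponding_ideal A R' A' \<phi> \<mm>) A'"
      if m: "maximalideal \<mm> R" for \<mm>
    proof -
      interpret azumaya_center_iso_at A R A' R' \<phi> \<mm> by (rule at_maximal[OF m])
      show ?thesis unfolding corr[OF m] by (rule local_rank_image[OF img])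
    qed
    then show "\<phi> \<in> ring_iso (center_ring A) (center_ring A') \<and>
      (\<forall>\<mm>. maximalideal \<mm> R \<longrightarrow>
        local_rank R \<mm> A = local_rank R' (corresponding_ideal A R' A' \<phi> \<mm>) A')"
      using True by blast
  next
    assume "\<phi> \<in> ring_iso (center_ring A) (center_ring A') \<and>
      (\<forall>\<mm>. maximalideal \<mm> R \<longrightarrow>
        local_rank R \<mm> A = local_rank R' (corresponding_ideal A R' A' \<phi> \<mm>) A')"
    then show "\<phi> \<in> ring_iso A A'" using corr by (intro ring_isoI) simp
  qed
qed

end
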